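(* Let $f:\mathbb{R}\to\mathbb{R}$ be a $C^2$ strictly convex function with $\lim_{|u|\to\infty} f(u)/|u|=\infty$, let $\alpha\in L^\infty([0,\infty);\mathbb{R})$, $\beta(t)=\int_0^t\alpha(\theta)\,d\theta$, $u_0\in L^\infty([0,\infty))$ and $u_b\in BV([0,\infty))$. With the objects $h$, $A$, $B$, $y_*,y^*,\tau_*,\tau^*$ and the characteristic triangles defined in the context, let $t_1>0$ be fixed. For each $(x_1,t_1)$ there exists a unique Lipschitz continuous curve $x=X(t)$ with $X(t_1)=x_1$ such that the characteristic triangles associated with each point on the curve form an increasing family of triangles, and for any point $(x,t)$, $t\ge t_1$, on the curve, the limit $$D:=\lim_{t'',t'\to t}\frac{X(t'')-X(t')}{t''-t'}$$ satisfies: (i) When $A(x,t)<B(x,t)$: $$D=\begin{cases} f'\big(h(x-y(x,t),t)e^{\beta(t)}\big) & \text{if } y_*(x,t)=y^*(x,t)=:y(x,t),\\[2mm] \dfrac{f\big(h(x-y_*(x,t),t)e^{\beta(t)}\big)-f\big(h(x-y^*(x,t),t)e^{\beta(t)}\big)}{h(x-y_*(x,t),t)e^{\beta(t)}-h(x-y^*(x,t),t)e^{\beta(t)}} & \text{if } y_*(x,t)<y^*(x,t).\end{cases}$$ (ii) When $B(x,t)<A(x,t)$: $$D=\begin{cases} f'\big(h(x,t,\tau(x,t))e^{\beta(t)}\big) & \text{if } \tau_*(x,t)=\tau^*(x,t)=:\tau(x,t),\\[2mm] \dfrac{f\big(h(x,t,\tau_*(x,t))e^{\beta(t)}\big)-f\big(h(x,t,\tau^*(x,t))e^{\beta(t)}\big)}{h(x,t,\tau_*(x,t))e^{\beta(t)}-h(x,t,\tau^*(x,t))e^{\beta(t)}}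 & \text{if } \tau_*(x,t)<\tau^*(x,t).\end{cases}$$ (iii) When $A(x,t)=B(x,t)$ and $y^*(x,t)\ne0$ or $\tau^*(x,t)\ne0$: $$D=\frac{f\big(h(x-y^*(x,t),t)e^{\beta(t)}\big)-f\big(h(x,t,\tau^*(x,t))e^{\beta(t)}\big)}{h(x-y^*(x,t),t)e^{\beta(t)}-h(x,t,\tau^*(x,t))e^{\beta(t)}}.$$ (iv) When $A(x,t)=B(x,t)$ and both $y^*(x,t)=0$ and $\tau^*(x,t)=0$: $$D=f'\big(h(x,t)e^{\beta(t)}\big).$$
   Context: Notation. $f^*(p)=\max_{v\in\mathbb{R}}\{pv-f(v)\}$; $\lambda_f$ is the point where $f'$ changes sign; $\bar u_b(t)=\max\{u_b(t),\lambda_f\}$. The function $h$ and $h$-curves. An $h$-curve joining $(x_1,t_1)$ and $(x_2,t_2)$, $0\le t_2<t_1$, is a curve $X$ with $X(t_1)=x_1$, $X(t_2)=x_2$ and $\dot X(\theta)=f'(y_0e^{\beta(\theta)})$ for a (unique) $y_0\in\mathbb{R}$. For $x_2=0$ this $y_0$ is denoted $h(x_1,t_1,t_2)$; for $t_2=0$ it is denoted $h(x_1-x_2,t_1)$. Value function. For $x\ge0$, $t\ge 0$ let $\Gamma(x,t)$ be the set of Lipschitz functions $\gamma:[0,t]\to[0,\infty)$ with $\gamma(t)=x$, and $$J(\gamma,x,t)=\int_{\{\gamma(\theta)\ne0\}}f^*(\dot\gamma(\theta))e^{-\beta(\theta)}d\theta-\int_{\{\gamma(\theta)=0\}}f(\bar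 u_b(\theta))e^{-\beta(\theta)}d\theta+\int_0^{\gamma(0)}u_0(y)\,dy .$$ Then $W(x,t)=\inf_{\gamma\in\Gamma(x,t)}J(\gamma,x,t)$. Initial and boundary functionals. Let $$H_A(x,t)=\Big\{y:\ y+\int_0^\tau f'(h(x-y,t)e^{\beta(\theta)})d\theta\ge0\ \text{ for } 0\le\tau\le t\Big\},$$ $$H_B(x,t)=\Big\{\tau:\ \int_\tau^s f'(h(x,t,\tau)e^{\beta(\theta)})d\theta\ge0\ \text{ for } 0\le\tau\le s\le t\Big\}.$$ For $y\in H_A(x,t)$, $A(y,x,t)=\int_0^te^{-\beta(\theta)}f^*(f'(h(x-y,t)e^{\beta(\theta)}))d\theta+\int_0^yu_0(\theta)d\theta$, and for $\tau\in H_B(x,t)$, $B(\tau,x,t)=\int_\tau^te^{-\beta(\theta)}f^*(f'(h(x,t,\tau)e^{\beta(\theta)}))d\theta+W(0,\tau)$. Put $A(x,t)=\min_{y\in H_A(x,t)}A(y,x,t)$, $B(x,t)=\min_{\tau\in H_B(x,t)}B(\tau,x,t)$; $y_*(x,t)\le y^*(x,t)$ are the smallest and largest minimizers of $A(\cdot,x,t)$, and $\tau_*(x,t)\le\tau^*(x,t)$ the smallest and largest minimizers of $B(\cdot,x,t)$. Characteristic triangles. For $x\ge0$, $t>0$ the characteristic triangle $\Delta(x,t)$ is: (1) if $A(x,t)<B(x,t)$, the region bounded by the $h$-curves joining $(x,t)$ to $(y_*(x,t),0)$ and to $(y^*(x,t),0)$ (and the $x$-axis); (2) if $A(x,t)>B(x,t)$,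 the region bounded by the $h$-curves joining $(x,t)$ to $(0,\tau_*(x,t))$ and to $(0,\tau^*(x,t))$ (and the $t$-axis); (3) if $A(x,t)=B(x,t)$, the region, including the point $(0,0)$, bounded by the $h$-curve joining $(x,t)$ to $(y^*(x,t),0)$, the $h$-curve joining $(x,t)$ to $(0,\tau^*(x,t))$ and the axes; (4) at a boundary point with $A(0,t)<B(0,t)$, the region bounded by the $h$-curve $\gamma:[0,t]\to[0,\infty)$ joining $(0,t)$ to $(y^*(0,t),0)$, with $\gamma(\theta)>0$ for all $\theta\in[0,t)$ (and the axes). "Increasing family" means increasing with respect to inclusion as $t$ increases along the curve.
   Formalization: Proved for x₁>0, with the limit D taken from the right (t',t''≥t) and the speed formulas only at points with x>0; where the two states in a quotient coincide it is read as f'; Lipschitz means Lipschitz on each bounded time interval. *)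

theory Defs
  imports "HOL-Analysis.Analysis"
begin

section \<open>Data\<close>

definition strictly_convex :: "(real \<Rightarrow> real) \<Rightarrow> bool" where
  "strictly_convex f \<longleftrightarrow>
     (\<forall>x y s. x \<noteq> y \<and> 0 < s \<and> s < 1 \<longrightarrow> f ((1 - s) * x + s * y) < (1 - s) * f x + s * f y)"

definition C2_fun :: "(real \<Rightarrow> real) \<Rightarrow> bool" where
  "C2_fun f \<longleftrightarrow>
     (\<forall>x. f differentiable (at x)) \<and> (\<forall>x. deriv f differentiable (at x)) \<and>
     continuous_on UNIV (deriv (deriv f))"

text \<open>Functions on the half-line \<open>[0,\<infinity>)\<close> are functions on the reals whose values at negative
  arguments are irrelevant.\<close>

definition Linf_halfline :: "(real \<Rightarrow> real) \<Rightarrow> bool" where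
  "Linf_halfline g \<longleftrightarrow>
     g \<in> borel_measurable (lebesgue_on {0..}) \<and> (\<exists>M. AE x in lebesgue_on {0..}. \<bar>g x\<bar> \<le> M)"

definition BV_halfline :: "(real \<Rightarrow> real) \<Rightarrow> bool" where
  "BV_halfline g \<longleftrightarrow>
     (\<exists>V. \<forall>(n::nat) s. mono s \<and> 0 \<le> s 0 \<longrightarrow> (\<Sum>i<n. \<bar>g (s (Suc i)) - g (s i)\<bar>) \<le> V)"

definition beta :: "(real \<Rightarrow> real) \<Rightarrow> real \<Rightarrow> real" where
  "beta \<alpha> t = integral {0..t} \<alpha>"

definition fstar :: "(real \<Rightarrow> real) \<Rightarrow> real \<Rightarrow> real" where
  "fstar f p = (SUP v. p * v - f v)"

definition lam :: "(real \<Rightarrow> real) \<Rightarrow> real" where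
  "lam f = (THE l. (\<forall>v<l. deriv f v < 0) \<and> (\<forall>v>l. 0 < deriv f v))"

definition ubar :: "(real \<Rightarrow> real) \<Rightarrow> (real \<Rightarrow> real) \<Rightarrow> real \<Rightarrow> real" where
  "ubar f ub t = max (ub t) (lam f)"

section \<open>\<open>h\<close>-curves\<close>

definition is_h_curve ::
  "(real \<Rightarrow> real) \<Rightarrow> (real \<Rightarrow> real) \<Rightarrow> real \<Rightarrow> real \<Rightarrow> real \<Rightarrow> real \<Rightarrow> real \<Rightarrow> (real \<Rightarrow> real) \<Rightarrow> bool" where
  "is_h_curve f \<alpha> x1 t1 x2 t2 y0 X \<longleftrightarrow>
     X t1 = x1 \<and> X t2 = x2 \<and>
     (\<forall>\<theta>\<in>{t2..t1}.
        (X has_real_derivative deriv f (y0 * exp (beta \<alpha> \<theta>))) (at \<theta> within {t2..t1}))"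

text \<open>The parameter \<open>y0\<close> of the \<open>h\<close>-curve joining \<open>(x1,t1)\<close> and \<open>(x2,t2)\<close>; meaningful only for
  \<open>0 \<le> t2 < t1\<close>.\<close>

definition h_gen ::
  "(real \<Rightarrow> real) \<Rightarrow> (real \<Rightarrow> real) \<Rightarrow> real \<Rightarrow> real \<Rightarrow> real \<Rightarrow> real \<Rightarrow> real" where
  "h_gen f \<alpha> x1 t1 x2 t2 = (THE y0. \<exists>X. is_h_curve f \<alpha> x1 t1 x2 t2 y0 X)"

text \<open>\<open>hB f \<alpha> x t \<tau>\<close> is \<open>h(x,t,\<tau>)\<close>. \<open>hA f \<alpha> z t\<close> is the two-argument \<open>h(z,t)\<close>: \<open>h\<close>-curves are
  translation invariant in space, so the parameter of the curve joining \<open>(x,t)\<close> and \<open>(y,0)\<close>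
  depends on \<open>x - y\<close> only.\<close>

definition hB :: "(real \<Rightarrow> real) \<Rightarrow> (real \<Rightarrow> real) \<Rightarrow> real \<Rightarrow> real \<Rightarrow> real \<Rightarrow> real" where
  "hB f \<alpha> x t \<tau> = h_gen f \<alpha> x t 0 \<tau>"

definition hA :: "(real \<Rightarrow> real) \<Rightarrow> (real \<Rightarrow> real) \<Rightarrow> real \<Rightarrow> real \<Rightarrow> real" where
  "hA f \<alpha> z t = h_gen f \<alpha> z t 0 0"

text \<open>The \<open>h\<close>-curves joining \<open>(x,t)\<close> to \<open>(y,0)\<close> and to \<open>(0,\<tau>)\<close>.\<close>

definition curveA ::
  "(real \<Rightarrow> real) \<Rightarrow> (real \<Rightarrow> real) \<Rightarrow> real \<Rightarrow> real \<Rightarrow> real \<Rightarrow> real \<Rightarrow> real" where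
  "curveA f \<alpha> x t y \<theta> = y + integral {0..\<theta>} (\<lambda>\<sigma>. deriv f (hA f \<alpha> (x - y) t * exp (beta \<alpha> \<sigma>)))"

definition curveB ::
  "(real \<Rightarrow> real) \<Rightarrow> (real \<Rightarrow> real) \<Rightarrow> real \<Rightarrow> real \<Rightarrow> real \<Rightarrow> real \<Rightarrow> real" where
  "curveB f \<alpha> x t \<tau> \<theta> = integral {\<tau>..\<theta>} (\<lambda>\<sigma>. deriv f (hB f \<alpha> x t \<tau> * exp (beta \<alpha> \<sigma>)))"

section \<open>Value function\<close>

definition Gam :: "real \<Rightarrow> real \<Rightarrow> (real \<Rightarrow> real) set" where
  "Gam x t = {\<gamma>. (\<exists>L. L-lipschitz_on {0..t} \<gamma>) \<and> \<gamma> ` {0..t} \<subseteq> {0..} \<and> \<gamma> t = x}"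

definition J ::
  "(real \<Rightarrow> real) \<Rightarrow> (real \<Rightarrow> real) \<Rightarrow> (real \<Rightarrow> real) \<Rightarrow> (real \<Rightarrow> real) \<Rightarrow> (real \<Rightarrow> real) \<Rightarrow> real \<Rightarrow> real" where
  "J f \<alpha> u0 ub \<gamma> t =
     integral {\<theta>\<in>{0..t}. \<gamma> \<theta> \<noteq> 0} (\<lambda>\<theta>. fstar f (deriv \<gamma> \<theta>) * exp (- beta \<alpha> \<theta>))
     - integral {\<theta>\<in>{0..t}. \<gamma> \<theta> = 0} (\<lambda>\<theta>. f (ubar f ub \<theta>) * exp (- beta \<alpha> \<theta>))
     + integral {0..\<gamma> 0} u0"

definition W ::
  "(real \<Rightarrow> real) \<Rightarrow> (real \<Rightarrow> real) \<Rightarrow> (real \<Rightarrow> real) \<Rightarrow> (real \<Rightarrow> real) \<Rightarrow> real \<Rightarrow> real \<Rightarrow> real" where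
  "W f \<alpha> u0 ub x t = (INF \<gamma>\<in>Gam x t. J f \<alpha> u0 ub \<gamma> t)"

section \<open>Initial and boundary functionals\<close>

definition HA :: "(real \<Rightarrow> real) \<Rightarrow> (real \<Rightarrow> real) \<Rightarrow> real \<Rightarrow> real \<Rightarrow> real set" where
  "HA f \<alpha> x t =
     {y. \<forall>\<tau>\<in>{0..t}. 0 \<le> y + integral {0..\<tau>} (\<lambda>\<theta>. deriv f (hA f \<alpha> (x - y) t * exp (beta \<alpha> \<theta>)))}"

text \<open>For \<open>\<tau> = t\<close> an \<open>h\<close>-curve from \<open>(0,\<tau>)\<close> to \<open>(x,t)\<close> exists only if \<open>x = 0\<close>; it is then
  the trivial one-point curve. Its parameter \<open>hB f \<alpha> 0 t t\<close> is not determined, but occurs below only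
  under integrals over \<open>{t..t}\<close>; in particular \<open>funB f \<alpha> u0 ub t 0 t = W f \<alpha> u0 ub 0 t\<close>.
  So at \<open>x = 0\<close> the largest minimizer of \<open>B\<close> is \<open>t\<close>, and a formula containing
  \<open>h(x,t,\<tau>\<^sup>*)\<close> makes sense only for \<open>x > 0\<close>.\<close>

definition HB :: "(real \<Rightarrow> real) \<Rightarrow> (real \<Rightarrow> real) \<Rightarrow> real \<Rightarrow> real \<Rightarrow> real set" where
  "HB f \<alpha> x t =
     {\<tau>. 0 \<le> \<tau> \<and> \<tau> \<le> t \<and> (\<tau> = t \<longrightarrow> x = 0) \<and>
         (\<forall>s\<in>{\<tau>..t}. 0 \<le> integral {\<tau>..s} (\<lambda>\<theta>. deriv f (hB f \<alpha> x t \<tau> * exp (beta \<alpha> \<theta>))))}"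

definition funA ::
  "(real \<Rightarrow> real) \<Rightarrow> (real \<Rightarrow> real) \<Rightarrow> (real \<Rightarrow> real) \<Rightarrow> real \<Rightarrow> real \<Rightarrow> real \<Rightarrow> real" where
  "funA f \<alpha> u0 y x t =
     integral {0..t}
       (\<lambda>\<theta>. exp (- beta \<alpha> \<theta>) * fstar f (deriv f (hA f \<alpha> (x - y) t * exp (beta \<alpha> \<theta>))))
     + integral {0..y} u0"

definition funB ::
  "(real \<Rightarrow> real) \<Rightarrow> (real \<Rightarrow> real) \<Rightarrow> (real \<Rightarrow> real) \<Rightarrow> (real \<Rightarrow> real) \<Rightarrow> real \<Rightarrow> real \<Rightarrow> real \<Rightarrow> real" where
  "funB f \<alpha> u0 ub \<tau> x t =
     integral {\<tau>..t}
       (\<lambda>\<theta>. exp (- beta \<alpha> \<theta>) * fstar f (deriv f (hB f \<alpha> x t \<tau> * exp (beta \<alpha> \<theta>))))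
     + W f \<alpha> u0 ub 0 \<tau>"

definition minA ::
  "(real \<Rightarrow> real) \<Rightarrow> (real \<Rightarrow> real) \<Rightarrow> (real \<Rightarrow> real) \<Rightarrow> real \<Rightarrow> real \<Rightarrow> real" where
  "minA f \<alpha> u0 x t = (INF y\<in>HA f \<alpha> x t. funA f \<alpha> u0 y x t)"

definition minB ::
  "(real \<Rightarrow> real) \<Rightarrow> (real \<Rightarrow> real) \<Rightarrow> (real \<Rightarrow> real) \<Rightarrow> (real \<Rightarrow> real) \<Rightarrow> real \<Rightarrow> real \<Rightarrow> real" where
  "minB f \<alpha> u0 ub x t = (INF \<tau>\<in>HB f \<alpha> x t. funB f \<alpha> u0 ub \<tau> x t)"

definition minimizerA ::
  "(real \<Rightarrow> real) \<Rightarrow> (real \<Rightarrow> real) \<Rightarrow> (real \<Rightarrow> real) \<Rightarrow> real \<Rightarrow> real \<Rightarrow> real \<Rightarrow> bool" where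
  "minimizerA f \<alpha> u0 x t = is_arg_min (\<lambda>y. funA f \<alpha> u0 y x t) (\<lambda>y. y \<in> HA f \<alpha> x t)"

definition minimizerB ::
  "(real \<Rightarrow> real) \<Rightarrow> (real \<Rightarrow> real) \<Rightarrow> (real \<Rightarrow> real) \<Rightarrow> (real \<Rightarrow> real) \<Rightarrow> real \<Rightarrow> real \<Rightarrow> real \<Rightarrow> bool" where
  "minimizerB f \<alpha> u0 ub x t = is_arg_min (\<lambda>\<tau>. funB f \<alpha> u0 ub \<tau> x t) (\<lambda>\<tau>. \<tau> \<in> HB f \<alpha> x t)"

definition y_low ::
  "(real \<Rightarrow> real) \<Rightarrow> (real \<Rightarrow> real) \<Rightarrow> (real \<Rightarrow> real) \<Rightarrow> real \<Rightarrow> real \<Rightarrow> real" where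
  "y_low f \<alpha> u0 x t = (LEAST y. minimizerA f \<alpha> u0 x t y)"

definition y_up ::
  "(real \<Rightarrow> real) \<Rightarrow> (real \<Rightarrow> real) \<Rightarrow> (real \<Rightarrow> real) \<Rightarrow> real \<Rightarrow> real \<Rightarrow> real" where
  "y_up f \<alpha> u0 x t = (GREATEST y. minimizerA f \<alpha> u0 x t y)"

definition tau_low ::
  "(real \<Rightarrow> real) \<Rightarrow> (real \<Rightarrow> real) \<Rightarrow> (real \<Rightarrow> real) \<Rightarrow> (real \<Rightarrow> real) \<Rightarrow> real \<Rightarrow> real \<Rightarrow> real" where
  "tau_low f \<alpha> u0 ub x t = (LEAST \<tau>. minimizerB f \<alpha> u0 ub x t \<tau>)"

definition tau_up ::
  "(real \<Rightarrow> real) \<Rightarrow> (real \<Rightarrow> real) \<Rightarrow> (real \<Rightarrow> real) \<Rightarrow> (real \<Rightarrow> real) \<Rightarrow> real \<Rightarrow> real \<Rightarrow> real" where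
  "tau_up f \<alpha> u0 ub x t = (GREATEST \<tau>. minimizerB f \<alpha> u0 ub x t \<tau>)"

section \<open>Characteristic triangles\<close>

text \<open>Closed regions, as sets of points \<open>(\<xi>,\<theta>)\<close> (space, time), described by their time slices.
  Below its foot \<open>(0,\<tau>)\<close> the \<open>h\<close>-curve bounding a region on the left is continued by the \<open>t\<close>-axis.
  The second branch is the one for points of the boundary \<open>x = 0\<close>: there the \<open>t\<close>-axis, and not the
  curve to \<open>(y_low,0)\<close>, bounds the region on the left.\<close>

definition char_triangle ::
  "(real \<Rightarrow> real) \<Rightarrow> (real \<Rightarrow> real) \<Rightarrow> (real \<Rightarrow> real) \<Rightarrow> (real \<Rightarrow> real) \<Rightarrow> real \<Rightarrow> real \<Rightarrow> (real \<times> real) set" where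
  "char_triangle f \<alpha> u0 ub x t =
    (let a = minA f \<alpha> u0 x t; b = minB f \<alpha> u0 ub x t;
         y1 = y_low f \<alpha> u0 x t; y2 = y_up f \<alpha> u0 x t;
         s1 = tau_low f \<alpha> u0 ub x t; s2 = tau_up f \<alpha> u0 ub x t;
         leftB = (\<lambda>\<theta>. if \<theta> \<le> s2 then 0 else curveB f \<alpha> x t s2 \<theta>)
     in if a < b \<and> x \<noteq> 0 then
          {(\<xi>, \<theta>). 0 \<le> \<theta> \<and> \<theta> \<le> t \<and> curveA f \<alpha> x t y1 \<theta> \<le> \<xi> \<and> \<xi> \<le> curveA f \<alpha> x t y2 \<theta>}
        else if a < b then
          {(\<xi>, \<theta>). 0 \<le> \<theta> \<and> \<theta> \<le> t \<and> 0 \<le> \<xi> \<and> \<xi> \<le> curveA f \<alpha> x t y2 \<theta>}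
        else if b < a then
          {(\<xi>, \<theta>). s1 \<le> \<theta> \<and> \<theta> \<le> t \<and> leftB \<theta> \<le> \<xi> \<and> \<xi> \<le> curveB f \<alpha> x t s1 \<theta>}
        else
          {(\<xi>, \<theta>). 0 \<le> \<theta> \<and> \<theta> \<le> t \<and> leftB \<theta> \<le> \<xi> \<and> \<xi> \<le> curveA f \<alpha> x t y2 \<theta>})"

text \<open>A curve in the closed quarter plane, issuing from \<open>(x1,t1)\<close> and running forward in time, along
  which the characteristic triangles increase. Speeds may grow without bound as \<open>t\<close> tends to infinity
  (for instance like \<open>exp t\<close> for \<open>f u = u\<^sup>2 / 2\<close>, \<open>\<alpha> = 1\<close>), so Lipschitz continuity is required on
  bounded time intervals.\<close>

definition increasing_triangle_curve ::
  "(real \<Rightarrow> real) \<Rightarrow> (real \<Rightarrow> real) \<Rightarrow> (real \<Rightarrow> real) \<Rightarrow> (real \<Rightarrow> real) \<Rightarrow> real \<Rightarrow> real \<Rightarrow> (real \<Rightarrow> real) \<Rightarrow> bool" where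
  "increasing_triangle_curve f \<alpha> u0 ub x1 t1 X \<longleftrightarrow>
     X t1 = x1 \<and> (\<forall>t\<ge>t1. 0 \<le> X t) \<and> (\<forall>T. \<exists>L. L-lipschitz_on {t1..T} X) \<and>
     (\<forall>s t. t1 \<le> s \<and> s \<le> t \<longrightarrow> char_triangle f \<alpha> u0 ub (X s) s \<subseteq> char_triangle f \<alpha> u0 ub (X t) t)"

section \<open>Speed of the curve\<close>

text \<open>\<open>(X t'' - X t') / (t'' - t') \<longlongrightarrow> D\<close> as \<open>t''\<close> and \<open>t'\<close> tend to \<open>t\<close> independently, both from the right
  (either may equal \<open>t\<close>). The curve runs forward in time; where two shocks merge, the difference
  quotients from the left tend to the speed of the incoming shock instead.\<close>

definition has_forward_speed :: "(real \<Rightarrow> real) \<Rightarrow> real \<Rightarrow> real \<Rightarrow> bool" where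
  "has_forward_speed X D t \<longleftrightarrow>
     ((\<lambda>(t'', t'). (X t'' - X t') / (t'' - t')) \<longlongrightarrow> D)
       (at (t, t) within {(t'', t'). t \<le> t'' \<and> t \<le> t' \<and> t'' \<noteq> t'})"

text \<open>The quotient \<open>(f a - f b) / (a - b)\<close>, with its limit \<open>f' a\<close> in place of \<open>0 / 0\<close>. The two states
  coincide if an \<open>h\<close>-curve touches the \<open>t\<close>-axis tangentially: both feet then lie on one \<open>h\<close>-curve.\<close>

definition shock_speed :: "(real \<Rightarrow> real) \<Rightarrow> real \<Rightarrow> real \<Rightarrow> real" where
  "shock_speed f a b = (if a = b then deriv f a else (f a - f b) / (a - b))"

end

theory Submission
  imports Defs
begin

text \<open>
  The value function \<open>W\<close> is Lipschitz and equals the smaller of \<open>A\<close> and \<open>B\<close> off the boundary. The minimizers of \<open>A\<close> and \<open>B\<close> thus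
  are the feet of those \<open>h\<close>-curves (here called extremal) along which \<open>W\<close> is attained, and the characteristic triangle of
  \<open>(x,t)\<close> lies between the two outermost of them. By strict convexity, cutting a corner lowers the cost;
  hence two different extremal curves cannot meet at a time at which one of them has not ended and the other one has already started.

  Consequently \<open>(x\<^sub>1,t\<^sub>1)\<close> lies in the triangle of exactly one point \<open>(X(t),t)\<close> for every \<open>t \<ge> t\<^sub>1\<close>: at most one because extremal
  curves do not cross, at least one because the points whose outermost curve passes at time \<open>t\<^sub>1\<close> to the right (left) of \<open>x\<^sub>1\<close>
  form closed sets covering \<open>[0,\<infinity>)\<close>. Non-crossing also makes the triangles along \<open>X\<close> increase.

  For the speed, the parameters \<open>c\<close> of the outermost curves of \<open>(X(t),t)\<close> converge to those of \<open>(X(t\<^sub>0),t\<^sub>0)\<close> as \<open>t\<close> decreases to \<open>t\<^sub>0\<close>,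
  and the increment of \<open>W\<close> along \<open>X\<close> is, up to \<open>o(t''-t')\<close>, equal to
  \<open>c (X(t'')-X(t')) - (t''-t') exp(-\<beta>(t\<^sub>0)) f(c exp(\<beta>(t\<^sub>0)))\<close> for both limits \<open>c\<close>. Comparing the two expressions yields the
  Rankine-Hugoniot quotient.
\<close>

subsection \<open>Lipschitz functions are differentiable almost everywhere\<close>

text \<open>Along an h-curve the number \<open>c\<close> is a conserved momentum: exp(-\<beta>) f(c
  exp(\<beta>)) is convex in \<open>c\<close> with derivative f'(c exp(\<beta>)), so the cost of an
  h-curve is the Legendre transform of the integrated flux \<open>G\<close> at the displacement.
  Hence, for any \<open>k\<close>, moving away from the axis costs at least \<open>k\<close> times
  the displacement minus \<open>G\<close>, and an h-curve with another parameter costs strictly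
  more. The Lipschitz bounds, the bounds on parameters, the cutting of corners and the expansion of
  the value function along the curve all come from this one inequality with a suitable
  \<open>k\<close>. The obstacle is the t-axis. A path may rest there, and the inequality then also
  asks that the boundary rate be dominated by the flux at \<open>k\<close>, which is arranged by
  very large |k|; moreover an h-curve may touch the axis or leave the quarter plane. Competing paths
  are only Lipschitz, so the inequality holds at almost every time and has to be integrated: this is
  why differentiation almost everywhere comes first.\<close>

definition slow_points :: "(real \<Rightarrow> real) \<Rightarrow> real \<Rightarrow> real set" where
  "slow_points F p = {x. \<forall>n::nat. \<exists>h. h \<noteq> 0 \<and> \<bar>h\<bar> < 1 / real (Suc n) \<and> (F (x + h) - F x) / h < p}"

definition fast_points :: "(real \<Rightarrow> real) \<Rightarrow> real \<Rightarrow> real set" where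
  "fast_points F q = {x. \<forall>n::nat. \<exists>h. h \<noteq> 0 \<and> \<bar>h\<bar> < 1 / real (Suc n) \<and> q < (F (x + h) - F x) / h}"

text \<open>The union over the steps \<open>h\<close> is uncountable, but for fixed \<open>h\<close>
  continuity of \<open>F\<close> makes the condition open; both sets are therefore countable
  intersections of open sets.\<close>

lemma slow_points_borel:
  assumes "continuous_on UNIV F"
  shows "slow_points F p \<in> sets borel" "fast_points F p \<in> sets borel"
proof -
  have c: "continuous_on UNIV (\<lambda>x. (F (x + h) - F x) / h)" for h
    by (cases "h = 0") (simp_all add: continuous_on_divide continuous_on_diff continuous_on_compose2[OF assms] continuous_on_add continuous_on_id continuous_on_const assms)
  have "open {x. (F (x + h) - F x) / h < p}" "open {x. p < (F (x + h) - F x) / h}" for h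
    using c[of h] by (auto intro!: open_Collect_less continuous_intros)
  then have o: "open (\<Union>h\<in>{h. h \<noteq> 0 \<and> \<bar>h\<bar> < 1 / real (Suc n)}. {x. (F (x + h) - F x) / h < p})"
     "open (\<Union>h\<in>{h. h \<noteq> 0 \<and> \<bar>h\<bar> < 1 / real (Suc n)}. {x. p < (F (x + h) - F x) / h})" for n :: nat
    by blast+
  have "slow_points F p = (\<Inter>n::nat. \<Union>h\<in>{h. h \<noteq> 0 \<and> \<bar>h\<bar> < 1 / real (Suc n)}. {x. (F (x + h) - F x) / h < p})"
    "fast_points F p = (\<Inter>n::nat. \<Union>h\<in>{h. h \<noteq> 0 \<and> \<bar>h\<bar> < 1 / real (Suc n)}. {x. p < (F (x + h) - F x) / h})"
    by (simp_all add: slow_points_def fast_points_def set_eq_iff Bex_def conj_assoc)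
  then show "slow_points F p \<in> sets borel" "fast_points F p \<in> sets borel"
    using o by (auto intro!: sets.countable_INT'' borel_open)
qed

text \<open>Vitali's theorem is applied in the image: the intervals from \<open>F a\<close> to
  \<open>F b\<close> with \<open>F b - F a < p * (b - a)\<close> cover the image of \<open>E\<close>
  finely, so a disjoint subfamily exhausts it up to a null set. Their preimages are disjoint as well
  and lie in an open set barely larger than \<open>E\<close>.\<close>

lemma bilip_image_slow:
  fixes F :: "real \<Rightarrow> real"
  assumes m: "0 < m" and lo: "\<And>x y. x \<le> y \<Longrightarrow> m * (y - x) \<le> F y - F x"
    and hi: "\<And>x y. x \<le> y \<Longrightarrow> F y - F x \<le> M * (y - x)"
    and E: "E \<in> sets borel" "bounded E" "E \<subseteq> slow_points F p" and p: "0 < p"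
  shows "emeasure lebesgue (F ` E) \<le> ennreal p * emeasure lebesgue E"
proof -
  have Em: "E \<in> lmeasurable"
    using E by (simp add: bounded_set_imp_lmeasurable)
  have Mpos: "0 < M" using lo[of 0 1] hi[of 0 1] m by simp
  have strict: "F x < F y" if "x < y" for x y
    using lo[of x y] that m by (smt (verit) mult_pos_pos)
  have "emeasure lebesgue (F ` E) \<le> ennreal p * emeasure lebesgue E + ennreal e" if e: "0 < e" for e
  proof -
    \<comment> \<open>The excess \<open>e / p\<close> becomes \<open>e\<close> after the final
      multiplication by \<open>p\<close>.\<close>
    obtain O' where O': "open O'" "E \<subseteq> O'" "O' - E \<in> lmeasurable" "emeasure lebesgue (O' - E) < ennreal (e / p)"
      using sets_lebesgue_outer_open[of E "e / p"] Em e p by (metis divide_pos_pos fmeasurableD)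
    define K where "K = {(a, b). a < b \<and> {a..b} \<subseteq> O' \<and> F b - F a < p * (b - a)}"
    define ctr where "ctr = (\<lambda>(a, b). (F a + F b) / 2)"
    define rad where "rad = (\<lambda>(a, b). (F b - F a) / 2)"
    have cb: "cball (ctr k) (rad k) = {F (fst k)..F (snd k)}" for k
      by (auto simp: ctr_def rad_def cball_eq_atLeastAtMost split: prod.splits) (auto simp: field_simps)
    \<comment> \<open>Fineness of the cover: the steps that witness slowness are arbitrarily short,
      and the upper slope bound \<open>M\<close> carries this over to the image intervals.\<close>
    have cov: "\<exists>k. k \<in> K \<and> y \<in> cball (ctr k) (rad k) \<and> rad k < d" if y: "y \<in> F ` E" and d: "0 < d" for y d
    proof -
      obtain x where x: "x \<in> E" "y = F x" using y by auto
      obtain r where r: "0 < r" "ball x r \<subseteq> O'" using O' x by (meson openE subsetD)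
      obtain n :: nat where n: "1 / real (Suc n) < min r (d / M)"
        using r d Mpos nat_approx_posE[of "min r (d / M)"] by (metis divide_pos_pos min_less_iff_conj)
      obtain h where h: "h \<noteq> 0" "\<bar>h\<bar> < 1 / real (Suc n)" "(F (x + h) - F x) / h < p"
        using x E(3) unfolding slow_points_def by blast
      define a b where "a = min x (x + h)" and "b = max x (x + h)"
      have ab: "a < b" "b - a = \<bar>h\<bar>" "a \<le> x" "x \<le> b" using h(1) by (auto simp: a_def b_def)
      have "F b - F a < p * (b - a)"
        using h by (cases "h > 0") (auto simp: a_def b_def field_simps min_def max_def split: if_splits)
      moreover have "{a..b} \<subseteq> O'"
        using r(2) ab h(2) n by (auto simp: subset_iff dist_real_def a_def b_def)
      ultimately have "(a, b) \<in> K" using ab by (simp add: K_def)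
      moreover have "y \<in> cball (ctr (a, b)) (rad (a, b))"
        unfolding cb x(2) using ab strict by (simp add: order.order_iff_strict) (metis)
      moreover have "rad (a, b) < d"
      proof -
        have "F b - F a \<le> M * \<bar>h\<bar>" using hi[of a b] ab by simp
        also have "\<dots> < M * (d / M)" using h(2) n Mpos by (intro mult_strict_left_mono) auto
        also have "\<dots> = d" using Mpos by simp
        finally show ?thesis using d by (simp add: rad_def)
      qed
      ultimately show ?thesis by blast
    qed
    have Kpos: "0 < rad k" if "k \<in> K" for k using that strict by (auto simp: K_def rad_def)
    obtain C where C: "countable C" "C \<subseteq> K"
      "pairwise (\<lambda>i j. disjnt (cball (ctr i) (rad i)) (cball (ctr j) (rad j))) C"
      "negligible (F ` E - (\<Union>i\<in>C. cball (ctr i) (rad i)))"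
      by (rule Vitali_covering_theorem_cballs[OF Kpos cov])
    have disjI: "disjoint_family_on (\<lambda>k. {F (fst k)..F (snd k)}) C"
      using C(3) unfolding cb disjoint_family_on_def pairwise_def disjnt_def by blast
    have disjD: "disjoint_family_on (\<lambda>k. {fst k..snd k}) C"
      unfolding disjoint_family_on_def
    proof (intro ballI impI, rule ccontr)
      fix i j assume ij: "i \<in> C" "j \<in> C" "i \<noteq> j" "{fst i..snd i} \<inter> {fst j..snd j} \<noteq> {}"
      then obtain z where "z \<in> {fst i..snd i} \<inter> {fst j..snd j}" by blast
      then have "fst i \<le> z" "z \<le> snd i" "fst j \<le> z" "z \<le> snd j" by simp_all
      then have "F z \<in> {F (fst i)..F (snd i)} \<inter> {F (fst j)..F (snd j)}"
        using strict by (auto simp: order.order_iff_strict)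
      then show False using disjI ij unfolding disjoint_family_on_def by blast
    qed
    have "emeasure lebesgue (F ` E) \<le> emeasure lebesgue ((F ` E - (\<Union>i\<in>C. cball (ctr i) (rad i))) \<union> (\<Union>i\<in>C. cball (ctr i) (rad i)))"
      by (intro emeasure_mono sets.Un negligible_imp_sets[OF C(4)] sets.countable_UN'[OF C(1)]) auto
    also have "\<dots> \<le> emeasure lebesgue (F ` E - (\<Union>i\<in>C. cball (ctr i) (rad i))) + emeasure lebesgue (\<Union>i\<in>C. cball (ctr i) (rad i))"
      by (intro emeasure_subadditive negligible_imp_sets[OF C(4)] sets.countable_UN'[OF C(1)]) auto
    also have "emeasure lebesgue (F ` E - (\<Union>i\<in>C. cball (ctr i) (rad i))) = 0"
      using C(4) negligible_iff_emeasure0 negligible_imp_sets by blast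
    also have "0 + emeasure lebesgue (\<Union>i\<in>C. cball (ctr i) (rad i)) = (\<integral>\<^sup>+k. emeasure lebesgue {F (fst k)..F (snd k)} \<partial>count_space C)"
      unfolding cb add_0 by (rule emeasure_UN_countable) (auto simp: C(1) disjI)
    also have "\<dots> \<le> (\<integral>\<^sup>+k. ennreal p * emeasure lebesgue {fst k..snd k} \<partial>count_space C)"
    proof (rule nn_integral_mono)
      fix k assume "k \<in> space (count_space C)"
      then have k: "fst k < snd k" "F (snd k) - F (fst k) < p * (snd k - fst k)" using C(2) by (auto simp: K_def)
      then show "emeasure lebesgue {F (fst k)..F (snd k)} \<le> ennreal p * emeasure lebesgue {fst k..snd k}"
        using strict[of "fst k" "snd k"] p by (auto simp: ennreal_mult[symmetric] intro!: ennreal_leI)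
    qed
    also have "\<dots> = ennreal p * (\<integral>\<^sup>+k. emeasure lebesgue {fst k..snd k} \<partial>count_space C)"
      by (rule nn_integral_cmult) auto
    also have "(\<integral>\<^sup>+k. emeasure lebesgue {fst k..snd k} \<partial>count_space C) = emeasure lebesgue (\<Union>k\<in>C. {fst k..snd k})"
      by (rule emeasure_UN_countable[symmetric]) (auto simp: C(1) disjD)
    also have "\<dots> \<le> emeasure lebesgue O'"
      using C(2) borel_open[OF O'(1)] by (intro emeasure_mono) (fastforce simp: K_def subset_iff)+
    also have "emeasure lebesgue O' = emeasure lebesgue (E \<union> (O' - E))" using O'(2) by (simp add: Un_absorb1)
    also have "\<dots> \<le> emeasure lebesgue E + emeasure lebesgue (O' - E)"
      using Em O'(3) by (intro emeasure_subadditive) auto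
    also have "\<dots> \<le> emeasure lebesgue E + ennreal (e / p)" using O'(4) by (intro add_left_mono) auto
    finally have "emeasure lebesgue (F ` E) \<le> ennreal p * (emeasure lebesgue E + ennreal (e / p))"
      by (simp add: mult_left_mono)
    also have "\<dots> = ennreal p * emeasure lebesgue E + ennreal e"
      using p e by (simp add: distrib_left ennreal_mult[symmetric])
    finally show ?thesis .
  qed
  then show ?thesis
    by (rule ennreal_le_epsilon)
qed

text \<open>A fast point of \<open>F\<close> is mapped to a slow point of the inverse of \<open>F\<close>. Hence \<open>q |E| \<le> |F E| \<le> p |E|\<close> on the set
  \<open>E\<close> of points that are both slow and fast, which for \<open>p < q\<close> forces \<open>|E| = 0\<close>.\<close>

lemma bilip_negligible:
  fixes F :: "real \<Rightarrow> real"
  assumes m: "0 < m" and lo: "\<And>x y. x \<le> y \<Longrightarrow> m * (y - x) \<le> F y - F x"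
    and hi: "\<And>x y. x \<le> y \<Longrightarrow> F y - F x \<le> M * (y - x)" and pq: "0 < p" "p < q"
  shows "negligible (slow_points F p \<inter> fast_points F q)"
proof -
  have Mpos: "0 < M" using lo[of 0 1] hi[of 0 1] m by simp
  have strict: "F x < F y" if "x < y" for x y
    using lo[of x y] that m by (smt (verit) mult_pos_pos)
  have inj: "inj F" by (metis injI linorder_neqE_linordered_idom order_less_irrefl strict)
  have lip: "\<bar>F y - F x\<bar> \<le> M * \<bar>y - x\<bar>" for x y
    using hi[of x y] hi[of y x] strict[of x y] strict[of y x] by (cases x y rule: linorder_cases) auto
  have contF: "continuous_on UNIV F"
    by (rule lipschitz_on_continuous_on[of M]) (auto simp: lipschitz_on_def dist_real_def Mpos less_imp_le lip abs_minus_commute)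
  have "\<exists>x. F x = y" for y
  proof -
    define u where "u = \<bar>y - F 0\<bar> / m"
    have u: "0 \<le> u" "m * u = \<bar>y - F 0\<bar>" using m by (auto simp: u_def)
    have "F (-u) \<le> y" "y \<le> F u" using lo[of "-u" 0] lo[of 0 u] u by auto
    then show ?thesis using IVT'[of F "-u" y u] u contF continuous_on_subset by fastforce
  qed
  then obtain Fi where Fi: "\<And>y. F (Fi y) = y" by metis
  have FiF: "Fi (F x) = x" for x using Fi[of "F x"] inj by (simp add: inj_eq)
  have monoi: "Fi x \<le> Fi y" if "x \<le> y" for x y
    using strict[of "Fi y" "Fi x"] Fi that by fastforce
  have loi: "(1 / M) * (y - x) \<le> Fi y - Fi x" and hii: "Fi y - Fi x \<le> (1 / m) * (y - x)" if "x \<le> y" for x y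
    using hi[of "Fi x" "Fi y"] lo[of "Fi x" "Fi y"] monoi[OF that] Fi m Mpos by (auto simp: field_simps)
  have lipi: "\<bar>Fi y - Fi x\<bar> \<le> (1 / m) * \<bar>y - x\<bar>" for x y
    using hii[of x y] hii[of y x] monoi[of x y] monoi[of y x] by (cases "x \<le> y") auto
  have contFi: "continuous_on UNIV Fi"
    by (rule lipschitz_on_continuous_on[of "1 / m"]) (use lipi m in \<open>auto simp: lipschitz_on_def dist_real_def abs_minus_commute\<close>)
  \<comment> \<open>Bounded pieces have finite measure, so the final inequality between |E| and
    \<open>p / q\<close> times |E| can be evaluated in the reals.\<close>
  have "negligible (slow_points F p \<inter> fast_points F q \<inter> cball 0 (real n))" for n :: nat
  proof -
    define E where "E = slow_points F p \<inter> fast_points F q \<inter> cball 0 (real n)"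
    have Eb: "E \<in> sets borel" unfolding E_def using slow_points_borel[OF contF] by (auto intro!: sets.Int)
    have bE: "bounded E" unfolding E_def by (rule bounded_subset[OF bounded_cball]) blast
    have FE: "F ` E = Fi -` E"
      using Fi FiF by (auto simp: image_iff) (metis)
    have FEb: "F ` E \<in> sets borel"
      using measurable_sets[OF borel_measurable_continuous_onI[OF contFi] Eb] FE by simp
    have bFE: "bounded (F ` E)"
    proof -
      have "\<bar>F x\<bar> \<le> \<bar>F 0\<bar> + M * real n" if "x \<in> E" for x
      proof -
        have "M * \<bar>x\<bar> \<le> M * real n" using that Mpos by (intro mult_left_mono) (auto simp: E_def)
        then show ?thesis using lip[of 0 x] by auto
      qed
      then show ?thesis by (auto simp: bounded_iff)
    qed
    have slowi: "F ` E \<subseteq> slow_points Fi (1 / q)"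
    proof
      fix y assume "y \<in> F ` E"
      then obtain x where x: "x \<in> fast_points F q" "y = F x" by (auto simp: E_def)
      show "y \<in> slow_points Fi (1 / q)"
        unfolding slow_points_def
      proof (intro CollectI allI)
        fix k :: nat
        \<comment> \<open>A step \<open>h\<close> of \<open>F\<close> is a step \<open>g\<close> of
          the inverse with \<open>\<bar>g\<bar> \<le> M * \<bar>h\<bar>\<close>; hence the factor
          \<open>M\<close> in the choice of \<open>j\<close>.\<close>
        obtain j :: nat where j: "1 / real (Suc j) < 1 / (M * real (Suc k))"
          using nat_approx_posE[of "1 / (M * real (Suc k))"] Mpos by (metis divide_pos_pos mult_pos_pos of_nat_0_less_iff zero_less_Suc zero_less_one)
        obtain h where h: "h \<noteq> 0" "\<bar>h\<bar> < 1 / real (Suc j)" "q < (F (x + h) - F x) / h"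
          using x(1) unfolding fast_points_def by blast
        define g where "g = F (x + h) - F x"
        have g0: "g \<noteq> 0" using inj h(1) by (simp add: g_def inj_eq)
        have "\<bar>g\<bar> \<le> M * \<bar>h\<bar>" using lip[of x "x + h"] by (simp add: g_def)
        also have "\<dots> < M * (1 / (M * real (Suc k)))" using h(2) j Mpos by (intro mult_strict_left_mono) auto
        also have "\<dots> = 1 / real (Suc k)" using Mpos by simp
        finally have 1: "\<bar>g\<bar> < 1 / real (Suc k)" .
        have "Fi (y + g) - Fi y = h" using FiF[of "x + h"] FiF[of x] by (simp add: g_def x(2))
        moreover have "h / g < 1 / q"
        proof -
          have "q < g / h" using h(3) by (simp add: g_def)
          then have "1 / (g / h) < 1 / q" using pq by (intro divide_strict_left_mono mult_pos_pos) linarith+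
          then show ?thesis by simp
        qed
        ultimately show "\<exists>h. h \<noteq> 0 \<and> \<bar>h\<bar> < 1 / real (Suc k) \<and> (Fi (y + h) - Fi y) / h < 1 / q"
          using g0 1 by (intro exI[of _ g]) simp
      qed
    qed
    have EFi: "Fi ` F ` E = E" using FiF by (simp add: image_image)
    have 1: "emeasure lebesgue (F ` E) \<le> ennreal p * emeasure lebesgue E"
      by (rule bilip_image_slow[OF m lo hi Eb bE _ pq(1)]) (auto simp: E_def)
    have 2: "emeasure lebesgue E \<le> ennreal (1 / q) * emeasure lebesgue (F ` E)"
      using bilip_image_slow[of "1 / M" Fi "1 / m" "F ` E" "1 / q", OF _ loi hii FEb bFE slowi] Mpos pq EFi by simp
    have "E \<in> lmeasurable" using Eb bE by (simp add: bounded_set_imp_lmeasurable)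
    then have fin: "emeasure lebesgue E = ennreal (measure lebesgue E)"
      using emeasure_eq_measure2 by blast
    have "ennreal (measure lebesgue E) \<le> ennreal (1 / q) * (ennreal p * ennreal (measure lebesgue E))"
      using 1 2 unfolding fin by (meson mult_left_mono order_trans zero_le)
    also have "\<dots> = ennreal (p / q * measure lebesgue E)"
      using pq by (simp add: ennreal_mult[symmetric])
    finally have "measure lebesgue E \<le> p / q * measure lebesgue E"
      using pq by (simp add: ennreal_le_iff)
    then have "measure lebesgue E * (1 - p / q) \<le> 0" by (simp add: algebra_simps)
    moreover have "0 < 1 - p / q" using pq by simp
    ultimately have "measure lebesgue E = 0"
      by (metis measure_nonneg mult_le_0_iff not_less order_antisym)
    then show ?thesis using \<open>E \<in> lmeasurable\<close> negligible_iff_measure0 E_def by blast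
  qed
  then have "negligible (\<Union>n::nat. slow_points F p \<inter> fast_points F q \<inter> cball 0 (real n))"
    by (intro negligible_countable_Union) auto
  moreover have "slow_points F p \<inter> fast_points F q \<subseteq> (\<Union>n::nat. slow_points F p \<inter> fast_points F q \<inter> cball 0 (real n))"
    by (auto simp: real_arch_simple)
  ultimately show ?thesis using negligible_subset by blast
qed
text \<open>If the difference quotients at a point do not converge, rationals
  \<open>0 < p < q\<close> separate their lower and upper limits, and the point is slow for
  \<open>p\<close> and fast for \<open>q\<close>. There are only countably many such pairs.\<close>

lemma bilip_differentiable_ae:
  fixes F :: "real \<Rightarrow> real"
  assumes m: "0 < m" and lo: "\<And>x y. x \<le> y \<Longrightarrow> m * (y - x) \<le> F y - F x"
    and hi: "\<And>x y. x \<le> y \<Longrightarrow> F y - F x \<le> M * (y - x)"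
  shows "negligible {x. \<not> F differentiable (at x)}"
proof -
  have Mpos: "0 < M" using lo[of 0 1] hi[of 0 1] m by simp
  let ?P = "{(p, q). p \<in> \<rat> \<and> q \<in> \<rat> \<and> 0 < p \<and> p < q} :: (real \<times> real) set"
  have "countable ?P"
    by (rule countable_subset[of _ "\<rat> \<times> \<rat>"]) (auto simp: countable_rat)
  moreover have "negligible (slow_points F (fst k) \<inter> fast_points F (snd k))" if "k \<in> ?P" for k
    using bilip_negligible[OF m lo hi, of "fst k" "snd k"] that by auto
  ultimately have neg: "negligible (\<Union>k\<in>?P. slow_points F (fst k) \<inter> fast_points F (snd k))"
    by (intro negligible_countable_Union) auto
  have "F differentiable (at x)" if x: "x \<notin> (\<Union>k\<in>?P. slow_points F (fst k) \<inter> fast_points F (snd k))" for x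
  proof -
    define Q where "Q = (\<lambda>h. (F (x + h) - F x) / h)"
    have Qb: "m \<le> Q h \<and> Q h \<le> M" if "h \<noteq> 0" for h
      using lo[of x "x + h"] hi[of x "x + h"] lo[of "x + h" x] hi[of "x + h" x] that
      by (cases "h > 0") (auto simp: Q_def field_simps)
    \<comment> \<open>\<open>Sup S\<close> is the lower limit of the difference quotients. It is at
      least \<open>m\<close>, which makes the separating rationals positive.\<close>
    define S where "S = {p. \<forall>\<^sub>F h in at 0. p \<le> Q h}"
    have mS: "m \<in> S" using Qb by (auto simp: S_def eventually_at_filter)
    have Sb: "p \<le> M" if "p \<in> S" for p
    proof -
      have "\<forall>\<^sub>F h in at 0. h \<noteq> (0::real)" by (simp add: eventually_at_filter)
      moreover have "\<forall>\<^sub>F h in at 0. p \<le> Q h" using that by (simp add: S_def)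
      ultimately have "\<forall>\<^sub>F h in at (0::real). p \<le> M"
        by eventually_elim (use Qb in \<open>force intro: order_trans\<close>)
      then show ?thesis by (metis eventually_const trivial_limit_at)
    qed
    have bdd: "bdd_above S" using Sb by (auto simp: bdd_above_def)
    define s where "s = Sup S"
    have ms: "m \<le> s" using cSup_upper[OF mS bdd] by (simp add: s_def)
    have slow: "x \<in> slow_points F p" if "s < p" for p
    proof -
      have "p \<notin> S" using cSup_upper[OF _ bdd] that by (force simp: s_def)
      then have "\<exists>\<^sub>F h in at 0. Q h < p" by (simp add: S_def frequently_def not_less)
      then show ?thesis
        unfolding slow_points_def frequently_at Q_def
        by (auto simp: dist_real_def)
    qed
    have "(Q \<longlongrightarrow> s) (at 0)"
    proof (rule order_tendstoI)
      fix a assume "a < s"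
      then obtain p where p: "p \<in> S" "a < p" using less_cSup_iff[OF _ bdd] mS unfolding s_def by blast
      show "\<forall>\<^sub>F h in at 0. a < Q h"
        using p(1) unfolding S_def mem_Collect_eq by (rule eventually_mono) (use p(2) in auto)
    next
      fix a assume a: "s < a"
      obtain p where p: "p \<in> \<rat>" "s < p" "p < a" using Rats_dense_in_real[OF a] by blast
      obtain q where q: "q \<in> \<rat>" "p < q" "q < a" using Rats_dense_in_real[OF p(3)] by blast
      show "\<forall>\<^sub>F h in at 0. Q h < a"
      proof (rule ccontr)
        assume "\<not> ?thesis"
        then have "\<exists>\<^sub>F h in at 0. a \<le> Q h" by (simp add: frequently_def not_le)
        then have "\<exists>\<^sub>F h in at 0. q < Q h" by (rule frequently_elim1) (use q in auto)
        then have "x \<in> fast_points F q"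
          unfolding fast_points_def frequently_at Q_def
          by (auto simp: dist_real_def)
        moreover have "0 < p" using p(2) ms m by simp
        ultimately show False using x slow[OF p(2)] p q by auto
      qed
    qed
    then have "(F has_real_derivative s) (at x)" by (simp add: DERIV_def Q_def)
    then show ?thesis using real_differentiable_def by blast
  qed
  then show ?thesis by (intro negligible_subset[OF neg]) blast
qed

section \<open>Lipschitz functions on an interval: the derivative and its integral\<close>

definition clamped :: "real \<Rightarrow> real \<Rightarrow> (real \<Rightarrow> real) \<Rightarrow> real \<Rightarrow> real" where
  "clamped a b g x = g (max a (min b x))"

lemma clamped_lipschitz:
  assumes "L-lipschitz_on {a..b} g" "a \<le> b"
  shows "\<bar>clamped a b g y - clamped a b g x\<bar> \<le> L * \<bar>y - x\<bar>"
proof -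
  have L: "0 \<le> L" using assms(1) by (simp add: lipschitz_on_def)
  have "\<bar>clamped a b g y - clamped a b g x\<bar> \<le> L * \<bar>max a (min b y) - max a (min b x)\<bar>"
    using lipschitz_onD[OF assms(1), of "max a (min b y)" "max a (min b x)"] assms(2)
    by (simp add: clamped_def dist_real_def)
  also have "\<dots> \<le> L * \<bar>y - x\<bar>" by (intro mult_left_mono L) (auto simp: max_def min_def)
  finally show ?thesis .
qed

text \<open>Adding \<open>(L + 1) * x\<close> to the clamped function gives slopes between
  \<open>1\<close> and \<open>2 * L + 1\<close>, so the bi-Lipschitz case applies. The endpoints are
  put into \<open>N\<close> because \<open>g\<close> and its clamped extension agree near a point
  only in the interior.\<close>

lemma lipschitz_differentiable_ae:
  fixes g :: "real \<Rightarrow> real"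
  assumes lip: "L-lipschitz_on {a..b} g" and ab: "a \<le> b"
  obtains N where "negligible N" "a \<in> N" "b \<in> N"
    "\<And>x. x \<in> {a..b} - N \<Longrightarrow> (g has_real_derivative deriv g x) (at x)"
    "\<And>x. x \<in> {a..b} - N \<Longrightarrow> (clamped a b g has_real_derivative deriv g x) (at x)"
    "\<And>x. x \<in> {a..b} - N \<Longrightarrow> \<bar>deriv g x\<bar> \<le> L"
proof -
  have L: "0 \<le> L" using lip by (simp add: lipschitz_on_def)
  note cl = clamped_lipschitz[OF lip ab]
  define F where "F = (\<lambda>x. clamped a b g x + (L + 1) * x)"
  have 1: "negligible {x. \<not> F differentiable (at x)}"
  proof (rule bilip_differentiable_ae[of 1 _ "2 * L + 1"])
    fix x y :: real assume "x \<le> y"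
    then show "1 * (y - x) \<le> F y - F x" "F y - F x \<le> (2 * L + 1) * (y - x)"
      using cl[of y x] by (auto simp: F_def algebra_simps)
  qed auto
  define N where "N = {x. \<not> F differentiable (at x)} \<union> {a, b}"
  have N: "negligible N" unfolding N_def by (intro negligible_Un 1) auto
  have D: "(clamped a b g has_real_derivative deriv g x) (at x) \<and> (g has_real_derivative deriv g x) (at x)"
    if x: "x \<in> {a..b} - N" for x
  proof -
    obtain d where "(F has_real_derivative d) (at x)"
      using x by (auto simp: N_def real_differentiable_def)
    then have "((\<lambda>y. F y - (L + 1) * y) has_real_derivative d - (L + 1)) (at x)"
      by (auto intro!: derivative_eq_intros)
    then have d: "(clamped a b g has_real_derivative d - (L + 1)) (at x)" by (simp add: F_def)
    have "(g has_real_derivative d - (L + 1)) (at x)"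
    proof (rule DERIV_cong_ev[THEN iffD1, OF refl _ refl d])
      have "\<forall>\<^sub>F y in nhds x. y \<in> {a<..<b}" using x by (intro eventually_nhds_in_open) (auto simp: N_def)
      then show "\<forall>\<^sub>F y in nhds x. clamped a b g y = g y"
        by eventually_elim (auto simp: clamped_def)
    qed
    then show ?thesis using d DERIV_imp_deriv by metis
  qed
  have B: "\<bar>deriv g x\<bar> \<le> L" if x: "x \<in> {a..b} - N" for x
  proof -
    have "((\<lambda>h. \<bar>(clamped a b g (x + h) - clamped a b g x) / h\<bar>) \<longlongrightarrow> \<bar>deriv g x\<bar>) (at 0)"
      using D[OF x] by (intro tendsto_rabs) (simp add: DERIV_def)
    moreover have "\<forall>\<^sub>F h in at 0. \<bar>(clamped a b g (x + h) - clamped a b g x) / h\<bar> \<le> L"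
      unfolding eventually_at_filter using cl[of "x + h" x for h] by (auto simp: field_simps intro!: always_eventually)
    ultimately show ?thesis by (rule tendsto_upperbound) simp
  qed
  show ?thesis using that[OF N] D B by (auto simp: N_def)
qed

text \<open>The forward difference quotients are bounded by \<open>L\<close> and converge to
  \<open>deriv g\<close> almost everywhere, while their integrals are differences of averages of
  \<open>G\<close> just to the right of \<open>b\<close> and of \<open>a\<close>. Dominated
  convergence joins the two facts.\<close>

lemma lipschitz_deriv_integral:
  fixes g :: "real \<Rightarrow> real"
  assumes lip: "L-lipschitz_on {a..b} g" and ab: "a \<le> b"
  shows "(deriv g has_integral g b - g a) {a..b}"
proof -
  have L: "0 \<le> L" using lip by (simp add: lipschitz_on_def)
  obtain N where N: "negligible N" "a \<in> N" "b \<in> N"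
    and D: "\<And>x. x \<in> {a..b} - N \<Longrightarrow> (clamped a b g has_real_derivative deriv g x) (at x)"
    using lipschitz_differentiable_ae[OF lip ab] by metis
  note cl = clamped_lipschitz[OF lip ab]
  define G where "G = clamped a b g"
  have contG: "continuous_on UNIV G"
    by (rule lipschitz_on_continuous_on[of L]) (use cl L in \<open>auto simp: lipschitz_on_def dist_real_def abs_minus_commute G_def\<close>)
  define e where "e = (\<lambda>k. 1 / real (Suc k))"
  have e0: "0 < e k" "e k \<noteq> 0" "e k \<le> 1" for k by (auto simp: e_def)
  have eto: "e \<longlonglongrightarrow> 0" unfolding e_def using LIMSEQ_inverse_real_of_nat by (simp add: inverse_eq_divide)
  \<comment> \<open>Starting the primitive at \<open>a - 1\<close> makes it differentiable from both
    sides at \<open>a\<close> too.\<close>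
  define P where "P = (\<lambda>u. integral {a - 1..u} G)"
  have dP: "(P has_real_derivative G u) (at u)" if "u \<in> {a..b}" for u
  proof -
    have "(P has_real_derivative G u) (at u within {a - 1..b + 1})"
      unfolding P_def using that by (intro integral_has_real_derivative continuous_on_subset[OF contG]) auto
    moreover have "at u within {a - 1..b + 1} = at u" using that by (intro at_within_interior) (auto simp: interior_atLeastAtMost_real)
    ultimately show ?thesis by simp
  qed
  define q where "q = (\<lambda>k x. (G (x + e k) - G x) / e k)"
  have intG: "G integrable_on {u..v}" for u v
    by (intro integrable_continuous_interval continuous_on_subset[OF contG]) auto
  have iq: "(q k has_integral (P (b + e k) - P b) / e k - (P (a + e k) - P a) / e k) {a..b}" for k
  proof -
    have "(G has_integral P (b + e k) - P (a + e k)) {a + e k..b + e k}"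
      using Henstock_Kurzweil_Integration.integral_combine[where a = "a - 1" and c = "a + e k" and b = "b + e k" and f = G] intG e0[of k] ab
      by (auto simp: P_def has_integral_iff)
    then have "((\<lambda>x. G (x + e k)) has_integral P (b + e k) - P (a + e k)) {a..b}"
      using has_integral_affinity[of G _ "a + e k" "b + e k" 1 "e k"] by (simp add: cbox_interval ab)
    moreover have "(G has_integral P b - P a) {a..b}"
      using Henstock_Kurzweil_Integration.integral_combine[where a = "a - 1" and c = a and b = b and f = G] intG ab by (auto simp: P_def has_integral_iff)
    ultimately have "((\<lambda>x. (G (x + e k) - G x) / e k) has_integral ((P (b + e k) - P (a + e k)) - (P b - P a)) / e k) {a..b}"
      by (intro has_integral_divide has_integral_diff)
    then show ?thesis by (simp add: q_def diff_divide_distrib add_divide_distrib algebra_simps)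
  qed
  have lim: "(\<lambda>k. (P (u + e k) - P u) / e k) \<longlonglongrightarrow> G u" if "u \<in> {a..b}" for u
    using dP[OF that] unfolding DERIV_def
    by (rule filterlim_compose) (auto simp: filterlim_at e0 eto)
  \<comment> \<open>Setting sequence and limit to 0 on \<open>N\<close> turns convergence almost
    everywhere into convergence everywhere.\<close>
  define q' where "q' = (\<lambda>k x. if x \<in> N then 0 else q k x)"
  define d' where "d' = (\<lambda>x. if x \<in> N then 0 else deriv g x)"
  have iq': "(q' k has_integral (P (b + e k) - P b) / e k - (P (a + e k) - P a) / e k) {a..b}" for k
    by (rule has_integral_spike[OF N(1) _ iq[of k]]) (auto simp: q'_def)
  have limq: "(\<lambda>k. q' k x) \<longlonglongrightarrow> d' x" if "x \<in> {a..b}" for x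
  proof (cases "x \<in> N")
    case False
    have "(\<lambda>k. q k x) \<longlonglongrightarrow> deriv g x"
    proof -
      have "((\<lambda>h. (G (x + h) - G x) / h) \<longlongrightarrow> deriv g x) (at 0)"
        using D[of x] False that by (simp add: DERIV_def G_def)
      then show ?thesis
        unfolding q_def by (rule filterlim_compose) (auto simp: filterlim_at e0 eto)
    qed
    then show ?thesis using False by (simp add: q'_def d'_def)
  qed (simp add: q'_def d'_def)
  have bq: "norm (q' k x) \<le> L" for k x
    using cl[of "x + e k" x] e0[of k] L by (auto simp: q'_def q_def G_def field_simps)
  have dc: "d' integrable_on {a..b}" "(\<lambda>k. integral {a..b} (q' k)) \<longlonglongrightarrow> integral {a..b} d'"
    using dominated_convergence[of q' "{a..b}" "\<lambda>_. L" d'] iq' bq limq by auto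
  moreover have "(\<lambda>k. integral {a..b} (q' k)) \<longlonglongrightarrow> G b - G a"
    using tendsto_diff[OF lim[of b] lim[of a]] ab by (simp add: integral_unique[OF iq'])
  ultimately have "integral {a..b} d' = g b - g a"
    using LIMSEQ_unique by (fastforce simp: G_def clamped_def ab)
  then have "(d' has_integral g b - g a) {a..b}" using dc by (simp add: has_integral_iff)
  then show ?thesis by (rule has_integral_spike[OF N(1), rotated]) (auto simp: d'_def)
qed

subsection \<open>Half-line data\<close>

lemma Linf_halfline_integral:
  assumes "Linf_halfline g"
  obtains M where "0 \<le> M" "\<And>s t. 0 \<le> s \<Longrightarrow> g integrable_on {s..t}"
    "\<And>s t. 0 \<le> s \<Longrightarrow> s \<le> t \<Longrightarrow> \<bar>integral {s..t} g\<bar> \<le> M * (t - s)"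
proof -
  obtain M where meas: "g \<in> borel_measurable (lebesgue_on {0..})"
    and M: "AE x in lebesgue_on {0..}. \<bar>g x\<bar> \<le> M"
    using assms by (auto simp: Linf_halfline_def)
  have "AE x in lebesgue. x \<in> {0..} \<longrightarrow> \<bar>g x\<bar> \<le> M"
    using M by (subst (asm) AE_restrict_space_iff) auto
  then obtain N where N: "negligible N" "{x. \<not> (x \<in> {0..} \<longrightarrow> \<bar>g x\<bar> \<le> M)} \<subseteq> N"
    by (auto simp: eventually_ae_filter_negligible)
  define B where "B = max M 0"
  \<comment> \<open>Clipping at the essential bound changes \<open>g\<close> on a null set only and
    makes it bounded everywhere, so measurability yields integrability.\<close>
  define g' where "g' = (\<lambda>x. max (- B) (min B (g x)))"
  have gg': "g' x = g x" if "x \<in> {s..t} - N" "0 \<le> s" for x s t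
  proof -
    have "x \<notin> N" "0 \<le> x" using that by auto
    then have "\<bar>g x\<bar> \<le> M" using N(2) by blast
    then have "\<bar>g x\<bar> \<le> B" by (simp add: B_def)
    then show ?thesis by (auto simp: g'_def)
  qed
  have ig': "g' integrable_on {s..t}" if "0 \<le> s" for s t
  proof (rule measurable_bounded_by_integrable_imp_integrable[of _ _ "\<lambda>_. B"])
    have "g \<in> borel_measurable (lebesgue_on {s..t})"
      by (rule measurable_restrict_mono[OF meas]) (use that in auto)
    then show "g' \<in> borel_measurable (lebesgue_on {s..t})"
      unfolding g'_def by (intro borel_measurable_max borel_measurable_min borel_measurable_const)
  qed (auto simp: g'_def B_def)
  show ?thesis
  proof
    show "0 \<le> B" by (simp add: B_def)
    fix s t :: real assume s: "0 \<le> s"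
    show "g integrable_on {s..t}"
      by (rule integrable_spike[OF ig'[OF s, of t] N(1)]) (use gg' s in auto)
    assume st: "s \<le> t"
    have "integral {s..t} g = integral {s..t} g'"
      by (rule integral_spike[OF N(1)]) (use gg' s in auto)
    moreover have "norm (integral {s..t} g') \<le> B * measure lborel (cbox s t)"
      by (rule has_integral_bound[of _ g']) (use ig'[OF s, of t] in \<open>auto simp: B_def g'_def has_integral_iff\<close>)
    ultimately show "\<bar>integral {s..t} g\<bar> \<le> B * (t - s)" using st by simp
  qed
qed

lemma BV_halfline_bounded:
  assumes "BV_halfline g"
  obtains R where "\<And>x. 0 \<le> x \<Longrightarrow> \<bar>g x\<bar> \<le> R"
proof -
  obtain V where V: "\<And>n s. mono s \<and> 0 \<le> s 0 \<Longrightarrow> (\<Sum>i<n. \<bar>g (s (Suc i)) - g (s i)\<bar>) \<le> V"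
    using assms unfolding BV_halfline_def by blast
  have "\<bar>g x - g 0\<bar> \<le> V" if "0 \<le> x" for x
    using V[of "\<lambda>i::nat. if i = 0 then 0 else x" 1] that by (auto simp: mono_def)
  then have "\<bar>g x\<bar> \<le> V + \<bar>g 0\<bar>" if "0 \<le> x" for x using that by (smt (verit))
  then show ?thesis using that by blast
qed

text \<open>Jordan decomposition: the variation function \<open>v\<close> and the difference
  \<open>v - g\<close> are increasing, hence Borel. Composing with \<open>max 0\<close> discards the
  meaningless values at negative arguments.\<close>

lemma BV_halfline_measurable:
  assumes "BV_halfline g"
  shows "(\<lambda>x. g (max 0 x)) \<in> borel_measurable borel"
proof -
  obtain V where V: "\<And>n s. mono s \<and> 0 \<le> s 0 \<Longrightarrow> (\<Sum>i<n. \<bar>g (s (Suc i)) - g (s i)\<bar>) \<le> V"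
    using assms unfolding BV_halfline_def by blast
  define A where "A = (\<lambda>t. {\<Sum>i<n. \<bar>g (s (Suc i)) - g (s i)\<bar> | n s. mono s \<and> 0 \<le> s 0 \<and> s n \<le> t})"
  define v where "v = (\<lambda>t. Sup (A t))"
  have bdd: "bdd_above (A t)" for t using V unfolding A_def bdd_above_def by blast
  have ne: "0 \<in> A t" if "0 \<le> t" for t
    using that unfolding A_def by (intro CollectI exI[of _ 0] exI[of _ "\<lambda>_. 0"]) (auto simp: mono_def)
  have step: "v t + \<bar>g t' - g t\<bar> \<le> v t'" if t: "0 \<le> t" "t \<le> t'" for t t'
  proof -
    have "a \<le> v t' - \<bar>g t' - g t\<bar>" if a: "a \<in> A t" for a
    proof -
      obtain n :: nat and s where s: "mono s" "0 \<le> s 0" "s n \<le> t" and a': "a = (\<Sum>i<n. \<bar>g (s (Suc i)) - g (s i)\<bar>)"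
        using a unfolding A_def by blast
      \<comment> \<open>A partition ending at \<open>s n \<le> t\<close> is prolonged by
        \<open>t\<close> and \<open>t'\<close>. Its entries after index \<open>n\<close> may be
        overwritten, since the sum only sees the first \<open>n\<close> steps.\<close>
      define r where "r = (\<lambda>i. if i \<le> n then s i else if i = Suc n then t else t')"
      have r: "mono r"
        unfolding mono_iff_le_Suc
      proof
        fix i show "r i \<le> r (Suc i)"
          using s t monoD[OF s(1), of i "Suc i"] monoD[OF s(1), of i n] by (auto simp: r_def)
      qed
      have "(\<Sum>i<Suc (Suc n). \<bar>g (r (Suc i)) - g (r i)\<bar>) = a + \<bar>g t - g (s n)\<bar> + \<bar>g t' - g t\<bar>"
        by (simp add: a' r_def)
      moreover have "(\<Sum>i<Suc (Suc n). \<bar>g (r (Suc i)) - g (r i)\<bar>) \<in> A t'"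
        unfolding A_def using r s(2) by (intro CollectI exI[of _ "Suc (Suc n)"] exI[of _ r]) (auto simp: r_def)
      ultimately have "a + \<bar>g t - g (s n)\<bar> + \<bar>g t' - g t\<bar> \<le> v t'"
        unfolding v_def using cSup_upper[OF _ bdd] by metis
      then show ?thesis by linarith
    qed
    then have "v t \<le> v t' - \<bar>g t' - g t\<bar>"
      unfolding v_def using ne[OF t(1)] by (intro cSup_least) (auto simp: v_def)
    then show ?thesis by simp
  qed
  have "mono (\<lambda>x. v (max 0 x))" "mono (\<lambda>x. v (max 0 x) - g (max 0 x))"
    using step by (auto intro!: monoI) (smt (verit) max.cobounded1 max.mono order_refl)+
  then have "(\<lambda>x. v (max 0 x)) \<in> borel_measurable borel" "(\<lambda>x. v (max 0 x) - g (max 0 x)) \<in> borel_measurable borel"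
    by (auto intro: borel_measurable_mono)
  then have "(\<lambda>x. v (max 0 x) - (v (max 0 x) - g (max 0 x))) \<in> borel_measurable borel"
    by (rule borel_measurable_diff)
  then show ?thesis by simp
qed

lemma integral_less_continuous:
  fixes p q :: "real \<Rightarrow> real"
  assumes "continuous_on {s..t} p" "continuous_on {s..t} q" "s < t" "\<And>x. x \<in> {s..t} \<Longrightarrow> p x < q x"
  shows "integral {s..t} p < integral {s..t} q"
proof -
  have "continuous_on {s..t} (\<lambda>x. q x - p x)" using assms by (intro continuous_intros)
  then obtain m where m: "m \<in> {s..t}" "\<forall>x\<in>{s..t}. q m - p m \<le> q x - p x"
    using continuous_attains_inf[of "{s..t}" "\<lambda>x. q x - p x"] assms(3) by auto
  have ip: "p integrable_on {s..t}" "q integrable_on {s..t}"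
    using assms by (auto intro: integrable_continuous_interval)
  have "integral {s..t} (\<lambda>x. q m - p m) \<le> integral {s..t} (\<lambda>x. q x - p x)"
    using m ip by (intro integral_le integrable_diff) auto
  also have "\<dots> = integral {s..t} q - integral {s..t} p" by (intro integral_diff ip)
  finally have "(t - s) * (q m - p m) \<le> integral {s..t} q - integral {s..t} p" using assms(3) by simp
  moreover have "0 < (t - s) * (q m - p m)" using assms m by simp
  ultimately show ?thesis by linarith
qed

lemma continuous_on_Pair_left: "continuous_on S (Pair c)"
  by (rule continuous_on_eq[OF continuous_on_Pair[OF continuous_on_const continuous_on_id]]) auto

text \<open>The substitution \<open>\<theta> = t * u\<close> turns the moving endpoint into a
  parameter of an integrand over the fixed unit interval.\<close>

lemma continuous_on_integral_endpoint:
  fixes \<psi> :: "real \<Rightarrow> real \<Rightarrow> real"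
  assumes "continuous_on (UNIV \<times> {0..}) (\<lambda>(c, \<theta>). \<psi> c \<theta>)"
  shows "continuous_on (UNIV \<times> {0..}) (\<lambda>(c, t). integral {0..t} (\<psi> c))"
proof -
  have eq: "integral {0..t} (\<psi> c) = t * integral (cbox 0 1) (\<lambda>u. \<psi> c (t * u))" if "0 \<le> t" for t c
  proof (cases "t = 0")
    case False
    have "continuous_on {0..t} (\<psi> c)"
      using continuous_on_compose2[OF assms continuous_on_Pair_left, of c "{0..t}"] by (force simp: image_subset_iff)
    then have "(\<psi> c has_integral integral {0..t} (\<psi> c)) {0..t}"
      by (simp add: integrable_integral integrable_continuous_interval)
    then have "((\<lambda>u. \<psi> c (t * u)) has_integral (1 / \<bar>t\<bar>) * integral {0..t} (\<psi> c)) ((\<lambda>u. u / t) ` {0..t})"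
      using False has_integral_stretch_real[of "\<psi> c" _ 0 t t] by simp
    moreover have "(\<lambda>u. u / t) ` {0..t} = {0..1}"
    proof -
      have "x \<in> (\<lambda>u. u / t) ` {0..t}" if "0 \<le> x" "x \<le> 1" for x
        using that False \<open>0 \<le> t\<close> by (intro image_eqI[of _ _ "x * t"]) (auto simp: mult_left_le_one_le)
      then show ?thesis using False \<open>0 \<le> t\<close> by auto
    qed
    ultimately have "integral (cbox 0 1) (\<lambda>u. \<psi> c (t * u)) = (1 / \<bar>t\<bar>) * integral {0..t} (\<psi> c)"
      by (simp add: integral_unique)
    then show ?thesis using False that by simp
  qed simp
  have "continuous_on ((UNIV \<times> {0..}) \<times> cbox 0 1) (\<lambda>q. (\<lambda>(c, \<theta>). \<psi> c \<theta>) (fst (fst q), snd (fst q) * snd q :: real))"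
    by (rule continuous_on_compose2[OF assms]) (auto intro!: continuous_intros)
  then have "continuous_on ((UNIV \<times> {0..}) \<times> cbox 0 1) (\<lambda>(p, u). \<psi> (fst p) (snd p * u))"
    by (simp add: case_prod_unfold)
  then have "continuous_on (UNIV \<times> {0..}) (\<lambda>p. snd p * integral (cbox 0 1) (\<lambda>u. \<psi> (fst p) (snd p * u)))"
    by (intro continuous_intros integral_continuous_on_param)
  then show ?thesis
    by (rule continuous_on_eq) (auto simp: eq)
qed

section \<open>The convex flux, its derivative and its Legendre transform\<close>

locale halfline =
  fixes f \<alpha> u0 ub :: "real \<Rightarrow> real"
  assumes f_C2: "C2_fun f"
    and f_convex: "strictly_convex f"
    and f_superlinear: "filterlim (\<lambda>u. f u / \<bar>u\<bar>) at_top at_infinity"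
    and alpha: "Linf_halfline \<alpha>"
    and u0: "Linf_halfline u0"
    and ub: "BV_halfline ub"
begin

abbreviation "df \<equiv> deriv f"
abbreviation "E \<theta> \<equiv> exp (beta \<alpha> \<theta>)"

lemma f_deriv: "(f has_real_derivative df x) (at x)"
  using f_C2 by (simp add: C2_fun_def DERIV_deriv_iff_real_differentiable)

lemma f_continuous: "continuous_on UNIV f"
  using f_deriv by (meson DERIV_isCont continuous_at_imp_continuous_on)

lemma df_continuous: "continuous_on UNIV df"
  using f_C2 unfolding C2_fun_def by (meson continuous_at_imp_continuous_on differentiable_imp_continuous_within)

text \<open>Convexity gives only the weak tangent inequality; using it at the midpoint, together
  with strict convexity there, makes it strict at \<open>y\<close>.\<close>

lemma above_tangent: "x \<noteq> y \<Longrightarrow> f x + df x * (y - x) < f y"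
proof -
  assume xy: "x \<noteq> y"
  have "convex_on UNIV f"
  proof (rule convex_onI)
    fix t x y :: real assume t: "0 < t" "t < 1"
    show "f ((1 - t) *\<^sub>R x + t *\<^sub>R y) \<le> (1 - t) * f x + t * f y"
    proof (cases "x = y")
      case True
      have "(1 - t) * y + t * y = y" "(1 - t) * f y + t * f y = f y" by (simp_all add: algebra_simps)
      then show ?thesis using True by simp
    next
      case False
      then show ?thesis using f_convex t unfolding strictly_convex_def by (simp add: less_imp_le)
    qed
  qed auto
  from convex_on_imp_above_tangent[OF this _ _ _ f_deriv, of x "(x + y) / 2"]
  have "df x * ((x + y) / 2 - x) \<le> f ((x + y) / 2) - f x" by simp
  moreover have "f ((1 - 1/2) * x + (1/2) * y) < (1 - 1/2) * f x + (1/2) * f y"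
    by (rule f_convex[unfolded strictly_convex_def, rule_format]) (use xy in auto)
  moreover have "(1 - 1/2) * x + (1/2) * y = (x + y) / 2" by (simp add: field_simps)
  ultimately show ?thesis by (simp add: field_simps)
qed

lemma above_tangent_le: "f x + df x * (y - x) \<le> f y"
  using above_tangent[of x y] by (cases "x = y") auto

lemma df_strict: "x < y \<Longrightarrow> df x < df y"
proof -
  assume xy: "x < y"
  have "df x * (y - x) < df y * (y - x)"
    using above_tangent[of x y] above_tangent[of y x] xy by (simp add: algebra_simps)
  then show ?thesis using xy by simp
qed

lemma df_less_iff: "df x < df y \<longleftrightarrow> x < y"
  by (metis df_strict linorder_cases order_less_asym order_less_irrefl)

lemma df_le_iff: "df x \<le> df y \<longleftrightarrow> x \<le> y"
  using df_less_iff by (metis not_less)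

lemma f_large: "\<exists>R>0. \<forall>u. R \<le> \<bar>u\<bar> \<longrightarrow> C \<le> f u / \<bar>u\<bar>"
proof -
  have "\<forall>\<^sub>F u in at_infinity. C \<le> f u / \<bar>u\<bar>"
    using f_superlinear by (simp add: filterlim_at_top)
  then obtain R where "\<forall>u. R \<le> norm u \<longrightarrow> C \<le> f u / \<bar>u\<bar>" by (auto simp: eventually_at_infinity)
  then show ?thesis by (intro exI[of _ "max R 1"]) auto
qed

lemma df_surj: "\<exists>v. df v = p"
proof -
  \<comment> \<open>The summand \<open>\<bar>f 0\<bar>\<close> absorbs the value \<open>f 0\<close>,
    with which the tangents at \<open>u\<close> and \<open>- u\<close> are compared.\<close>
  obtain R where R: "0 < R" "\<And>u. R \<le> \<bar>u\<bar> \<Longrightarrow> \<bar>p\<bar> + \<bar>f 0\<bar> \<le> f u / \<bar>u\<bar>"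
    using f_large[of "\<bar>p\<bar> + \<bar>f 0\<bar>"] by blast
  define u where "u = max R 1"
  have u: "R \<le> u" "1 \<le> u" by (auto simp: u_def)
  have "(\<bar>p\<bar> + \<bar>f 0\<bar>) * u \<le> f u" "(\<bar>p\<bar> + \<bar>f 0\<bar>) * u \<le> f (- u)"
    using R(2)[of u] R(2)[of "-u"] u R(1) by (simp_all add: pos_le_divide_eq)
  moreover have "f u + df u * (0 - u) \<le> f 0" "f (-u) + df (-u) * (0 - (-u)) \<le> f 0"
    by (rule above_tangent_le)+
  moreover have "\<bar>f 0\<bar> * 1 \<le> \<bar>f 0\<bar> * u" using u by (intro mult_left_mono) auto
  ultimately have "\<bar>p\<bar> * u \<le> df u * u" "\<bar>p\<bar> * u \<le> - df (-u) * u" by (auto simp: algebra_simps)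
  then have "\<bar>p\<bar> \<le> df u" "\<bar>p\<bar> \<le> - df (- u)" using u
    mult_le_cancel_right[of "\<bar>p\<bar>" u "df u"] mult_le_cancel_right[of "\<bar>p\<bar>" u "- df (-u)"] by linarith+
  then have "df (- u) \<le> p" "p \<le> df u" by linarith+
  then show ?thesis using IVT'[of df "-u" p u] u df_continuous continuous_on_subset by fastforce
qed

lemma lam_iff: "df (lam f) = 0" "df v < 0 \<longleftrightarrow> v < lam f" "0 < df v \<longleftrightarrow> lam f < v" "0 \<le> df v \<longleftrightarrow> lam f \<le> v" "df v \<le> 0 \<longleftrightarrow> v \<le> lam f"
proof -
  obtain l where l: "df l = 0" using df_surj by blast
  have "lam f = l"
    unfolding lam_def
  proof (rule the_equality)
    show "(\<forall>v<l. df v < 0) \<and> (\<forall>v>l. 0 < df v)" using l df_strict by metis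
    fix m assume m: "(\<forall>v<m. df v < 0) \<and> (\<forall>v>m. 0 < df v)"
    show "m = l" using m l by (metis linorder_cases order_less_irrefl)
  qed
  then show l0: "df (lam f) = 0" using l by simp
  show "df v < 0 \<longleftrightarrow> v < lam f" "0 < df v \<longleftrightarrow> lam f < v" "0 \<le> df v \<longleftrightarrow> lam f \<le> v" "df v \<le> 0 \<longleftrightarrow> v \<le> lam f"
    using df_less_iff[of v "lam f"] df_less_iff[of "lam f" v] df_le_iff[of v "lam f"] df_le_iff[of "lam f" v] l0 by auto
qed

lemma f_mono_right: "lam f \<le> v \<Longrightarrow> v \<le> w \<Longrightarrow> f v \<le> f w"
  using above_tangent_le[of v w] lam_iff(4)[of v] by (smt (verit) mult_nonneg_nonneg)

lemma f_lam_min: "f (lam f) \<le> f v"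
  using above_tangent_le[of "lam f" v] lam_iff(1) by simp

lemma fstar_eq: "fstar f (df v) = df v * v - f v"
  unfolding fstar_def
proof (rule cSup_eq_maximum)
  fix x assume "x \<in> range (\<lambda>w. df v * w - f w)"
  then obtain w where "x = df v * w - f w" by auto
  then show "x \<le> df v * v - f v" using above_tangent_le[of v w] by (simp add: algebra_simps)
qed auto

lemma fenchel: "p * w - f w \<le> fstar f p"
proof -
  obtain v where v: "df v = p" using df_surj by blast
  show ?thesis using above_tangent_le[of v w] fstar_eq[of v] v by (simp add: algebra_simps)
qed

lemma fstar_0: "fstar f 0 = - f (lam f)"
  using fstar_eq[of "lam f"] lam_iff(1) by simp

text \<open>A finite convex function on the line is continuous. For convexity, the maximiser
  \<open>v\<close> belonging to the intermediate slope is a competitor at both end slopes.\<close>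

lemma fstar_continuous: "continuous_on UNIV (fstar f)"
proof (rule convex_on_continuous)
  show "convex_on UNIV (fstar f)"
  proof (rule convex_onI)
    fix t p q :: real assume t: "0 < t" "t < 1"
    obtain v where v: "df v = (1 - t) * p + t * q" using df_surj by blast
    have "fstar f ((1 - t) * p + t * q) = (1 - t) * (p * v - f v) + t * (q * v - f v)"
      using fstar_eq[of v] v by (simp add: algebra_simps)
    also have "\<dots> \<le> (1 - t) * fstar f p + t * fstar f q"
      using t by (intro add_mono mult_left_mono fenchel) auto
    finally show "fstar f ((1 - t) *\<^sub>R p + t *\<^sub>R q) \<le> (1 - t) * fstar f p + t * fstar f q" by simp
  qed auto
qed auto

section \<open>Displacement, integrated flux and cost along h-curves\<close>

lemma beta_continuous: "continuous_on {0..} (beta \<alpha>)"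
proof -
  obtain M where M: "\<And>s t. 0 \<le> s \<Longrightarrow> \<alpha> integrable_on {s..t}"
    using Linf_halfline_integral[OF alpha] by metis
  have "continuous (at x within {0..}) (beta \<alpha>)" if "0 \<le> x" for x
  proof -
    have "continuous_on {0..x + 1} (beta \<alpha>)"
      unfolding beta_def[abs_def] by (intro indefinite_integral_continuous_1 M) auto
    then have "continuous (at x within {0..x + 1}) (beta \<alpha>)" using that by (simp add: continuous_on_eq_continuous_within)
    moreover have "at x within {0..x + 1} = at x within {0..}"
      by (rule at_within_nhd[of x "{..<x + 1}"]) auto
    ultimately show ?thesis by simp
  qed
  then show ?thesis by (simp add: continuous_on_eq_continuous_within)
qed

lemma E_bounds: obtains e1 e2 where "0 < e1" "e1 \<le> e2" "\<And>\<theta>. \<theta> \<in> {0..T} \<Longrightarrow> e1 \<le> E \<theta> \<and> E \<theta> \<le> e2"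
proof (cases "0 \<le> T")
  case True
  have c: "continuous_on {0..T} E" by (intro continuous_intros continuous_on_subset[OF beta_continuous]) auto
  obtain m where m: "m \<in> {0..T}" "\<And>x. x \<in> {0..T} \<Longrightarrow> E m \<le> E x"
    using continuous_attains_inf[OF _ _ c] True by auto
  obtain n where n: "n \<in> {0..T}" "\<And>x. x \<in> {0..T} \<Longrightarrow> E x \<le> E n"
    using continuous_attains_sup[OF _ _ c] True by auto
  show ?thesis using that[of "E m" "E n"] m n by auto
next
  case False
  then show ?thesis using that[of 1 1] by auto
qed

definition spd :: "real \<Rightarrow> real \<Rightarrow> real" where "spd c \<theta> = df (c * E \<theta>)"
definition flx :: "real \<Rightarrow> real \<Rightarrow> real" where "flx c \<theta> = exp (- beta \<alpha> \<theta>) * f (c * E \<theta>)"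
definition F :: "real \<Rightarrow> real \<Rightarrow> real \<Rightarrow> real" where "F s t c = integral {s..t} (spd c)"
definition G :: "real \<Rightarrow> real \<Rightarrow> real \<Rightarrow> real" where "G s t c = integral {s..t} (flx c)"

lemma spd_flx_joint_continuous:
  "continuous_on (UNIV \<times> {0..}) (\<lambda>(c, \<theta>). spd c \<theta>)" "continuous_on (UNIV \<times> {0..}) (\<lambda>(c, \<theta>). flx c \<theta>)"
proof -
  have b: "continuous_on (UNIV \<times> {0..}) (\<lambda>p. beta \<alpha> (snd p))"
    by (rule continuous_on_compose2[OF beta_continuous]) (auto intro: continuous_intros)
  show "continuous_on (UNIV \<times> {0..}) (\<lambda>(c, \<theta>). spd c \<theta>)"
    unfolding spd_def case_prod_unfold
    by (rule continuous_on_compose2[OF df_continuous]) (auto intro!: continuous_intros b)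
  show "continuous_on (UNIV \<times> {0..}) (\<lambda>(c, \<theta>). flx c \<theta>)"
    unfolding flx_def case_prod_unfold
    by (intro continuous_intros b continuous_on_compose2[OF f_continuous, of "UNIV \<times> {0..}" "\<lambda>p. fst p * E (snd p)"]) auto
qed

lemma spd_flx_continuous:
  assumes "0 \<le> s" shows "continuous_on {s..t} (spd c)" "continuous_on {s..t} (flx c)"
proof -
  have "Pair c ` {s..t} \<subseteq> UNIV \<times> {0..}" using assms by auto
  then show "continuous_on {s..t} (spd c)" "continuous_on {s..t} (flx c)"
    using continuous_on_compose2[OF spd_flx_joint_continuous(1) continuous_on_Pair_left, of c "{s..t}"]
      continuous_on_compose2[OF spd_flx_joint_continuous(2) continuous_on_Pair_left, of c "{s..t}"] by auto
qed

lemma spd_flx_integrable: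
  assumes "0 \<le> s" shows "spd c integrable_on {s..t}" "flx c integrable_on {s..t}"
  using spd_flx_continuous[OF assms] by (auto intro: integrable_continuous_interval)

lemma F_add: "0 \<le> r \<Longrightarrow> r \<le> s \<Longrightarrow> s \<le> t \<Longrightarrow> F r s c + F s t c = F r t c"
  unfolding F_def by (intro Henstock_Kurzweil_Integration.integral_combine spd_flx_integrable) auto

lemma G_add: "0 \<le> r \<Longrightarrow> r \<le> s \<Longrightarrow> s \<le> t \<Longrightarrow> G r s c + G s t c = G r t c"
  unfolding G_def by (intro Henstock_Kurzweil_Integration.integral_combine spd_flx_integrable) auto

lemma F_refl [simp]: "F s s c = 0" and G_refl [simp]: "G s s c = 0"
  by (auto simp: F_def G_def)

lemma F_strict: "0 \<le> s \<Longrightarrow> s < t \<Longrightarrow> c < c' \<Longrightarrow> F s t c < F s t c'"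
  unfolding F_def by (intro integral_less_continuous spd_flx_continuous) (auto simp: spd_def intro: df_strict)

lemma F_mono: "0 \<le> s \<Longrightarrow> s \<le> t \<Longrightarrow> c \<le> c' \<Longrightarrow> F s t c \<le> F s t c'"
  using F_strict[of s t c c'] by (cases "s = t"; cases "c = c'") auto

lemma F_less_iff: "0 \<le> s \<Longrightarrow> s < t \<Longrightarrow> F s t c < F s t c' \<longleftrightarrow> c < c'"
  by (metis F_strict linorder_cases order_less_asym order_less_irrefl)

lemma F_le_iff: "0 \<le> s \<Longrightarrow> s < t \<Longrightarrow> F s t c \<le> F s t c' \<longleftrightarrow> c \<le> c'"
  using F_less_iff[of s t c' c] by (auto simp: not_less[symmetric])

lemma F_eq_iff: "0 \<le> s \<Longrightarrow> s < t \<Longrightarrow> F s t c = F s t c' \<longleftrightarrow> c = c'"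
  by (metis F_strict linorder_cases order_less_irrefl)

text \<open>This is the tangent inequality of \<open>f\<close> integrated in time; the weight
  \<open>exp (- beta \<alpha> \<theta>)\<close> cancels the factor \<open>E \<theta>\<close> by
  which the states differ from the parameters.\<close>

lemma G_tangent: "0 \<le> s \<Longrightarrow> s < t \<Longrightarrow> k \<noteq> c \<Longrightarrow> G s t c + F s t c * (k - c) < G s t k"
proof -
  assume st: "0 \<le> s" "s < t" and kc: "k \<noteq> c"
  have "G s t c + F s t c * (k - c) = integral {s..t} (\<lambda>\<theta>. flx c \<theta> + spd c \<theta> * (k - c))"
    unfolding F_def G_def using spd_flx_integrable[OF st(1)]
    by (subst integral_add) (auto intro!: integrable_on_mult_left)
  also have "\<dots> < G s t k"
    unfolding G_def
  proof (intro integral_less_continuous continuous_intros spd_flx_continuous st)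
    fix \<theta> 
    have "E \<theta> * exp (- beta \<alpha> \<theta>) = 1" by (simp add: exp_minus)
    moreover have "f (c * E \<theta>) + df (c * E \<theta>) * (k * E \<theta> - c * E \<theta>) < f (k * E \<theta>)"
      using kc by (intro above_tangent) auto
    then have "exp (- beta \<alpha> \<theta>) * (f (c * E \<theta>) + df (c * E \<theta>) * (k * E \<theta> - c * E \<theta>)) < flx k \<theta>"
      by (simp add: flx_def)
    moreover have "exp (- beta \<alpha> \<theta>) * (f (c * E \<theta>) + df (c * E \<theta>) * (k * E \<theta> - c * E \<theta>))
        = flx c \<theta> + spd c \<theta> * (k - c) * (E \<theta> * exp (- beta \<alpha> \<theta>))"
      by (simp add: flx_def spd_def algebra_simps)
    ultimately show "flx c \<theta> + spd c \<theta> * (k - c) < flx k \<theta>" by simp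
  qed
  finally show ?thesis .
qed

text \<open>The Legendre transform of the convex function \<open>G s t\<close>, evaluated at the
  displacement \<open>F s t c\<close>, where the maximum is attained at \<open>c\<close>
  itself.\<close>

definition cost :: "real \<Rightarrow> real \<Rightarrow> real \<Rightarrow> real" where "cost s t c = c * F s t c - G s t c"

lemma cost_ge_strict: "0 \<le> s \<Longrightarrow> s < t \<Longrightarrow> k \<noteq> c \<Longrightarrow> k * F s t c - G s t k < cost s t c"
  using G_tangent[of s t k c] by (simp add: cost_def algebra_simps)

lemma cost_ge: "0 \<le> s \<Longrightarrow> s \<le> t \<Longrightarrow> k * F s t c - G s t k \<le> cost s t c"
  using cost_ge_strict[of s t k c] by (cases "s = t"; cases "k = c") (auto simp: cost_def)

lemma cost_add: "0 \<le> r \<Longrightarrow> r \<le> s \<Longrightarrow> s \<le> t \<Longrightarrow> cost r s c + cost s t c = cost r t c"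
  using F_add[of r s t c] G_add[of r s t c] by (simp add: cost_def algebra_simps flip: distrib_left)

lemma cost_refl [simp]: "cost s s c = 0" by (simp add: cost_def)

lemma spd_ge_ex: "\<exists>c0. \<forall>c\<ge>c0. \<forall>\<theta>\<in>{0..T}. v \<le> c * E \<theta>" and spd_le_ex: "\<exists>c0. \<forall>c\<le>c0. \<forall>\<theta>\<in>{0..T}. c * E \<theta> \<le> v"
proof -
  obtain e1 e2 where e: "0 < e1" "e1 \<le> e2" "\<And>\<theta>. \<theta> \<in> {0..T} \<Longrightarrow> e1 \<le> E \<theta> \<and> E \<theta> \<le> e2" using E_bounds[of T] by metis
  have *: "\<bar>v\<bar> \<le> c * E \<theta>" if "\<bar>v\<bar> / e1 \<le> c" "\<theta> \<in> {0..T}" for c \<theta>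
  proof -
    have "\<bar>v\<bar> = (\<bar>v\<bar> / e1) * e1" using e by simp
    also have "\<dots> \<le> c * E \<theta>" using that e by (intro mult_mono) (auto intro: order_trans[rotated])
    finally show ?thesis .
  qed
  show "\<exists>c0. \<forall>c\<ge>c0. \<forall>\<theta>\<in>{0..T}. v \<le> c * E \<theta>"
    using * by (intro exI[of _ "\<bar>v\<bar> / e1"]) force
  show "\<exists>c0. \<forall>c\<le>c0. \<forall>\<theta>\<in>{0..T}. c * E \<theta> \<le> v"
  proof (intro exI[of _ "- (\<bar>v\<bar> / e1)"] allI impI ballI)
    fix c \<theta> assume "c \<le> - (\<bar>v\<bar> / e1)" "\<theta> \<in> {0..T}"
    then show "c * E \<theta> \<le> v" using *[of "- c" \<theta>] by auto
  qed
qed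

lemma F_cont: "continuous_on (UNIV \<times> {0..}) (\<lambda>(c, t). F 0 t c)"
  and G_cont: "continuous_on (UNIV \<times> {0..}) (\<lambda>(c, t). G 0 t c)"
  unfolding F_def G_def using continuous_on_integral_endpoint spd_flx_joint_continuous by auto

lemma F_diff: "0 \<le> s \<Longrightarrow> s \<le> t \<Longrightarrow> F s t c = F 0 t c - F 0 s c"
  and G_diff: "0 \<le> s \<Longrightarrow> s \<le> t \<Longrightarrow> G s t c = G 0 t c - G 0 s c"
  using F_add[of 0 s t c] G_add[of 0 s t c] by auto

text \<open>\<open>F\<close> and \<open>G\<close> are differences of integrals from 0, for which
  joint continuity in parameter and endpoint is known. The general filter serves sequences and
  continuity statements alike.\<close>

lemma F_tendsto:
  assumes "(cn \<longlongrightarrow> c) A" "(sn \<longlongrightarrow> s) A" "(tn \<longlongrightarrow> t) A" "\<forall>\<^sub>F n in A. 0 \<le> sn n \<and> sn n \<le> tn n"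
    and "0 \<le> s" "s \<le> t"
  shows "((\<lambda>n. F (sn n) (tn n) (cn n)) \<longlongrightarrow> F s t c) A" "((\<lambda>n. G (sn n) (tn n) (cn n)) \<longlongrightarrow> G s t c) A"
    "((\<lambda>n. cost (sn n) (tn n) (cn n)) \<longlongrightarrow> cost s t c) A"
proof -
  have *: "((\<lambda>n. \<psi> (cn n, rn n)) \<longlongrightarrow> \<psi> (c, r)) A" if "continuous_on (UNIV \<times> {0..}) \<psi>" "(rn \<longlongrightarrow> r) A"
    "\<forall>\<^sub>F n in A. 0 \<le> rn n" "0 \<le> r" for \<psi> :: "real \<times> real \<Rightarrow> real" and rn r
    by (rule continuous_on_tendsto_compose[OF that(1) tendsto_Pair[OF assms(1) that(2)]])
      (use that in \<open>auto elim: eventually_mono\<close>)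
  have ev: "\<forall>\<^sub>F n in A. 0 \<le> sn n" "\<forall>\<^sub>F n in A. 0 \<le> tn n" using assms(4) by (auto elim: eventually_mono)
  have "((\<lambda>n. F 0 (tn n) (cn n) - F 0 (sn n) (cn n)) \<longlongrightarrow> F 0 t c - F 0 s c) A"
    using *[OF F_cont assms(3) ev(2)] *[OF F_cont assms(2) ev(1)] assms by (intro tendsto_diff) auto
  moreover have "((\<lambda>n. G 0 (tn n) (cn n) - G 0 (sn n) (cn n)) \<longlongrightarrow> G 0 t c - G 0 s c) A"
    using *[OF G_cont assms(3) ev(2)] *[OF G_cont assms(2) ev(1)] assms by (intro tendsto_diff) auto
  ultimately show 1: "((\<lambda>n. F (sn n) (tn n) (cn n)) \<longlongrightarrow> F s t c) A" "((\<lambda>n. G (sn n) (tn n) (cn n)) \<longlongrightarrow> G s t c) A"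
  proof -
    assume 1: "((\<lambda>n. F 0 (tn n) (cn n) - F 0 (sn n) (cn n)) \<longlongrightarrow> F 0 t c - F 0 s c) A"
      and 2: "((\<lambda>n. G 0 (tn n) (cn n) - G 0 (sn n) (cn n)) \<longlongrightarrow> G 0 t c - G 0 s c) A"
    have "\<forall>\<^sub>F n in A. F 0 (tn n) (cn n) - F 0 (sn n) (cn n) = F (sn n) (tn n) (cn n)"
      "\<forall>\<^sub>F n in A. G 0 (tn n) (cn n) - G 0 (sn n) (cn n) = G (sn n) (tn n) (cn n)"
      using assms(4) by (auto elim!: eventually_mono intro: F_diff[symmetric] G_diff[symmetric])
    then show "((\<lambda>n. F (sn n) (tn n) (cn n)) \<longlongrightarrow> F s t c) A" "((\<lambda>n. G (sn n) (tn n) (cn n)) \<longlongrightarrow> G s t c) A"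
      unfolding F_diff[OF assms(5,6)] G_diff[OF assms(5,6)] using 1 2 by (blast intro: Lim_transform_eventually)+
  qed
  show "((\<lambda>n. cost (sn n) (tn n) (cn n)) \<longlongrightarrow> cost s t c) A"
    unfolding cost_def by (intro tendsto_intros 1 assms(1))
qed

lemma F_continuous_param: "0 \<le> s \<Longrightarrow> s \<le> t \<Longrightarrow> continuous_on UNIV (F s t)"
  unfolding continuous_on_def using F_tendsto(1)[of "\<lambda>x. x" _ _ "\<lambda>_. s" s "\<lambda>_. t" t] by auto

lemma F_surj: "0 \<le> s \<Longrightarrow> s < t \<Longrightarrow> \<exists>c. F s t c = d"
proof -
  assume st: "0 \<le> s" "s < t"
  \<comment> \<open>The slope \<open>d / (t - s)\<close> is that of the straight segment; parameters
    far out on either side make the speed exceed or undercut it on the whole interval.\<close>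
  obtain v where v: "df v = d / (t - s)" using df_surj by blast
  obtain c1 where c1: "\<And>\<theta>. \<theta> \<in> {0..t} \<Longrightarrow> v \<le> c1 * E \<theta>" using spd_ge_ex[of t v] by blast
  obtain c0 where c0: "\<And>\<theta>. \<theta> \<in> {0..t} \<Longrightarrow> c0 * E \<theta> \<le> v" using spd_le_ex[of t v] by blast
  have "integral {s..t} (\<lambda>_. df v) \<le> F s t c1"
    unfolding F_def using c1 st by (intro integral_le spd_flx_integrable) (auto simp: spd_def df_le_iff)
  moreover have "F s t c0 \<le> integral {s..t} (\<lambda>_. df v)"
    unfolding F_def using c0 st by (intro integral_le spd_flx_integrable) (auto simp: spd_def df_le_iff)
  ultimately have "F s t c0 \<le> d" "d \<le> F s t c1" using st v by simp_all
  moreover have "c0 \<le> c1" using c0[of t] c1[of t] st by (smt (verit) atLeastAtMost_iff exp_gt_zero mult_le_cancel_right)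
  ultimately show ?thesis using IVT'[of "F s t" c0 d c1] F_continuous_param[of s t] st continuous_on_subset by fastforce
qed

definition jp :: "real \<Rightarrow> real \<Rightarrow> real \<Rightarrow> real" where "jp s t d = (THE c. F s t c = d)"

lemma jp_eq: "0 \<le> s \<Longrightarrow> s < t \<Longrightarrow> F s t c = d \<Longrightarrow> jp s t d = c"
  unfolding jp_def using F_eq_iff by (intro the_equality) auto

lemma F_jp [simp]: "0 \<le> s \<Longrightarrow> s < t \<Longrightarrow> F s t (jp s t d) = d"
  using F_surj jp_eq by metis

lemma F_has_derivative:
  assumes "0 \<le> s" "\<theta> \<in> {s..t}"
  shows "((\<lambda>r. F s r c) has_real_derivative spd c \<theta>) (at \<theta> within {s..t})"
  unfolding F_def by (intro integral_has_real_derivative spd_flx_continuous assms)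

text \<open>By the fundamental theorem of calculus a parameter admits an h-curve exactly if its
  displacement is \<open>x - y\<close>; the definite description of \<open>h\<close> thereby becomes
  the inverse of \<open>F s t\<close>.\<close>

lemma h_gen_eq: "0 \<le> s \<Longrightarrow> s < t \<Longrightarrow> h_gen f \<alpha> x t y s = jp s t (x - y)"
proof -
  assume st: "0 \<le> s" "s < t"
  have "(\<exists>X. is_h_curve f \<alpha> x t y s c X) \<longleftrightarrow> F s t c = x - y" for c
  proof
    assume "\<exists>X. is_h_curve f \<alpha> x t y s c X"
    then obtain X where X: "X t = x" "X s = y" "\<And>\<theta>. \<theta> \<in> {s..t} \<Longrightarrow> (X has_real_derivative spd c \<theta>) (at \<theta> within {s..t})"
      unfolding is_h_curve_def spd_def by auto
    have "(spd c has_integral X t - X s) {s..t}"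
      using X st by (intro fundamental_theorem_of_calculus) (auto simp: has_real_derivative_iff_has_vector_derivative)
    then show "F s t c = x - y" using X by (simp add: F_def integral_unique)
  next
    assume "F s t c = x - y"
    then have "is_h_curve f \<alpha> x t y s c (\<lambda>r. y + F s r c)"
      unfolding is_h_curve_def using F_has_derivative[OF st(1), unfolded spd_def]
      by (auto intro!: derivative_eq_intros)
    then show "\<exists>X. is_h_curve f \<alpha> x t y s c X" by blast
  qed
  then show ?thesis by (simp add: h_gen_def jp_def)
qed

lemma hA_eq: "0 < t \<Longrightarrow> hA f \<alpha> z t = jp 0 t z"
  by (simp add: hA_def h_gen_eq)

lemma hB_eq: "0 \<le> s \<Longrightarrow> s < t \<Longrightarrow> hB f \<alpha> x t s = jp s t x"
  by (simp add: hB_def h_gen_eq)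

subsection \<open>The cost of a path\<close>

definition U0 :: "real \<Rightarrow> real" where "U0 y = integral {0..y} u0"
definition bd :: "real \<Rightarrow> real" where "bd \<theta> = f (ubar f ub \<theta>) * exp (- beta \<alpha> \<theta>)"
text \<open>One integrand for both time integrals in \<open>J\<close>, so that the cost is additive
  over adjacent time intervals.\<close>

definition rate :: "(real \<Rightarrow> real) \<Rightarrow> real \<Rightarrow> real" where
  "rate \<gamma> \<theta> = (if \<gamma> \<theta> = 0 then - bd \<theta> else fstar f (deriv \<gamma> \<theta>) * exp (- beta \<alpha> \<theta>))"
definition C :: "(real \<Rightarrow> real) \<Rightarrow> real \<Rightarrow> real \<Rightarrow> real" where "C \<gamma> s t = integral {s..t} (rate \<gamma>)"

abbreviation "path_in \<gamma> s t \<equiv> (\<exists>L. L-lipschitz_on {s..t} \<gamma>) \<and> (\<forall>\<theta>\<in>{s..t}. 0 \<le> \<gamma> \<theta>)"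

lemma U0_0 [simp]: "U0 0 = 0" by (simp add: U0_def)

lemma U0_lipschitz: obtains M where "0 \<le> M" "\<And>y y'. 0 \<le> y \<Longrightarrow> 0 \<le> y' \<Longrightarrow> \<bar>U0 y - U0 y'\<bar> \<le> M * \<bar>y - y'\<bar>"
proof -
  obtain M where M: "0 \<le> M" "\<And>s t. 0 \<le> s \<Longrightarrow> u0 integrable_on {s..t}"
    "\<And>s t. 0 \<le> s \<Longrightarrow> s \<le> t \<Longrightarrow> \<bar>integral {s..t} u0\<bar> \<le> M * (t - s)"
    using Linf_halfline_integral[OF u0] by metis
  have *: "\<bar>U0 y' - U0 y\<bar> \<le> M * (y' - y)" if "0 \<le> y" "y \<le> y'" for y y'
    using Henstock_Kurzweil_Integration.integral_combine[of 0 y y' u0] M(2)[of 0 y'] M(3)[of y y'] that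
    by (simp add: U0_def)
  show ?thesis
  proof (rule that[OF M(1)])
    fix y y' :: real assume "0 \<le> y" "0 \<le> y'"
    then show "\<bar>U0 y - U0 y'\<bar> \<le> M * \<bar>y - y'\<bar>"
      using *[of y y'] *[of y' y] by (cases "y \<le> y'") (auto simp: abs_minus_commute)
  qed
qed

lemma ubar_bounded: obtains R where "\<And>\<theta>. 0 \<le> \<theta> \<Longrightarrow> lam f \<le> ubar f ub \<theta> \<and> ubar f ub \<theta> \<le> R" "lam f \<le> R"
proof -
  obtain R where R: "\<And>x. 0 \<le> x \<Longrightarrow> \<bar>ub x\<bar> \<le> R" using BV_halfline_bounded[OF ub] by metis
  show ?thesis
  proof (rule that[of "max R (lam f)"])
    fix \<theta> :: real assume "0 \<le> \<theta>"
    then show "lam f \<le> ubar f ub \<theta> \<and> ubar f ub \<theta> \<le> max R (lam f)"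
      using R[of \<theta>] by (auto simp: ubar_def)
  qed simp
qed

text \<open>Resting on the boundary costs no more than standing still in the interior, because
  \<open>f\<close> is smallest at \<open>lam f\<close>. This settles the times at which an h-curve
  touches the t-axis.\<close>

lemma bd_ge: "- bd \<theta> \<le> fstar f 0 * exp (- beta \<alpha> \<theta>)"
  using f_lam_min[of "ubar f ub \<theta>"] by (simp add: fstar_0 bd_def)

lemma bd_bounded: obtains B where "0 \<le> B" "\<And>\<theta>. \<theta> \<in> {0..T} \<Longrightarrow> \<bar>bd \<theta>\<bar> \<le> B"
proof -
  obtain R where R: "\<And>\<theta>. 0 \<le> \<theta> \<Longrightarrow> lam f \<le> ubar f ub \<theta> \<and> ubar f ub \<theta> \<le> R" "lam f \<le> R"
    using ubar_bounded by metis
  obtain e1 e2 where e: "0 < e1" "\<And>\<theta>. \<theta> \<in> {0..T} \<Longrightarrow> e1 \<le> E \<theta>" using E_bounds[of T] by metis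
  define A where "A = \<bar>f (lam f)\<bar> + \<bar>f R\<bar>"
  have "\<bar>bd \<theta>\<bar> \<le> A * (1 / e1)" if \<theta>: "\<theta> \<in> {0..T}" for \<theta>
  proof -
    have "f (lam f) \<le> f (ubar f ub \<theta>)" "f (ubar f ub \<theta>) \<le> f R"
      using f_lam_min f_mono_right[of "ubar f ub \<theta>" R] R(1)[of \<theta>] \<theta> by auto
    then have "\<bar>f (ubar f ub \<theta>)\<bar> \<le> A" by (simp add: A_def)
    moreover have "exp (- beta \<alpha> \<theta>) \<le> 1 / e1"
      using e(2)[OF \<theta>] e(1) by (simp add: exp_minus inverse_eq_divide frac_le)
    ultimately show ?thesis unfolding bd_def abs_mult by (intro mult_mono) auto
  qed
  moreover have "0 \<le> A * (1 / e1)" using e by (simp add: A_def)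
  ultimately show ?thesis using that by blast
qed

lemma exp_beta_measurable: "0 \<le> s \<Longrightarrow> (\<lambda>\<theta>. exp (- beta \<alpha> \<theta>)) \<in> borel_measurable (lebesgue_on {s..t})"
  by (intro continuous_imp_measurable_on_sets_lebesgue continuous_intros continuous_on_subset[OF beta_continuous]) auto

lemma bd_measurable: "0 \<le> s \<Longrightarrow> bd \<in> borel_measurable (lebesgue_on {s..t})"
proof -
  assume s: "0 \<le> s"
  have "(\<lambda>x. f (max (ub (max 0 x)) (lam f))) \<in> borel_measurable borel"
    using BV_halfline_measurable[OF ub] borel_measurable_continuous_onI[OF f_continuous] by measurable
  then have "(\<lambda>x. f (max (ub (max 0 x)) (lam f))) \<in> borel_measurable (lebesgue_on {s..t})"
    by (intro measurable_restrict_space1 measurable_completion) simp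
  then have "(\<lambda>x. f (max (ub (max 0 x)) (lam f)) * exp (- beta \<alpha> x)) \<in> borel_measurable (lebesgue_on {s..t})"
    by (intro borel_measurable_times exp_beta_measurable s)
  then show ?thesis
    by (rule measurable_cong[THEN iffD1, rotated]) (use s in \<open>auto simp: bd_def ubar_def max_def\<close>)
qed

lemma bounded_measurable_integrable:
  fixes g :: "real \<Rightarrow> real"
  assumes "g \<in> borel_measurable (lebesgue_on {s..t})" "negligible N" "\<And>x. x \<in> {s..t} - N \<Longrightarrow> \<bar>g x\<bar> \<le> B"
  shows "g integrable_on {s..t}"
proof -
  define h where "h = (\<lambda>x. max (- B) (min B (g x)))"
  have "h integrable_on {s..t}"
  proof (rule measurable_bounded_by_integrable_imp_integrable[of _ _ "\<lambda>_. \<bar>B\<bar>"])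
    show "h \<in> borel_measurable (lebesgue_on {s..t})"
      unfolding h_def by (intro borel_measurable_max borel_measurable_min borel_measurable_const assms(1))
  qed (auto simp: h_def)
  then show ?thesis
    by (rule integrable_spike[OF _ assms(2)]) (use assms(3) in \<open>force simp: h_def\<close>)
qed

lemma rate_parts_integrable:
  assumes lip: "L-lipschitz_on {s..t} \<gamma>" and s: "0 \<le> s" "s \<le> t"
  shows "(\<lambda>\<theta>. if \<gamma> \<theta> = 0 then bd \<theta> else 0) integrable_on {s..t}"
    "(\<lambda>\<theta>. if \<gamma> \<theta> = 0 then 0 else fstar f (deriv \<gamma> \<theta>) * exp (- beta \<alpha> \<theta>)) integrable_on {s..t}"
proof -
  have "continuous_on {s..t} \<gamma>" using lip by (rule lipschitz_on_continuous_on)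
  then have \<gamma>m: "\<gamma> \<in> borel_measurable (lebesgue_on {s..t})"
    by (intro continuous_imp_measurable_on_sets_lebesgue) auto
  have z: "{\<theta> \<in> space (lebesgue_on {s..t}). \<gamma> \<theta> = 0} \<in> sets (lebesgue_on {s..t})"
    using \<gamma>m by measurable
  obtain B where B: "0 \<le> B" "\<And>\<theta>. \<theta> \<in> {0..t} \<Longrightarrow> \<bar>bd \<theta>\<bar> \<le> B" using bd_bounded[of t] by metis
  show "(\<lambda>\<theta>. if \<gamma> \<theta> = 0 then bd \<theta> else 0) integrable_on {s..t}"
    using B s by (intro bounded_measurable_integrable[of _ _ _ "{}" B] measurable_If[OF _ _ z] bd_measurable) auto
  obtain N where N: "negligible N" "\<And>x. x \<in> {s..t} - N \<Longrightarrow> \<bar>deriv \<gamma> x\<bar> \<le> L"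
    using lipschitz_differentiable_ae[OF lip s(2)] by metis
  have "compact (fstar f ` {-L..L})"
    by (intro compact_continuous_image continuous_on_subset[OF fstar_continuous]) auto
  then obtain D where D: "\<And>p. \<bar>p\<bar> \<le> L \<Longrightarrow> \<bar>fstar f p\<bar> \<le> D"
    using compact_imp_bounded[of "fstar f ` {-L..L}"] unfolding bounded_iff by (force simp: abs_le_iff)
  obtain e1 e2 where e: "0 < e1" "\<And>\<theta>. \<theta> \<in> {0..t} \<Longrightarrow> e1 \<le> E \<theta>" using E_bounds[of t] by metis
  have dm: "deriv \<gamma> \<in> borel_measurable (lebesgue_on {s..t})"
    using lipschitz_deriv_integral[OF lip s(2)] by (intro integrable_imp_measurable) blast
  have fm: "(\<lambda>\<theta>. fstar f (deriv \<gamma> \<theta>)) \<in> borel_measurable (lebesgue_on {s..t})"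
    by (rule measurable_compose[OF dm borel_measurable_continuous_onI[OF fstar_continuous]])
  show "(\<lambda>\<theta>. if \<gamma> \<theta> = 0 then 0 else fstar f (deriv \<gamma> \<theta>) * exp (- beta \<alpha> \<theta>)) integrable_on {s..t}"
  proof (rule bounded_measurable_integrable[OF _ N(1), of _ _ _ "\<bar>D\<bar> * (1 / e1)"])
    show "(\<lambda>\<theta>. if \<gamma> \<theta> = 0 then 0 else fstar f (deriv \<gamma> \<theta>) * exp (- beta \<alpha> \<theta>)) \<in> borel_measurable (lebesgue_on {s..t})"
      using s by (intro measurable_If[OF _ _ z] fm borel_measurable_times exp_beta_measurable) auto
    fix x assume x: "x \<in> {s..t} - N"
    have "exp (- beta \<alpha> x) \<le> 1 / e1"
      using e(2)[of x] e(1) x s by (simp add: exp_minus inverse_eq_divide frac_le)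
    moreover have "\<bar>fstar f (deriv \<gamma> x)\<bar> \<le> \<bar>D\<bar>" using D[OF N(2)[OF x]] by simp
    ultimately have "\<bar>fstar f (deriv \<gamma> x)\<bar> * exp (- beta \<alpha> x) \<le> \<bar>D\<bar> * (1 / e1)" by (intro mult_mono) auto
    then show "\<bar>if \<gamma> x = 0 then 0 else fstar f (deriv \<gamma> x) * exp (- beta \<alpha> x)\<bar> \<le> \<bar>D\<bar> * (1 / e1)"
      using e by (auto simp: abs_mult)
  qed
qed

lemma rate_integrable:
  assumes lip: "L-lipschitz_on {s..t} \<gamma>" and s: "0 \<le> s" "s \<le> t"
  shows "rate \<gamma> integrable_on {s..t}"
proof -
  note p = rate_parts_integrable[OF assms]
  show ?thesis
    by (rule integrable_eq[OF integrable_diff[OF p(2) p(1)]]) (auto simp: rate_def)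
qed

lemma integral_restrict_subset:
  fixes g :: "real \<Rightarrow> real"
  shows "S \<subseteq> T \<Longrightarrow> integral S g = integral T (\<lambda>x. if x \<in> S then g x else 0)"
  by (simp add: integral_restrict_Int Int_absorb2)

lemma J_eq:
  assumes "L-lipschitz_on {0..t} \<gamma>" and "0 \<le> t"
  shows "J f \<alpha> u0 ub \<gamma> t = C \<gamma> 0 t + U0 (\<gamma> 0)"
proof -
  note p = rate_parts_integrable[OF assms(1) order_refl assms(2)]
  have "integral {\<theta>\<in>{0..t}. \<gamma> \<theta> \<noteq> 0} (\<lambda>\<theta>. fstar f (deriv \<gamma> \<theta>) * exp (- beta \<alpha> \<theta>))
      = integral {0..t} (\<lambda>\<theta>. if \<theta> \<in> {\<theta>\<in>{0..t}. \<gamma> \<theta> \<noteq> 0} then fstar f (deriv \<gamma> \<theta>) * exp (- beta \<alpha> \<theta>) else 0)"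
    by (rule integral_restrict_subset) auto
  also have "\<dots> = integral {0..t} (\<lambda>\<theta>. if \<gamma> \<theta> = 0 then 0 else fstar f (deriv \<gamma> \<theta>) * exp (- beta \<alpha> \<theta>))"
    by (rule integral_cong) auto
  finally have 1: "integral {\<theta>\<in>{0..t}. \<gamma> \<theta> \<noteq> 0} (\<lambda>\<theta>. fstar f (deriv \<gamma> \<theta>) * exp (- beta \<alpha> \<theta>)) = \<dots>" .
  have "integral {\<theta>\<in>{0..t}. \<gamma> \<theta> = 0} (\<lambda>\<theta>. f (ubar f ub \<theta>) * exp (- beta \<alpha> \<theta>))
      = integral {0..t} (\<lambda>\<theta>. if \<theta> \<in> {\<theta>\<in>{0..t}. \<gamma> \<theta> = 0} then f (ubar f ub \<theta>) * exp (- beta \<alpha> \<theta>) else 0)"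
    by (rule integral_restrict_subset) auto
  also have "\<dots> = integral {0..t} (\<lambda>\<theta>. if \<gamma> \<theta> = 0 then bd \<theta> else 0)"
    by (rule integral_cong) (auto simp: bd_def)
  finally have 2: "integral {\<theta>\<in>{0..t}. \<gamma> \<theta> = 0} (\<lambda>\<theta>. f (ubar f ub \<theta>) * exp (- beta \<alpha> \<theta>)) = \<dots>" .
  have "C \<gamma> 0 t = integral {0..t} (\<lambda>\<theta>. (if \<gamma> \<theta> = 0 then 0 else fstar f (deriv \<gamma> \<theta>) * exp (- beta \<alpha> \<theta>)) - (if \<gamma> \<theta> = 0 then bd \<theta> else 0))"
    unfolding C_def by (rule integral_cong) (auto simp: rate_def)
  also have "\<dots> = integral {0..t} (\<lambda>\<theta>. if \<gamma> \<theta> = 0 then 0 else fstar f (deriv \<gamma> \<theta>) * exp (- beta \<alpha> \<theta>)) - integral {0..t} (\<lambda>\<theta>. if \<gamma> \<theta> = 0 then bd \<theta> else 0)"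
    by (rule integral_diff[OF p(2) p(1)])
  finally show ?thesis unfolding J_def 1 2 by (simp add: U0_def)
qed

lemma C_add:
  assumes "L-lipschitz_on {r..t} \<gamma>" "0 \<le> r" "r \<le> s" "s \<le> t"
  shows "C \<gamma> r s + C \<gamma> s t = C \<gamma> r t"
  unfolding C_def using assms by (intro Henstock_Kurzweil_Integration.integral_combine rate_integrable) auto

lemma deriv_cong_interval:
  fixes \<gamma> \<eta> :: "real \<Rightarrow> real"
  assumes "\<And>x. x \<in> {s..t} \<Longrightarrow> \<gamma> x = \<eta> x" "s < \<theta>" "\<theta> < t"
  shows "deriv \<gamma> \<theta> = deriv \<eta> \<theta>"
proof (rule deriv_cong_ev)
  have "\<forall>\<^sub>F y in nhds \<theta>. y \<in> {s<..<t}" using assms by (intro eventually_nhds_in_open) auto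
  then show "\<forall>\<^sub>F y in nhds \<theta>. \<gamma> y = \<eta> y" by eventually_elim (use assms(1) in auto)
qed auto

lemma C_cong:
  assumes "\<And>x. x \<in> {s..t} \<Longrightarrow> \<gamma> x = \<eta> x"
  shows "C \<gamma> s t = C \<eta> s t"
  unfolding C_def
proof (rule integral_spike[of "{s, t}"])
  fix \<theta> assume "\<theta> \<in> {s..t} - {s, t}"
  then show "rate \<eta> \<theta> = rate \<gamma> \<theta>"
    using deriv_cong_interval[of s t \<gamma> \<eta> \<theta>, OF assms] assms[of \<theta>] by (auto simp: rate_def)
qed auto

lemma zero_deriv_at_zero:
  assumes "(\<gamma> has_real_derivative d) (at \<theta>)" "\<gamma> \<theta> = 0" "\<And>x. x \<in> {s..t} \<Longrightarrow> 0 \<le> \<gamma> x" "s < \<theta>" "\<theta> < t"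
  shows "d = 0"
  by (rule DERIV_local_min[OF assms(1), of "min (\<theta> - s) (t - \<theta>)"])
    (use assms in \<open>auto intro!: assms(3) simp: abs_if split: if_splits\<close>)

text \<open>A calibration argument: at almost every time Fenchel's inequality at the state
  \<open>k * E \<theta>\<close> bounds the running cost below by
  \<open>k * deriv \<gamma> \<theta> - flx k \<theta>\<close>. Where the path is 0, which is a
  minimum, its derivative vanishes and only the boundary rate matters.\<close>

lemma C_lower:
  assumes lip: "L-lipschitz_on {s..t} \<gamma>" and pos: "\<And>\<theta>. \<theta> \<in> {s..t} \<Longrightarrow> 0 \<le> \<gamma> \<theta>" and st: "0 \<le> s" "s \<le> t"
    and \<psi>: "\<psi> integrable_on {s..t}"
      "\<And>\<theta>. s < \<theta> \<Longrightarrow> \<theta> < t \<Longrightarrow> \<gamma> \<theta> \<noteq> 0 \<Longrightarrow> flx k \<theta> \<le> \<psi> \<theta>" "\<And>\<theta>. s < \<theta> \<Longrightarrow> \<theta> < t \<Longrightarrow> \<gamma> \<theta> = 0 \<Longrightarrow> bd \<theta> \<le> \<psi> \<theta>"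
  shows "k * (\<gamma> t - \<gamma> s) - integral {s..t} \<psi> \<le> C \<gamma> s t"
proof -
  obtain N where N: "negligible N" "s \<in> N" "t \<in> N"
    "\<And>x. x \<in> {s..t} - N \<Longrightarrow> (\<gamma> has_real_derivative deriv \<gamma> x) (at x)"
    using lipschitz_differentiable_ae[OF lip st(2)] by metis
  have i: "((\<lambda>\<theta>. k * deriv \<gamma> \<theta> - \<psi> \<theta>) has_integral k * (\<gamma> t - \<gamma> s) - integral {s..t} \<psi>) {s..t}"
    using \<psi>(1) by (intro has_integral_diff has_integral_mult_right lipschitz_deriv_integral[OF lip st(2)]) auto
  have r: "(rate \<gamma> has_integral C \<gamma> s t) {s..t}"
    unfolding C_def using rate_integrable[OF lip st] by auto
  have "((\<lambda>\<theta>. if \<theta> \<in> N then 0 else k * deriv \<gamma> \<theta> - \<psi> \<theta>) has_integral k * (\<gamma> t - \<gamma> s) - integral {s..t} \<psi>) {s..t}"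
    by (rule has_integral_spike[OF N(1) _ i]) auto
  moreover have "((\<lambda>\<theta>. if \<theta> \<in> N then 0 else rate \<gamma> \<theta>) has_integral C \<gamma> s t) {s..t}"
    by (rule has_integral_spike[OF N(1) _ r]) auto
  ultimately show ?thesis
  proof (rule has_integral_le)
    fix \<theta> assume \<theta>: "\<theta> \<in> {s..t}"
    show "(if \<theta> \<in> N then 0 else k * deriv \<gamma> \<theta> - \<psi> \<theta>) \<le> (if \<theta> \<in> N then 0 else rate \<gamma> \<theta>)"
    proof (cases "\<theta> \<in> N")
      case False
      then have in': "s < \<theta>" "\<theta> < t" using N \<theta> by (auto simp: order.order_iff_strict)
      have "k * deriv \<gamma> \<theta> - \<psi> \<theta> \<le> rate \<gamma> \<theta>"
      proof (cases "\<gamma> \<theta> = 0")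
        case True
        then have "deriv \<gamma> \<theta> = 0" using zero_deriv_at_zero[of \<gamma> "deriv \<gamma> \<theta>" \<theta> s t] N(4) pos in' False \<theta> by auto
        then show ?thesis using True \<psi>(3)[OF in' True] by (simp add: rate_def)
      next
        case nz: False
        have "deriv \<gamma> \<theta> * (k * E \<theta>) - f (k * E \<theta>) \<le> fstar f (deriv \<gamma> \<theta>)" by (rule fenchel)
        then have "(deriv \<gamma> \<theta> * (k * E \<theta>) - f (k * E \<theta>)) * exp (- beta \<alpha> \<theta>) \<le> rate \<gamma> \<theta>"
          using nz by (simp add: rate_def)
        moreover have "(deriv \<gamma> \<theta> * (k * E \<theta>) - f (k * E \<theta>)) * exp (- beta \<alpha> \<theta>) = k * deriv \<gamma> \<theta> * (E \<theta> * exp (- beta \<alpha> \<theta>)) - flx k \<theta>"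
          by (simp add: flx_def algebra_simps)
        moreover have "E \<theta> * exp (- beta \<alpha> \<theta>) = 1" by (simp add: exp_minus)
        ultimately show ?thesis using \<psi>(2)[OF in' nz] by simp
      qed
      then show ?thesis using False by simp
    qed simp
  qed
qed

lemma C_lower_G:
  assumes lip: "L-lipschitz_on {s..t} \<gamma>" and pos: "\<And>\<theta>. \<theta> \<in> {s..t} \<Longrightarrow> 0 \<le> \<gamma> \<theta>" and st: "0 \<le> s" "s \<le> t"
    and "\<And>\<theta>. s < \<theta> \<Longrightarrow> \<theta> < t \<Longrightarrow> \<gamma> \<theta> = 0 \<Longrightarrow> bd \<theta> \<le> flx k \<theta>"
  shows "k * (\<gamma> t - \<gamma> s) - G s t k \<le> C \<gamma> s t"
  unfolding G_def using assms by (intro C_lower spd_flx_integrable) auto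

text \<open>Fenchel's inequality is an equality along an h-curve. The result is only an upper bound
  because the curve may touch the t-axis; there its speed is 0 and the boundary rate does not exceed
  the interior one.\<close>

lemma C_curve_upper:
  assumes st: "0 \<le> s" "s \<le> t" and \<gamma>: "\<And>\<theta>. \<theta> \<in> {s..t} \<Longrightarrow> \<gamma> \<theta> = \<xi> + F s \<theta> c" "\<And>\<theta>. \<theta> \<in> {s..t} \<Longrightarrow> 0 \<le> \<gamma> \<theta>"
    and lip: "L-lipschitz_on {s..t} \<gamma>"
  shows "C \<gamma> s t \<le> cost s t c"
proof -
  have i0: "((\<lambda>\<theta>. c * spd c \<theta> - flx c \<theta>) has_integral cost s t c) {s..t}"
    unfolding cost_def F_def G_def using spd_flx_integrable[OF st(1)]
    by (intro has_integral_diff has_integral_mult_right) auto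
  have i1: "((\<lambda>\<theta>. if \<theta> \<in> {s, t} then 0 else c * spd c \<theta> - flx c \<theta>) has_integral cost s t c) {s..t}"
    by (rule has_integral_spike[of "{s, t}" _ _ _ _, OF _ _ i0]) auto
  have i2: "((\<lambda>\<theta>. if \<theta> \<in> {s, t} then 0 else rate \<gamma> \<theta>) has_integral C \<gamma> s t) {s..t}"
    by (rule has_integral_spike[of "{s, t}" _ _ "rate \<gamma>"]) (use rate_integrable[OF lip st] in \<open>auto simp: C_def\<close>)
  show ?thesis
  proof (rule has_integral_le[OF i2 i1])
    fix \<theta> assume \<theta>: "\<theta> \<in> {s..t}"
    show "(if \<theta> \<in> {s, t} then 0 else rate \<gamma> \<theta>) \<le> (if \<theta> \<in> {s, t} then 0 else c * spd c \<theta> - flx c \<theta>)"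
    proof (cases "\<theta> \<in> {s, t}")
      case False
      then have in': "s < \<theta>" "\<theta> < t" using \<theta> by auto
      have "((\<lambda>r. \<xi> + F s r c) has_real_derivative spd c \<theta>) (at \<theta> within {s..t})"
        using F_has_derivative[OF st(1) \<theta>] by (auto intro!: derivative_eq_intros)
      then have "((\<lambda>r. \<xi> + F s r c) has_real_derivative spd c \<theta>) (at \<theta>)"
        by (simp only: at_within_Icc_at[OF in'])
      moreover have ev: "\<forall>\<^sub>F y in nhds \<theta>. \<xi> + F s y c = \<gamma> y"
      proof -
        have "\<forall>\<^sub>F y in nhds \<theta>. y \<in> {s<..<t}" using in' by (intro eventually_nhds_in_open) auto
        then show ?thesis by eventually_elim (use \<gamma>(1) in auto)
      qed
      ultimately have d: "(\<gamma> has_real_derivative spd c \<theta>) (at \<theta>)"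
        using DERIV_cong_ev[OF refl ev refl] by blast
      have eq: "fstar f (spd c \<theta>) * exp (- beta \<alpha> \<theta>) = c * spd c \<theta> - flx c \<theta>"
      proof -
        have "fstar f (spd c \<theta>) * exp (- beta \<alpha> \<theta>) = c * spd c \<theta> * (E \<theta> * exp (- beta \<alpha> \<theta>)) - flx c \<theta>"
          by (simp add: spd_def fstar_eq flx_def algebra_simps)
        then show ?thesis by (simp add: exp_minus)
      qed
      have "rate \<gamma> \<theta> \<le> c * spd c \<theta> - flx c \<theta>"
      proof (cases "\<gamma> \<theta> = 0")
        case True
        then have "spd c \<theta> = 0" using zero_deriv_at_zero[OF d True \<gamma>(2) in'] by simp
        then show ?thesis using eq bd_ge[of \<theta>] True by (simp add: rate_def)
      qed (use eq DERIV_imp_deriv[OF d] in \<open>simp add: rate_def\<close>)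
      then show ?thesis using False by simp
    qed simp
  qed
qed

lemma spd_bound: obtains S where "0 \<le> S" "\<And>c \<theta>. \<bar>c\<bar> \<le> K \<Longrightarrow> \<theta> \<in> {0..T} \<Longrightarrow> \<bar>spd c \<theta>\<bar> \<le> S \<and> \<bar>flx c \<theta>\<bar> \<le> S"
proof -
  have c: "compact ((\<lambda>(c, \<theta>). spd c \<theta>) ` ({-K..K} \<times> {0..T}))" "compact ((\<lambda>(c, \<theta>). flx c \<theta>) ` ({-K..K} \<times> {0..T}))"
    by (intro compact_continuous_image continuous_on_subset[OF spd_flx_joint_continuous(1)]
        continuous_on_subset[OF spd_flx_joint_continuous(2)] compact_Times; auto)+
  obtain S1 where S1: "\<And>x. x \<in> (\<lambda>(c, \<theta>). spd c \<theta>) ` ({-K..K} \<times> {0..T}) \<Longrightarrow> norm x \<le> S1"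
    using compact_imp_bounded[OF c(1)] unfolding bounded_iff by blast
  obtain S2 where S2: "\<And>x. x \<in> (\<lambda>(c, \<theta>). flx c \<theta>) ` ({-K..K} \<times> {0..T}) \<Longrightarrow> norm x \<le> S2"
    using compact_imp_bounded[OF c(2)] unfolding bounded_iff by blast
  show ?thesis
  proof (rule that[of "max 0 (max S1 S2)"])
    fix c \<theta> assume "\<bar>c\<bar> \<le> K" "\<theta> \<in> {0..T}"
    then have "(c, \<theta>) \<in> {-K..K} \<times> {0..T}" by auto
    from imageI[OF this, of "\<lambda>(c, \<theta>). spd c \<theta>"] imageI[OF this, of "\<lambda>(c, \<theta>). flx c \<theta>"]
    show "\<bar>spd c \<theta>\<bar> \<le> max 0 (max S1 S2) \<and> \<bar>flx c \<theta>\<bar> \<le> max 0 (max S1 S2)"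
      using S1 S2 by (force simp: le_max_iff_disj)
  qed simp
qed

lemma F_G_bound:
  assumes S: "\<And>\<theta>. \<theta> \<in> {0..T} \<Longrightarrow> \<bar>spd c \<theta>\<bar> \<le> S \<and> \<bar>flx c \<theta>\<bar> \<le> S" and "0 \<le> s" "s \<le> t" "t \<le> T"
  shows "\<bar>F s t c\<bar> \<le> S * (t - s)" "\<bar>G s t c\<bar> \<le> S * (t - s)"
proof -
  have "norm (integral {s..t} (spd c)) \<le> integral {s..t} (\<lambda>_. S)" "norm (integral {s..t} (flx c)) \<le> integral {s..t} (\<lambda>_. S)"
    using S assms by (intro integral_norm_bound_integral spd_flx_integrable; auto)+
  then show "\<bar>F s t c\<bar> \<le> S * (t - s)" "\<bar>G s t c\<bar> \<le> S * (t - s)"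
    using assms by (simp_all add: F_def G_def mult.commute)
qed

lemma curve_lipschitz:
  assumes "0 \<le> s"
  shows "\<exists>L. L-lipschitz_on {s..t} (\<lambda>\<theta>. \<xi> + F s \<theta> c)"
proof -
  obtain S where S: "0 \<le> S" "\<And>\<theta>. \<theta> \<in> {0..t} \<Longrightarrow> \<bar>spd c \<theta>\<bar> \<le> S \<and> \<bar>flx c \<theta>\<bar> \<le> S"
    using spd_bound[of "\<bar>c\<bar>" t] by (metis order_refl)
  have *: "\<bar>F s y c - F s x c\<bar> \<le> S * (y - x)" if "s \<le> x" "x \<le> y" "y \<le> t" for x y
    using F_G_bound(1)[OF S(2), where s = x and t = y and T = t] F_add[of s x y c] that assms by auto
  have "S-lipschitz_on {s..t} (\<lambda>\<theta>. \<xi> + F s \<theta> c)"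
  proof (rule lipschitz_onI)
    fix x y assume "x \<in> {s..t}" "y \<in> {s..t}"
    then show "dist (\<xi> + F s x c) (\<xi> + F s y c) \<le> S * dist x y"
      using *[of x y] *[of y x] by (cases "x \<le> y") (auto simp: dist_real_def abs_minus_commute)
  qed (rule S)
  then show ?thesis by blast
qed

text \<open>The \<open>h\<close>-curves with parameter \<open>\<plusminus>K\<close> serve as barriers: their states dominate the initial and the
  boundary data, so the affine bounds on the cost that they define also hold for paths resting on the boundary.\<close>

definition Kbig :: "real \<Rightarrow> real \<Rightarrow> bool" where
  "Kbig T K \<longleftrightarrow> 0 \<le> K \<and> (\<forall>y\<ge>0. \<forall>y'\<ge>0. \<bar>U0 y - U0 y'\<bar> \<le> K * \<bar>y - y'\<bar>) \<and>
    (\<forall>\<theta>\<in>{0..T}. lam f \<le> K * E \<theta> \<and> - K * E \<theta> \<le> lam f \<and> bd \<theta> \<le> flx K \<theta> \<and> bd \<theta> \<le> flx (- K) \<theta>)"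

lemma Kbig_ex: obtains K0 where "0 \<le> K0" "\<And>K. K0 \<le> K \<Longrightarrow> Kbig T K"
proof -
  obtain M where M: "0 \<le> M" "\<And>y y'. 0 \<le> y \<Longrightarrow> 0 \<le> y' \<Longrightarrow> \<bar>U0 y - U0 y'\<bar> \<le> M * \<bar>y - y'\<bar>"
    using U0_lipschitz by metis
  obtain R where R: "\<And>\<theta>. 0 \<le> \<theta> \<Longrightarrow> lam f \<le> ubar f ub \<theta> \<and> ubar f ub \<theta> \<le> R" "lam f \<le> R"
    using ubar_bounded by metis
  obtain Q where Q: "0 < Q" "\<And>u. Q \<le> \<bar>u\<bar> \<Longrightarrow> \<bar>f R\<bar> + 1 \<le> f u / \<bar>u\<bar>" using f_large[of "\<bar>f R\<bar> + 1"] by blast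
  \<comment> \<open>Superlinear growth puts \<open>f\<close> above \<open>f R\<close>, an upper
    bound of the boundary fluxes, at all states of modulus at least \<open>v\<close>; being beyond
    \<open>lam f\<close> as well, these states have speeds of known sign.\<close>
  define v where "v = max (max \<bar>R\<bar> \<bar>lam f\<bar>) (max Q 1)"
  have fv: "f R \<le> f u" if "v \<le> \<bar>u\<bar>" for u
  proof -
    have u: "1 \<le> \<bar>u\<bar>" "Q \<le> \<bar>u\<bar>" using that by (auto simp: v_def)
    have "f R \<le> (\<bar>f R\<bar> + 1) * 1" by simp
    also have "\<dots> \<le> (\<bar>f R\<bar> + 1) * \<bar>u\<bar>" using u by (intro mult_left_mono) auto
    also have "\<dots> \<le> f u" using Q(2)[OF u(2)] u by (simp add: pos_le_divide_eq)
    finally show ?thesis .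
  qed
  obtain c1 where c1: "\<And>c \<theta>. c1 \<le> c \<Longrightarrow> \<theta> \<in> {0..T} \<Longrightarrow> v \<le> c * E \<theta>" using spd_ge_ex[of T v] by blast
  show ?thesis
  proof (rule that[of "max (max M c1) 0"])
    fix K assume K: "max (max M c1) 0 \<le> K"
    have "\<bar>U0 y - U0 y'\<bar> \<le> K * \<bar>y - y'\<bar>" if "0 \<le> y" "0 \<le> y'" for y y'
      using M(2)[OF that] K mult_right_mono[of M K "\<bar>y - y'\<bar>"] by simp
    moreover have "lam f \<le> K * E \<theta> \<and> - K * E \<theta> \<le> lam f \<and> bd \<theta> \<le> flx K \<theta> \<and> bd \<theta> \<le> flx (- K) \<theta>" if \<theta>: "\<theta> \<in> {0..T}" for \<theta>
    proof -
      have "v \<le> K * E \<theta>" using c1 K \<theta> by simp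
      then have "lam f \<le> K * E \<theta>" "- K * E \<theta> \<le> lam f" "f R \<le> f (K * E \<theta>)" "f R \<le> f (- K * E \<theta>)"
        using fv[of "K * E \<theta>"] fv[of "- K * E \<theta>"] by (auto simp: v_def)
      moreover have "f (ubar f ub \<theta>) \<le> f R" using R(1)[of \<theta>] \<theta> f_mono_right by auto
      ultimately show ?thesis by (auto simp: bd_def flx_def mult.commute[of "exp (- beta \<alpha> \<theta>)"])
    qed
    ultimately show "Kbig T K" using K by (simp add: Kbig_def)
  qed simp
qed

lemma KbigD:
  assumes "Kbig T K"
  shows "0 \<le> K" "\<And>y y'. 0 \<le> y \<Longrightarrow> 0 \<le> y' \<Longrightarrow> \<bar>U0 y - U0 y'\<bar> \<le> K * \<bar>y - y'\<bar>"
    "\<And>\<theta>. \<theta> \<in> {0..T} \<Longrightarrow> 0 \<le> spd K \<theta>" "\<And>\<theta>. \<theta> \<in> {0..T} \<Longrightarrow> spd (- K) \<theta> \<le> 0"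
    "\<And>\<theta>. \<theta> \<in> {0..T} \<Longrightarrow> bd \<theta> \<le> flx K \<theta>" "\<And>\<theta>. \<theta> \<in> {0..T} \<Longrightarrow> bd \<theta> \<le> flx (- K) \<theta>"
  using assms unfolding Kbig_def spd_def by (auto simp: lam_iff)

lemma F_sign:
  assumes "0 \<le> s" "s \<le> t" "\<And>\<theta>. \<theta> \<in> {s..t} \<Longrightarrow> 0 \<le> spd c \<theta>"
  shows "0 \<le> F s t c"
  unfolding F_def using assms by (intro integral_nonneg spd_flx_integrable) auto

lemma F_sign':
  assumes "0 \<le> s" "s \<le> t" "\<And>\<theta>. \<theta> \<in> {s..t} \<Longrightarrow> spd c \<theta> \<le> 0"
  shows "F s t c \<le> 0"
  using integral_le[of "spd c" "{s..t}" "\<lambda>_. 0"] spd_flx_integrable[of s c t] assms by (auto simp: F_def)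

subsection \<open>The value function\<close>

abbreviation "V \<equiv> W f \<alpha> u0 ub"
abbreviation "Jv \<equiv> J f \<alpha> u0 ub"

lemma Gam_iff: "\<gamma> \<in> Gam x t \<longleftrightarrow> path_in \<gamma> 0 t \<and> \<gamma> t = x"
  unfolding Gam_def by auto

lemma Gam_const: "0 \<le> x \<Longrightarrow> (\<lambda>_. x) \<in> Gam x t"
  unfolding Gam_iff by (auto intro!: exI[of _ 0] simp: lipschitz_on_def)

lemma J_split:
  assumes "\<gamma> \<in> Gam x t" "0 \<le> s" "s \<le> t"
  shows "\<gamma> \<in> Gam (\<gamma> s) s" "Jv \<gamma> t = Jv \<gamma> s + C \<gamma> s t"
proof -
  obtain L where L: "L-lipschitz_on {0..t} \<gamma>" using assms(1) by (auto simp: Gam_iff)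
  have L': "L-lipschitz_on {0..s} \<gamma>" by (rule lipschitz_on_subset[OF L]) (use assms in auto)
  show "\<gamma> \<in> Gam (\<gamma> s) s" using assms L' by (auto simp: Gam_iff)
  show "Jv \<gamma> t = Jv \<gamma> s + C \<gamma> s t"
    using J_eq[OF L] J_eq[OF L'] C_add[OF L, of s] assms by auto
qed

lemma C_lower_K:
  assumes "path_in \<gamma> s t" "0 \<le> s" "s \<le> t" "t \<le> T" "Kbig T K" "k = K \<or> k = - K"
  shows "k * (\<gamma> t - \<gamma> s) - G s t k \<le> C \<gamma> s t"
proof -
  obtain L where "L-lipschitz_on {s..t} \<gamma>" using assms by auto
  then show ?thesis
    by (rule C_lower_G) (use assms KbigD(5,6)[OF assms(5)] in auto)
qed

lemma path_in_subset:
  fixes s t s' t' :: real and \<gamma> :: "real \<Rightarrow> real"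
  shows "path_in \<gamma> s t \<Longrightarrow> s \<le> s' \<Longrightarrow> t' \<le> t \<Longrightarrow> path_in \<gamma> s' t'"
proof (elim conjE exE, intro conjI)
  fix L assume L: "L-lipschitz_on {s..t} \<gamma>" and st: "s \<le> s'" "t' \<le> t" and p: "\<forall>\<theta>\<in>{s..t}. 0 \<le> \<gamma> \<theta>"
  have sub: "{s'..t'} \<subseteq> {s..t}" using st by auto
  show "\<exists>L. L-lipschitz_on {s'..t'} \<gamma>" using lipschitz_on_subset[OF L sub] by blast
  show "\<forall>\<theta>\<in>{s'..t'}. 0 \<le> \<gamma> \<theta>" using p sub by blast
qed

text \<open>The parameter \<open>- K\<close> suits the initial term: \<open>U0 (\<gamma> 0)\<close>
  is at least \<open>- K * \<gamma> 0\<close>, which cancels the contribution of the unknown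
  starting point.\<close>

lemma J_lower:
  assumes "Kbig t K" "\<gamma> \<in> Gam x t" "0 \<le> t"
  shows "- K * x - G 0 t (- K) \<le> Jv \<gamma> t"
proof -
  have p: "path_in \<gamma> 0 t" "\<gamma> t = x" using assms by (auto simp: Gam_iff)
  then have "Jv \<gamma> t = C \<gamma> 0 t + U0 (\<gamma> 0)" using J_eq assms by blast
  moreover have "- K * (\<gamma> t - \<gamma> 0) - G 0 t (- K) \<le> C \<gamma> 0 t"
    using p assms by (intro C_lower_K) auto
  moreover have "\<bar>U0 (\<gamma> 0) - U0 0\<bar> \<le> K * \<bar>\<gamma> 0 - 0\<bar>" "0 \<le> \<gamma> 0"
    using KbigD(2)[OF assms(1), of "\<gamma> 0" 0] p assms(3) by auto
  ultimately show ?thesis using p by (auto simp: algebra_simps)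
qed

lemma W_le: "\<gamma> \<in> Gam x t \<Longrightarrow> 0 \<le> t \<Longrightarrow> V x t \<le> Jv \<gamma> t"
proof -
  assume a: "\<gamma> \<in> Gam x t" "0 \<le> t"
  obtain K where K: "Kbig t K" using Kbig_ex[of t] by (metis order_refl)
  have "bdd_below ((\<lambda>\<gamma>. Jv \<gamma> t) ` Gam x t)"
    unfolding bdd_below_def using J_lower[OF K _ a(2)] by blast
  then show ?thesis unfolding W_def using a by (intro cINF_lower) auto
qed

lemma W_ge: "0 \<le> x \<Longrightarrow> (\<And>\<gamma>. \<gamma> \<in> Gam x t \<Longrightarrow> m \<le> Jv \<gamma> t) \<Longrightarrow> m \<le> V x t"
  unfolding W_def using Gam_const by (intro cINF_greatest) auto

lemma W_split:
  assumes "\<gamma> \<in> Gam x t" "0 \<le> s" "s \<le> t"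
  shows "V (\<gamma> s) s + C \<gamma> s t \<le> Jv \<gamma> t"
  using J_split[OF assms] W_le assms(2) by fastforce

text \<open>One half of the dynamic programming principle: every path to
  \<open>(\<eta> s, s)\<close> may be continued by \<open>\<eta>\<close>.\<close>

lemma W_extend:
  assumes \<eta>: "path_in \<eta> s t" and st: "0 \<le> s" "s \<le> t"
  shows "V (\<eta> t) t \<le> V (\<eta> s) s + C \<eta> s t"
proof -
  have "V (\<eta> t) t - C \<eta> s t \<le> V (\<eta> s) s"
  proof (rule W_ge)
    show "0 \<le> \<eta> s" using \<eta> st by auto
    fix \<gamma> assume g: "\<gamma> \<in> Gam (\<eta> s) s"
    define \<zeta> where "\<zeta> = (\<lambda>\<theta>. if \<theta> \<le> s then \<gamma> \<theta> else \<eta> \<theta>)"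
    obtain L1 where L1: "L1-lipschitz_on {0..s} \<gamma>" using g by (auto simp: Gam_iff)
    obtain L2 where L2: "L2-lipschitz_on {s..t} \<eta>" using \<eta> by auto
    have "(max L1 L2)-lipschitz_on {0..t} \<zeta>"
      unfolding \<zeta>_def using L1 L2 g by (intro lipschitz_on_concat_max) (auto simp: Gam_iff)
    then have \<zeta>: "\<zeta> \<in> Gam (\<eta> t) t"
      using g \<eta> st by (auto simp: Gam_iff \<zeta>_def)
    have e: "\<zeta> \<theta> = \<eta> \<theta>" if "\<theta> \<in> {s..t}" for \<theta> using that g by (auto simp: \<zeta>_def Gam_iff)
    have "Jv \<zeta> t = Jv \<zeta> s + C \<eta> s t"
      using J_split(2)[OF \<zeta> st] C_cong[of s t \<zeta> \<eta>, OF e] by simp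
    moreover have "Jv \<zeta> s = Jv \<gamma> s"
    proof -
      have "L1-lipschitz_on {0..s} \<zeta>" using L1 by (rule lipschitz_on_transform) (auto simp: \<zeta>_def)
      then show ?thesis
        using J_eq[of L1 s \<zeta>] J_eq[OF L1] C_cong[of 0 s \<zeta> \<gamma>] st by (auto simp: \<zeta>_def)
    qed
    ultimately show "V (\<eta> t) t - C \<eta> s t \<le> Jv \<gamma> s"
      using W_le[OF \<zeta>] st by auto
  qed
  then show ?thesis by simp
qed

lemma W_curve:
  assumes "0 \<le> s" "s \<le> t" "\<And>\<theta>. \<theta> \<in> {s..t} \<Longrightarrow> 0 \<le> \<xi> + F s \<theta> c"
  shows "V (\<xi> + F s t c) t \<le> V \<xi> s + cost s t c"
proof -
  obtain L where L: "L-lipschitz_on {s..t} (\<lambda>\<theta>. \<xi> + F s \<theta> c)" using curve_lipschitz[OF assms(1)] by blast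
  have "V (\<xi> + F s t c) t \<le> V (\<xi> + F s s c) s + C (\<lambda>\<theta>. \<xi> + F s \<theta> c) s t"
    using assms L by (intro W_extend) auto
  also have "C (\<lambda>\<theta>. \<xi> + F s \<theta> c) s t \<le> cost s t c"
    by (rule C_curve_upper[OF assms(1,2) _ _ L]) (use assms in auto)
  finally show ?thesis by simp
qed

text \<open>Curves are indexed by their upper endpoint, so that those through one point are ordered
  by their parameters alone: the larger the parameter, the further left the past.\<close>

definition zc :: "real \<Rightarrow> real \<Rightarrow> real \<Rightarrow> real \<Rightarrow> real" where "zc x t c \<theta> = x - F \<theta> t c"

lemma zc_end [simp]: "zc x t c t = x" by (simp add: zc_def)

lemma zc_forward: "0 \<le> s \<Longrightarrow> s \<le> \<theta> \<Longrightarrow> \<theta> \<le> t \<Longrightarrow> zc x t c \<theta> = zc x t c s + F s \<theta> c"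
  using F_add[of s \<theta> t c] by (simp add: zc_def)

lemma zc_restart: "0 \<le> \<theta> \<Longrightarrow> \<theta> \<le> s \<Longrightarrow> s \<le> t \<Longrightarrow> zc (zc x t c s) s c \<theta> = zc x t c \<theta>"
  using F_add[of \<theta> s t c] by (simp add: zc_def)

lemma zc_less_iff: "0 \<le> \<theta> \<Longrightarrow> \<theta> < t \<Longrightarrow> zc x t c \<theta> < zc x t c' \<theta> \<longleftrightarrow> c' < c"
  and zc_le_iff: "0 \<le> \<theta> \<Longrightarrow> \<theta> < t \<Longrightarrow> zc x t c \<theta> \<le> zc x t c' \<theta> \<longleftrightarrow> c' \<le> c"
  by (auto simp: zc_def F_less_iff F_le_iff)

lemma zc_anti: "0 \<le> \<theta> \<Longrightarrow> \<theta> \<le> t \<Longrightarrow> c \<le> c' \<Longrightarrow> zc x t c' \<theta> \<le> zc x t c \<theta>"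
  using F_mono[of \<theta> t c c'] by (simp add: zc_def)

lemma zc_continuous: "0 \<le> s \<Longrightarrow> continuous_on {s..t} (zc x t c)"
  unfolding zc_def continuous_on_def
  by (auto intro!: tendsto_diff F_tendsto(1) simp: eventually_at_filter)

lemma W_zc:
  assumes "0 \<le> s" "s \<le> t" "\<And>\<theta>. \<theta> \<in> {s..t} \<Longrightarrow> 0 \<le> zc x t c \<theta>"
  shows "V x t \<le> V (zc x t c s) s + cost s t c"
proof -
  have "0 \<le> zc x t c s + F s \<theta> c" if "\<theta> \<in> {s..t}" for \<theta>
    using assms(3)[OF that] zc_forward[of s \<theta> t x c] assms(1) that by auto
  then have "V (zc x t c s + F s t c) t \<le> V (zc x t c s) s + cost s t c"
    using assms by (intro W_curve) auto
  then show ?thesis by (simp add: zc_def)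
qed

lemma cost_zc: "cost s t c = c * (x - zc x t c s) - G s t c"
  by (simp add: cost_def zc_def)

lemma W_time0: "0 \<le> y \<Longrightarrow> V y 0 = U0 y"
proof -
  assume y: "0 \<le> y"
  have J: "Jv \<gamma> 0 = U0 y" if g: "\<gamma> \<in> Gam y 0" for \<gamma>
  proof -
    obtain L where "L-lipschitz_on {0..0} \<gamma>" using g by (auto simp: Gam_iff)
    from J_eq[OF this] show ?thesis using g by (simp add: C_def Gam_iff)
  qed
  have "U0 y \<le> V y 0" using J y by (intro W_ge) auto
  moreover have "V y 0 \<le> U0 y" using W_le[OF Gam_const[OF y, of 0]] J[OF Gam_const[OF y, of 0]] by simp
  ultimately show ?thesis by simp
qed

section \<open>Lipschitz continuity of the value function\<close>

lemma W_le_cross: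
  assumes K: "Kbig T K" "k = K \<or> k = - K" and "0 \<le> s" "s \<le> \<tau>" "\<tau> \<le> T" and g: "\<gamma> \<in> Gam \<xi> \<tau>"
    and z: "\<gamma> s = zc x \<tau> k s" "\<And>\<theta>. \<theta> \<in> {s..\<tau>} \<Longrightarrow> 0 \<le> zc x \<tau> k \<theta>"
  shows "V x \<tau> \<le> Jv \<gamma> \<tau> + k * (x - \<xi>)"
proof -
  have "V x \<tau> \<le> V (\<gamma> s) s + cost s \<tau> k"
    using W_zc[of s \<tau> x k] z assms by simp
  moreover have "cost s \<tau> k = k * (x - \<gamma> s) - G s \<tau> k" using cost_zc[of s \<tau> k x] z(1) by simp
  \<comment> \<open>The same \<open>k\<close> gives the exact cost of the replacing curve and a
    lower bound for the replaced piece; \<open>G\<close> cancels and only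
    \<open>k * (x - \<xi>)\<close> survives.\<close>
  moreover have "k * (\<gamma> \<tau> - \<gamma> s) - G s \<tau> k \<le> C \<gamma> s \<tau>"
    using g assms path_in_subset[of 0 \<tau> \<gamma> s \<tau>] by (intro C_lower_K[OF _ _ _ _ K]) (auto simp: Gam_iff)
  moreover have "V (\<gamma> s) s + C \<gamma> s \<tau> \<le> Jv \<gamma> \<tau>" by (rule W_split[OF g assms(3,4)])
  moreover have "\<gamma> \<tau> = \<xi>" using g by (simp add: Gam_iff)
  ultimately show ?thesis by (simp add: algebra_simps)
qed

lemma W_le_foot:
  assumes K: "Kbig T K" "k = K \<or> k = - K" and "0 \<le> \<tau>" "\<tau> \<le> T" and g: "\<gamma> \<in> Gam \<xi> \<tau>"
    and z: "U0 (zc x \<tau> k 0) - k * zc x \<tau> k 0 \<le> U0 (\<gamma> 0) - k * \<gamma> 0" "\<And>\<theta>. \<theta> \<in> {0..\<tau>} \<Longrightarrow> 0 \<le> zc x \<tau> k \<theta>"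
  shows "V x \<tau> \<le> Jv \<gamma> \<tau> + k * (x - \<xi>)"
proof -
  have "V x \<tau> \<le> U0 (zc x \<tau> k 0) + cost 0 \<tau> k"
    using W_zc[of 0 \<tau> x k] z assms W_time0[of "zc x \<tau> k 0"] by simp
  moreover have "cost 0 \<tau> k = k * (x - zc x \<tau> k 0) - G 0 \<tau> k" by (rule cost_zc)
  moreover have "k * (\<gamma> \<tau> - \<gamma> 0) - G 0 \<tau> k \<le> C \<gamma> 0 \<tau>"
    using g assms by (intro C_lower_K[OF _ _ _ _ K]) (auto simp: Gam_iff)
  moreover have "Jv \<gamma> \<tau> = C \<gamma> 0 \<tau> + U0 (\<gamma> 0)" using g J_eq assms(3) by (auto simp: Gam_iff)
  moreover have "\<gamma> \<tau> = \<xi>" using g by (simp add: Gam_iff)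
  ultimately show ?thesis using z(1) by (simp add: algebra_simps)
qed

text \<open>A path to \<open>(\<xi>,\<tau>)\<close> either meets the \<open>h\<close>-curve with parameter \<open>\<plusminus>K\<close> through \<open>(x,\<tau>)\<close>, and can be
  switched to it there, or that curve has a foot on the \<open>x\<close>-axis that is comparable with the starting point of the path.\<close>

lemma W_lipschitz_space:
  assumes K: "Kbig T K" and "0 \<le> \<tau>" "\<tau> \<le> T" "0 \<le> x" "0 \<le> \<xi>"
  shows "V x \<tau> \<le> V \<xi> \<tau> + K * \<bar>x - \<xi>\<bar>"
proof -
  have "V x \<tau> - K * \<bar>x - \<xi>\<bar> \<le> V \<xi> \<tau>"
  proof (rule W_ge)
    fix \<gamma> assume g: "\<gamma> \<in> Gam \<xi> \<tau>"
    have cg: "continuous_on {0..\<tau>} \<gamma>" using g by (auto simp: Gam_iff intro: lipschitz_on_continuous_on)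
    have g0: "0 \<le> \<gamma> 0" "\<gamma> \<tau> = \<xi>" using g assms by (auto simp: Gam_iff)
    have KU: "\<bar>U0 y - U0 y'\<bar> \<le> K * \<bar>y - y'\<bar>" if "0 \<le> y" "0 \<le> y'" for y y' using KbigD(2)[OF K that] .
    show "V x \<tau> - K * \<bar>x - \<xi>\<bar> \<le> Jv \<gamma> \<tau>"
    proof (cases "\<xi> \<le> x")
      case True
      \<comment> \<open>Backwards in time this curve moves left and may leave the quarter plane; the
        path stays inside, so the crossing occurs where the curve is still nonnegative.\<close>
      define z where "z = zc x \<tau> K"
      have zmono: "z \<theta> \<le> z \<theta>'" if "0 \<le> \<theta>" "\<theta> \<le> \<theta>'" "\<theta>' \<le> \<tau>" for \<theta> \<theta>'
        using zc_forward[of \<theta> \<theta>' \<tau> x K] F_sign[of \<theta> \<theta>' K] KbigD(3)[OF K] that assms by (auto simp: z_def)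
      have "V x \<tau> \<le> Jv \<gamma> \<tau> + K * (x - \<xi>)"
      proof (cases "0 \<le> z 0 \<and> \<gamma> 0 < z 0")
        case f: True
        show ?thesis
        proof (rule W_le_foot[OF K _ assms(2,3) g])
          show "U0 (zc x \<tau> K 0) - K * zc x \<tau> K 0 \<le> U0 (\<gamma> 0) - K * \<gamma> 0"
            using KU[of "z 0" "\<gamma> 0"] f g0 by (auto simp: z_def algebra_simps)
          show "\<And>\<theta>. \<theta> \<in> {0..\<tau>} \<Longrightarrow> 0 \<le> zc x \<tau> K \<theta>"
            using zmono[of 0] f by (force simp: z_def)
        qed auto
      next
        case False
        then have "0 \<le> \<gamma> 0 - z 0" using g0 by auto
        moreover have "\<gamma> \<tau> - z \<tau> \<le> 0" using g0 True by (simp add: z_def)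
        ultimately obtain s where s: "0 \<le> s" "s \<le> \<tau>" "\<gamma> s - z s = 0"
          using IVT2'[of "\<lambda>\<theta>. \<gamma> \<theta> - z \<theta>" \<tau> 0 0] assms(2) cg zc_continuous[of 0 \<tau> x K]
          by (auto simp: z_def intro: continuous_on_diff)
        have zs: "0 \<le> z s" using s g by (auto simp: Gam_iff dest: bspec[of _ _ s])
        show ?thesis
          by (rule W_le_cross[OF K _ s(1,2) assms(3) g]) (use s zs zmono in \<open>fastforce simp: z_def\<close>)+
      qed
      then show ?thesis using True by simp
    next
      case False
      define z where "z = zc x \<tau> (- K)"
      have zpos: "0 \<le> z \<theta>" if "0 \<le> \<theta>" "\<theta> \<le> \<tau>" for \<theta>
        using F_sign'[of \<theta> \<tau> "- K"] KbigD(4)[OF K] that assms by (auto simp: z_def zc_def)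
      have "V x \<tau> \<le> Jv \<gamma> \<tau> + (- K) * (x - \<xi>)"
      proof (cases "z 0 < \<gamma> 0")
        case f: True
        show ?thesis
        proof (rule W_le_foot[OF K _ assms(2,3) g])
          show "U0 (zc x \<tau> (- K) 0) - (- K) * zc x \<tau> (- K) 0 \<le> U0 (\<gamma> 0) - (- K) * \<gamma> 0"
            using KU[of "z 0" "\<gamma> 0"] f g0 zpos[of 0] assms by (auto simp: z_def algebra_simps)
        qed (use zpos in \<open>auto simp: z_def\<close>)
      next
        case f: False
        then have "\<gamma> 0 - z 0 \<le> 0" by auto
        moreover have "0 \<le> \<gamma> \<tau> - z \<tau>" using g0 False by (simp add: z_def)
        ultimately obtain s where s: "0 \<le> s" "s \<le> \<tau>" "\<gamma> s - z s = 0"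
          using IVT'[of "\<lambda>\<theta>. \<gamma> \<theta> - z \<theta>" 0 0 \<tau>] assms(2) cg zc_continuous[of 0 \<tau> x "- K"]
          by (auto simp: z_def intro: continuous_on_diff)
        show ?thesis
          by (rule W_le_cross[OF K _ s(1,2) assms(3) g]) (use s zpos in \<open>auto simp: z_def\<close>)
      qed
      then show ?thesis using False by (simp add: algebra_simps)
    qed
  qed (rule assms)
  then show ?thesis by simp
qed

lemma W_lipschitz:
  obtains D where "0 \<le> D"
    "\<And>x y s t. 0 \<le> x \<Longrightarrow> 0 \<le> y \<Longrightarrow> s \<in> {0..T} \<Longrightarrow> t \<in> {0..T} \<Longrightarrow> \<bar>V x t - V y s\<bar> \<le> D * (\<bar>x - y\<bar> + \<bar>t - s\<bar>)"
proof -
  obtain K where K: "Kbig T K" using Kbig_ex[of T] by (metis order_refl)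
  have K0: "0 \<le> K" using KbigD(1)[OF K] .
  obtain S where S: "0 \<le> S" "\<And>c \<theta>. \<bar>c\<bar> \<le> K \<Longrightarrow> \<theta> \<in> {0..T} \<Longrightarrow> \<bar>spd c \<theta>\<bar> \<le> S \<and> \<bar>flx c \<theta>\<bar> \<le> S"
    using spd_bound[of K T] by metis
  have b: "\<bar>F s t k\<bar> \<le> S * (t - s)" "\<bar>G s t k\<bar> \<le> S * (t - s)" if "0 \<le> s" "s \<le> t" "t \<le> T" "k = K \<or> k = - K" for s t k
    using F_G_bound[of T k S s t] S(2)[of k] that K0 by auto
  define D where "D = K + (2 * K + 1) * S"
  have KD: "K \<le> D" "K * S + (K * S + S) = D - K" "0 \<le> D" using S K0 by (auto simp: D_def algebra_simps)
  have time: "\<bar>V x t - V x s\<bar> \<le> D * (t - s)" if "0 \<le> x" "0 \<le> s" "s \<le> t" "t \<le> T" for x s t :: real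
  proof -
    \<comment> \<open>Backwards in time the barrier with parameter \<open>- K\<close> moves right,
      so it never meets the axis on its way from a positive \<open>x\<close>.\<close>
    have zneg: "x \<le> zc x t (- K) \<theta>" if "\<theta> \<in> {s..t}" for \<theta>
      using F_sign'[of \<theta> t "- K"] KbigD(4)[OF K] that \<open>0 \<le> s\<close> \<open>t \<le> T\<close> by (auto simp: zc_def)
    have "V x t \<le> V (zc x t (- K) s) s + cost s t (- K)"
      using that by (intro W_zc order_trans[OF that(1) zneg]) auto
    moreover have "0 \<le> zc x t (- K) s" using zneg[of s] that by auto
    then have "V (zc x t (- K) s) s \<le> V x s + K * \<bar>zc x t (- K) s - x\<bar>"
      using that by (intro W_lipschitz_space[OF K]) auto
    moreover have "K * \<bar>zc x t (- K) s - x\<bar> \<le> K * (S * (t - s))"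
      using b(1)[of s t "- K"] that K0 by (intro mult_left_mono) (auto simp: zc_def)
    moreover have "\<bar>cost s t (- K)\<bar> \<le> K * (S * (t - s)) + S * (t - s)"
    proof -
      have "\<bar>cost s t (- K)\<bar> \<le> K * \<bar>F s t (- K)\<bar> + \<bar>G s t (- K)\<bar>"
        using K0 abs_triangle_ineq4[of "- K * F s t (- K)" "G s t (- K)"] by (simp add: cost_def abs_mult)
      also have "\<dots> \<le> K * (S * (t - s)) + S * (t - s)"
        using b[of s t "- K"] that K0 by (intro add_mono mult_left_mono) auto
      finally show ?thesis .
    qed
    moreover have "(D - K) * (t - s) \<le> D * (t - s)" using K0 that by (intro mult_right_mono) auto
    ultimately have 1: "V x t \<le> V x s + D * (t - s)"
      unfolding KD(2)[symmetric] by (simp add: algebra_simps)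
    have "V x s - S * (t - s) \<le> V x t"
    proof (rule W_ge)
      fix \<gamma> assume g: "\<gamma> \<in> Gam x t"
      \<comment> \<open>The sign makes the calibration term equal to
        \<open>K * \<bar>x - \<gamma> s\<bar>\<close>, which is exactly what the spatial Lipschitz
        bound at time \<open>s\<close> loses.\<close>
      define k where "k = (if \<gamma> s \<le> x then K else - K)"
      have k: "k = K \<or> k = - K" by (simp add: k_def)
      have gs: "0 \<le> \<gamma> s" "\<gamma> t = x" using g that by (auto simp: Gam_iff)
      have "k * (\<gamma> t - \<gamma> s) - G s t k \<le> C \<gamma> s t"
        using g that path_in_subset[of 0 t \<gamma> s t] by (intro C_lower_K[OF _ _ _ _ K k]) (auto simp: Gam_iff)
      moreover have "V (\<gamma> s) s + C \<gamma> s t \<le> Jv \<gamma> t" using W_split[OF g] that by auto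
      moreover have "V x s \<le> V (\<gamma> s) s + K * \<bar>x - \<gamma> s\<bar>"
        using that gs by (intro W_lipschitz_space[OF K]) auto
      moreover have "K * \<bar>x - \<gamma> s\<bar> = k * (\<gamma> t - \<gamma> s)" using gs by (simp add: k_def algebra_simps)
      moreover have "G s t k \<le> S * (t - s)" using b(2)[of s t k] k that by auto
      ultimately show "V x s - S * (t - s) \<le> Jv \<gamma> t" by linarith
    qed (rule that)
    moreover have "S * (t - s) \<le> D * (t - s)" using S K0 that by (intro mult_right_mono) (auto simp: D_def algebra_simps)
    ultimately show ?thesis using 1 by linarith
  qed
  show ?thesis
  proof (rule that[OF KD(3)])
    fix x y s t :: real assume a: "0 \<le> x" "0 \<le> y" "s \<in> {0..T}" "t \<in> {0..T}"
    have "\<bar>V x t - V x s\<bar> \<le> D * \<bar>t - s\<bar>"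
      using time[of x s t] time[of x t s] a by (cases "s \<le> t") (auto simp: abs_minus_commute)
    moreover have "\<bar>V x s - V y s\<bar> \<le> K * \<bar>x - y\<bar>"
      using W_lipschitz_space[OF K, of s x y] W_lipschitz_space[OF K, of s y x] a by (auto simp: abs_minus_commute)
    moreover have "K * \<bar>x - y\<bar> \<le> D * \<bar>x - y\<bar>" using KD by (intro mult_right_mono) auto
    ultimately show "\<bar>V x t - V y s\<bar> \<le> D * (\<bar>x - y\<bar> + \<bar>t - s\<bar>)" by (simp add: algebra_simps)
  qed
qed

lemma W_tendsto:
  assumes "xn \<longlonglongrightarrow> x" "tn \<longlonglongrightarrow> t" "\<And>n::nat. 0 \<le> xn n" "\<And>n. 0 \<le> tn n"
  shows "(\<lambda>n. V (xn n) (tn n)) \<longlonglongrightarrow> V x t"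
proof -
  have x: "0 \<le> x" "0 \<le> t" using assms by (auto intro: LIMSEQ_le_const)
  obtain T where T: "\<And>n. tn n \<le> T" using convergent_imp_Bseq[of tn] assms(2) Bseq_eq_bounded[of tn]
    by (metis BseqE abs_le_D1 convergentI real_norm_def)
  have tT: "t \<le> T" using assms(2) T by (intro LIMSEQ_le_const2) auto
  obtain D where D: "0 \<le> D" "\<And>x y s t. 0 \<le> x \<Longrightarrow> 0 \<le> y \<Longrightarrow> s \<in> {0..T} \<Longrightarrow> t \<in> {0..T} \<Longrightarrow> \<bar>V x t - V y s\<bar> \<le> D * (\<bar>x - y\<bar> + \<bar>t - s\<bar>)"
    using W_lipschitz[of T] by metis
  have "(\<lambda>n. D * (\<bar>xn n - x\<bar> + \<bar>tn n - t\<bar>)) \<longlonglongrightarrow> D * (\<bar>x - x\<bar> + \<bar>t - t\<bar>)"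
    by (intro tendsto_intros assms)
  then have "(\<lambda>n. D * (\<bar>xn n - x\<bar> + \<bar>tn n - t\<bar>)) \<longlonglongrightarrow> 0" by simp
  then have "(\<lambda>n. V (xn n) (tn n) - V x t) \<longlonglongrightarrow> 0"
    by (rule Lim_null_comparison[rotated]) (use D(2) assms(3,4) x T tT in auto)
  then show ?thesis by (simp add: LIM_zero_iff)
qed

subsection \<open>Extremal curves\<close>

definition adm :: "real \<Rightarrow> real \<Rightarrow> real \<Rightarrow> real \<Rightarrow> bool" where
  "adm c s x t \<longleftrightarrow> 0 \<le> s \<and> s \<le> t \<and> (\<forall>\<theta>\<in>{s..t}. 0 \<le> zc x t c \<theta>)"

definition val :: "real \<Rightarrow> real \<Rightarrow> real \<Rightarrow> real \<Rightarrow> real" where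
  "val c s x t = V (zc x t c s) s + cost s t c"

text \<open>Optimality in this sense survives cutting at any intermediate time and is what corner
  arguments use; \<open>ext\<close> requires in addition a foot on one of the axes and describes the
  minimizers of \<open>A\<close> and \<open>B\<close>.\<close>

definition opt :: "real \<Rightarrow> real \<Rightarrow> real \<Rightarrow> real \<Rightarrow> bool" where
  "opt c s x t \<longleftrightarrow> adm c s x t \<and> V x t = val c s x t"

definition cand :: "real \<Rightarrow> real \<Rightarrow> real \<Rightarrow> real \<Rightarrow> bool" where
  "cand c s x t \<longleftrightarrow> adm c s x t \<and> s < t \<and> (s = 0 \<or> zc x t c s = 0)"

definition ext :: "real \<Rightarrow> real \<Rightarrow> real \<Rightarrow> real \<Rightarrow> bool" where
  "ext c s x t \<longleftrightarrow> cand c s x t \<and> V x t = val c s x t"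

lemma ext_opt: "ext c s x t \<Longrightarrow> opt c s x t"
  by (simp add: ext_def opt_def cand_def)

lemma extD:
  assumes "ext c s x t"
  shows "0 \<le> s" "s < t" "\<And>\<theta>. s \<le> \<theta> \<Longrightarrow> \<theta> \<le> t \<Longrightarrow> 0 \<le> zc x t c \<theta>" "s = 0 \<or> zc x t c s = 0" "0 \<le> x"
proof -
  have a: "0 \<le> s" "s < t" "\<forall>\<theta>\<in>{s..t}. 0 \<le> zc x t c \<theta>" "s = 0 \<or> zc x t c s = 0"
    using assms unfolding ext_def cand_def adm_def by auto
  then show "0 \<le> s" "s < t" "\<And>\<theta>. s \<le> \<theta> \<Longrightarrow> \<theta> \<le> t \<Longrightarrow> 0 \<le> zc x t c \<theta>" "s = 0 \<or> zc x t c s = 0" by auto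
  show "0 \<le> x" using a(2) bspec[OF a(3), of t] by simp
qed

lemma adm_sub:
  assumes "adm c s x t" "s \<le> q" "q \<le> t"
  shows "adm c q x t" "adm c s (zc x t c q) q"
  using assms by (auto simp: adm_def zc_restart)

lemma V_le_val: "adm c s x t \<Longrightarrow> V x t \<le> val c s x t"
  unfolding adm_def val_def by (intro W_zc) auto

lemma val_split:
  assumes "0 \<le> s" "s \<le> q" "q \<le> t"
  shows "val c s x t = val c s (zc x t c q) q - V (zc x t c q) q + val c q x t"
  using assms cost_add[of s q t c] by (simp add: val_def zc_restart)

lemma opt_sub:
  assumes "opt c s x t" "s \<le> q" "q \<le> t"
  shows "opt c q x t" "opt c s (zc x t c q) q"
proof -
  have a: "adm c s x t" "V x t = val c s x t" "0 \<le> s" using assms(1) by (auto simp: opt_def adm_def)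
  note b = adm_sub[OF a(1) assms(2,3)]
  show "opt c q x t" "opt c s (zc x t c q) q"
    using V_le_val[OF b(1)] V_le_val[OF b(2)] val_split[OF a(3) assms(2,3), of c x] a b by (auto simp: opt_def)
qed

lemma opt_join:
  assumes "opt c r (zc x t c s) s" "opt c s x t"
  shows "opt c r x t"
proof -
  have a: "adm c r (zc x t c s) s" "adm c s x t" "V x t = val c s x t" "V (zc x t c s) s = val c r (zc x t c s) s"
    using assms by (auto simp: opt_def)
  have rs: "0 \<le> r" "r \<le> s" "s \<le> t" using a by (auto simp: adm_def)
  have "adm c r x t"
    unfolding adm_def
  proof (intro conjI ballI)
    fix \<theta> assume "\<theta> \<in> {r..t}"
    then show "0 \<le> zc x t c \<theta>"
    proof (cases "\<theta> \<le> s")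
      case True
      then have "0 \<le> zc (zc x t c s) s c \<theta>" using a(1) \<open>\<theta> \<in> {r..t}\<close> by (simp add: adm_def)
      then show ?thesis using zc_restart[of \<theta> s t x c] rs \<open>\<theta> \<in> {r..t}\<close> True by simp
    qed (use a(2) in \<open>auto simp: adm_def\<close>)
  qed (use rs in auto)
  then show ?thesis using val_split[OF rs, of c x] a by (simp add: opt_def)
qed

lemma optI_ext: "opt c s x t \<Longrightarrow> s < t \<Longrightarrow> s = 0 \<or> zc x t c s = 0 \<Longrightarrow> ext c s x t"
  by (simp add: ext_def opt_def cand_def)

lemma ext_restart:
  assumes "ext c s x t" "s < q" "q \<le> t"
  shows "ext c s (zc x t c q) q"
proof (rule optI_ext)
  show "opt c s (zc x t c q) q" using opt_sub(2)[OF ext_opt[OF assms(1)]] assms by simp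
  show "s = 0 \<or> zc (zc x t c q) q c s = 0"
    using extD(1,4)[OF assms(1)] zc_restart[of s q t x c] assms by auto
qed (rule assms)

lemma ext_refoot:
  assumes "ext c s x t" "s \<le> q" "q < t" "zc x t c q = 0"
  shows "ext c q x t"
  using opt_sub(1)[OF ext_opt[OF assms(1)], of q] assms by (intro optI_ext) auto

text \<open>Used to hand over feet: once two extremal curves with one parameter share a point, a
  foot of the lower curve is also one for the later endpoint.\<close>

lemma ext_join:
  assumes "ext c r (zc x t c s) s" "ext c q x t" "q \<le> s" "s < t"
  shows "ext c r x t"
proof -
  have "opt c s x t" using opt_sub(1)[OF ext_opt[OF assms(2)]] assms by auto
  then have "opt c r x t" using opt_join[OF ext_opt[OF assms(1)]] by simp
  moreover have "r = 0 \<or> zc x t c r = 0"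
    using extD(1,2,4)[OF assms(1)] zc_restart[of r s t x c] assms by auto
  ultimately show ?thesis using extD(2)[OF assms(1)] assms by (intro optI_ext) auto
qed

text \<open>Cutting a corner strictly lowers the cost, because \<open>cost\<close> is a strict maximum over the
  parameter of the affine bounds \<open>k * F - G\<close>.\<close>

lemma corner_cut:
  assumes o: "opt c s x t" "opt c' r (zc x t c s) s" and rst: "r < s" "s < t" and ne: "c \<noteq> c'"
    and k: "F r t k = F r s c' + F s t c" and pos: "\<And>\<theta>. \<theta> \<in> {r..t} \<Longrightarrow> 0 \<le> zc x t k \<theta>"
  shows False
proof -
  have r0: "0 \<le> r" using o by (auto simp: opt_def adm_def)
  have eq: "zc x t k r = zc (zc x t c s) s c' r" using k by (simp add: zc_def)
  have "V x t \<le> V (zc x t k r) r + cost r t k" using pos r0 rst by (intro W_zc) auto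
  moreover have "V x t = V (zc x t k r) r + cost r s c' + cost s t c"
    using o unfolding eq by (simp add: opt_def val_def)
  moreover have "cost r t k < cost r s c' + cost s t c"
  proof -
    have "cost r t k = (k * F r s c' - G r s k) + (k * F s t c - G s t k)"
      using G_add[of r s t k] r0 rst k by (simp add: cost_def algebra_simps)
    moreover have "k * F r s c' - G r s k \<le> cost r s c'" "k * F s t c - G s t k \<le> cost s t c"
      using cost_ge[of r s k c'] cost_ge[of s t k c] r0 rst by auto
    moreover have "k * F r s c' - G r s k < cost r s c' \<or> k * F s t c - G s t k < cost s t c"
      using cost_ge_strict[of r s k c'] cost_ge_strict[of s t k c] r0 rst ne by auto
    ultimately show ?thesis by linarith
  qed
  ultimately show False by linarith
qed

lemma F_between:
  assumes "0 \<le> r" "r < s" "s < t" and k: "F r t k = F r s c' + F s t c"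
  shows "c' < c \<Longrightarrow> c' \<le> k \<and> k \<le> c" "c < c' \<Longrightarrow> c \<le> k \<and> k \<le> c'"
proof -
  have e: "F r t k = F r s k + F s t k" using F_add[of r s t k] assms by simp
  have r: "F r s k \<le> F r s c' \<longleftrightarrow> k \<le> c'" "F r s c' \<le> F r s k \<longleftrightarrow> c' \<le> k" using F_le_iff assms by auto
  have t: "F s t k \<le> F s t c \<longleftrightarrow> k \<le> c" "F s t c \<le> F s t k \<longleftrightarrow> c \<le> k" using F_le_iff assms by auto
  show "c' < c \<Longrightarrow> c' \<le> k \<and> k \<le> c" "c < c' \<Longrightarrow> c \<le> k \<and> k \<le> c'"
    using e k r t by (smt (verit))+
qed

text \<open>At the boundary only corners with \<open>c' \<le> c\<close> can occur, and the chord cutting such a corner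
  stays in the quarter plane.\<close>

lemma no_corner:
  assumes o: "opt c s x t" "opt c' r (zc x t c s) s" and rst: "r < s" "s < t"
  shows "c = c'"
proof (rule ccontr)
  assume ne: "c \<noteq> c'"
  define \<xi> where "\<xi> = zc x t c s"
  have r0: "0 \<le> r" using o by (auto simp: opt_def adm_def)
  have p1: "0 \<le> zc x t c \<theta>" if "s \<le> \<theta>" "\<theta> \<le> t" for \<theta> using o(1) that by (auto simp: opt_def adm_def)
  have p2: "0 \<le> zc \<xi> s c' \<theta>" if "r \<le> \<theta>" "\<theta> \<le> s" for \<theta> using o(2) that by (auto simp: opt_def adm_def \<xi>_def)
  show False
  proof (cases "c' < c")
    case True
    \<comment> \<open>The chord has a parameter between \<open>c'\<close> and \<open>c\<close>; it
      lies on or to the right of the outgoing arc on \<open>[s,t]\<close> and of the incoming one on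
      \<open>[r,s]\<close>, hence in the quarter plane.\<close>
    obtain k where k: "F r t k = F r s c' + F s t c" using F_surj[of r t] r0 rst by fastforce
    note kc = F_between(1)[OF r0 rst k True]
    show False
    proof (rule corner_cut[OF o rst ne k])
      fix \<theta> assume th: "\<theta> \<in> {r..t}"
      show "0 \<le> zc x t k \<theta>"
      proof (cases "s \<le> \<theta>")
        case True
        then show ?thesis using p1[of \<theta>] zc_anti[of \<theta> t k c x] kc th r0 by auto
      next
        case False
        have "zc x t k \<theta> = zc \<xi> s c' r + F r \<theta> k"
          using zc_forward[of r \<theta> t x k] th r0 k by (simp add: zc_def \<xi>_def)
        also have "\<dots> \<ge> zc \<xi> s c' r + F r \<theta> c'" using F_mono[of r \<theta> c' k] kc th r0 by simp
        also have "zc \<xi> s c' r + F r \<theta> c' = zc \<xi> s c' \<theta>"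
          using zc_forward[of r \<theta> s \<xi> c'] th r0 False by simp
        finally show ?thesis using p2[of \<theta>] th False by auto
      qed
    qed
  next
    case False
    then have cc: "c < c'" using ne by simp
    show False
    proof (cases "\<xi> = 0")
      case True
      \<comment> \<open>Both arcs are nonnegative and meet at 0: the incoming speed cannot be
        positive and the outgoing one cannot be negative, which contradicts
        \<open>c < c'\<close>.\<close>
      have "spd c' s \<le> 0"
      proof (rule ccontr)
        assume "\<not> ?thesis"
        then have "0 < spd c' s" by simp
        moreover have "(spd c' \<longlongrightarrow> spd c' s) (at s within {r..s})"
          using spd_flx_continuous(1)[OF r0, of s c'] rst by (auto simp: continuous_on_def)
        ultimately have "\<forall>\<^sub>F \<theta> in at s within {r..s}. 0 < spd c' \<theta>" by (simp add: order_tendstoD)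
        then obtain d where d: "0 < d" "\<And>\<theta>. \<theta> \<in> {r..s} \<Longrightarrow> \<theta> \<noteq> s \<Longrightarrow> dist \<theta> s < d \<Longrightarrow> 0 < spd c' \<theta>"
          by (auto simp: eventually_at)
        define a where "a = max r (s - d / 2)"
        have a: "r \<le> a" "a < s" "s - a < d" using d(1) rst by (auto simp: a_def)
        have "integral {a..s} (\<lambda>_. 0) < F a s c'"
          unfolding F_def
          by (intro integral_less_continuous spd_flx_continuous)
            (use a r0 d \<open>0 < spd c' s\<close> in \<open>auto simp: dist_real_def, smt (verit)\<close>)
        then show False using p2[of a] a True by (simp add: zc_def)
      qed
      moreover have "0 \<le> spd c s"
      proof (rule ccontr)
        assume "\<not> ?thesis"
        then have n: "spd c s < 0" by simp
        moreover have "(spd c \<longlongrightarrow> spd c s) (at s within {s..t})"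
          using spd_flx_continuous(1)[of s t c] r0 rst by (auto simp: continuous_on_def)
        ultimately have "\<forall>\<^sub>F \<theta> in at s within {s..t}. spd c \<theta> < 0" by (simp add: order_tendstoD)
        then obtain d where d: "0 < d" "\<And>\<theta>. \<theta> \<in> {s..t} \<Longrightarrow> \<theta> \<noteq> s \<Longrightarrow> dist \<theta> s < d \<Longrightarrow> spd c \<theta> < 0"
          by (auto simp: eventually_at)
        define a where "a = min t (s + d / 2)"
        have a: "a \<le> t" "s < a" "a - s < d" using d(1) rst by (auto simp: a_def)
        have "F s a c < integral {s..a} (\<lambda>_. 0)"
          unfolding F_def
          by (intro integral_less_continuous spd_flx_continuous)
            (use a r0 rst d n in \<open>auto simp: dist_real_def, smt (verit)\<close>)
        then show False
          using p1[of a] a True zc_forward[of s a t x c] r0 rst by (simp add: \<xi>_def)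
      qed
      ultimately have "spd c' s \<le> spd c s" by simp
      then show False using cc by (simp add: spd_def df_le_iff)
    next
      case nz: False
      then have \<xi>: "0 < \<xi>" using p1[of s] rst by (simp add: \<xi>_def)
      obtain S where S: "0 \<le> S" "\<And>k \<theta>. \<bar>k\<bar> \<le> max \<bar>c\<bar> \<bar>c'\<bar> \<Longrightarrow> \<theta> \<in> {0..t} \<Longrightarrow> \<bar>spd k \<theta>\<bar> \<le> S \<and> \<bar>flx k \<theta>\<bar> \<le> S"
        using spd_bound[of "max \<bar>c\<bar> \<bar>c'\<bar>" t] by metis
      have Fb: "\<bar>F a b k\<bar> \<le> S * (b - a)" if "0 \<le> a" "a \<le> b" "b \<le> t" "\<bar>k\<bar> \<le> max \<bar>c\<bar> \<bar>c'\<bar>" for a b k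
        using F_G_bound(1)[of t k S a b] S(2) that by auto
      \<comment> \<open>Only a short chord is needed: it strays at most
        \<open>3 * S * \<delta>\<close>, less than \<open>\<xi>\<close>, from the corner and so
        stays off the axis.\<close>
      define \<delta> where "\<delta> = \<xi> / (4 * (S + 1))"
      have \<delta>: "0 < \<delta>" "4 * (S * \<delta>) \<le> \<xi>" using \<xi> S(1) by (auto simp: \<delta>_def field_simps)
      define r' q where "r' = max r (s - \<delta>)" and "q = min t (s + \<delta>)"
      have rq: "r \<le> r'" "r' < s" "s < q" "q \<le> t" "s - r' \<le> \<delta>" "q - s \<le> \<delta>" "0 \<le> r'"
        using \<delta> rst r0 by (auto simp: r'_def q_def)
      obtain k where k: "F r' q k = F r' s c' + F s q c" using F_surj[of r' q] rq by fastforce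
      note kc = F_between(2)[OF rq(7,2,3) k cc]
      have o1: "opt c s (zc x t c q) q" using opt_sub(2)[OF o(1), of q] rq by auto
      have zq: "zc (zc x t c q) q c s = \<xi>" using zc_restart[of s q t x c] rq r0 rst by (simp add: \<xi>_def)
      have o2: "opt c' r' (zc (zc x t c q) q c s) s"
        using opt_sub(1)[OF o(2), of r'] rq zq by (simp add: \<xi>_def)
      show False
      proof (rule corner_cut[OF o1 o2 rq(2,3) ne k])
        fix \<theta> assume th: "\<theta> \<in> {r'..q}"
        have "zc (zc x t c q) q k \<theta> = zc (zc x t c q) q k r' + F r' \<theta> k"
          using zc_forward[of r' \<theta> q "zc x t c q" k] th rq by auto
        moreover have "zc (zc x t c q) q k r' = \<xi> - F r' s c'"
          using k zq by (simp add: zc_def)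
        moreover have "\<bar>F r' s c'\<bar> \<le> S * \<delta>"
          using Fb[of r' s c'] rq rst mult_left_mono[OF rq(5) S(1)] by auto
        moreover have "\<bar>F r' \<theta> k\<bar> \<le> S * (2 * \<delta>)"
        proof -
          have "\<theta> - r' \<le> 2 * \<delta>" using th rq by auto
          moreover have "\<bar>k\<bar> \<le> max \<bar>c\<bar> \<bar>c'\<bar>" using kc by linarith
          ultimately show ?thesis using Fb[of r' \<theta> k] th rq mult_left_mono[of "\<theta> - r'" "2 * \<delta>" S] S(1) by auto
        qed
        ultimately show "0 \<le> zc (zc x t c q) q k \<theta>" using \<delta> S(1) \<xi> by (simp add: algebra_simps)
      qed
    qed
  qed
qed

text \<open>The conditions on \<open>r\<close> are asymmetric because only the part of the first
  curve after \<open>r\<close> and the part of the second before \<open>r\<close> are joined into a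
  possible corner.\<close>

lemma ext_no_cross:
  assumes "ext c \<sigma> x t" "\<sigma> \<le> r" "r < t" "ext c' \<sigma>' x' t'" "\<sigma>' < r" "r \<le> t'" "zc x t c r = zc x' t' c' r"
  shows "c = c'"
proof (rule no_corner)
  show "opt c r x t" using opt_sub(1)[OF ext_opt[OF assms(1)]] assms by auto
  show "opt c' \<sigma>' (zc x t c r) r" using opt_sub(2)[OF ext_opt[OF assms(4)], of r] assms by auto
qed (use assms in auto)

section \<open>A priori bounds and existence of extremal curves\<close>

lemma V_le_clipped:
  assumes K: "Kbig T K" and a: "adm c \<sigma> x t" "\<sigma> < t" "t \<le> T" and n: "K < \<bar>c\<bar>"
    and k_def: "k = (if 0 < c then K else - K)"
  shows "V x t \<le> V (zc x t c \<sigma>) \<sigma> + (k * F \<sigma> t c - G \<sigma> t k)"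
proof -
  have o: "0 \<le> \<sigma>" "\<And>\<theta>. \<theta> \<in> {\<sigma>..t} \<Longrightarrow> 0 \<le> zc x t c \<theta>"
    using a(1) by (auto simp: adm_def)
  have x0: "0 \<le> x" using o(2)[of t] a by simp
  have pos: "0 \<le> zc x t k \<theta>" if "\<theta> \<in> {\<sigma>..t}" for \<theta>
  proof (cases "0 < c")
    case True
    then show ?thesis using zc_anti[of \<theta> t k c x] o(1) o(2)[OF that] n that by (auto simp: k_def)
  next
    case False
    have "F \<theta> t (- K) \<le> 0" using KbigD(4)[OF K] that o(1) a by (intro F_sign') auto
    then show ?thesis using False x0 by (simp add: k_def zc_def)
  qed
  have "V x t \<le> V (zc x t k \<sigma>) \<sigma> + cost \<sigma> t k" using pos o(1) a by (intro W_zc) auto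
  moreover have "V (zc x t k \<sigma>) \<sigma> \<le> V (zc x t c \<sigma>) \<sigma> + K * \<bar>zc x t k \<sigma> - zc x t c \<sigma>\<bar>"
    using pos[of \<sigma>] o(1,2) a by (intro W_lipschitz_space[OF K]) auto
  \<comment> \<open>The sign of \<open>c\<close> decides the order of the two feet, so the Lipschitz
    error is linear with slope \<open>k\<close> and merges with the cost into the affine bound at
    \<open>k\<close>.\<close>
  moreover have "K * \<bar>zc x t k \<sigma> - zc x t c \<sigma>\<bar> = k * (zc x t k \<sigma> - zc x t c \<sigma>)"
  proof (cases "0 < c")
    case True
    then show ?thesis using zc_anti[of \<sigma> t k c x] o(1) a n by (simp add: k_def)
  next
    case False
    then have "zc x t k \<sigma> \<le> zc x t c \<sigma>" using zc_anti[of \<sigma> t c k x] o(1) a n KbigD(1)[OF K] by (simp add: k_def)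
    then show ?thesis using False by (simp add: k_def algebra_simps)
  qed
  moreover have "V (zc x t c \<sigma>) \<sigma> + k * (zc x t k \<sigma> - zc x t c \<sigma>) + cost \<sigma> t k = V (zc x t c \<sigma>) \<sigma> + (k * F \<sigma> t c - G \<sigma> t k)"
    by (simp add: cost_def zc_def algebra_simps)
  ultimately show ?thesis by linarith
qed

text \<open>Clipping a parameter beyond \<open>\<plusminus>K\<close> gives a strictly cheaper
  competitor, by the strict form of the Legendre bound.\<close>

lemma ext_bound:
  assumes K: "Kbig T K" and e: "opt c \<sigma> x t" "\<sigma> < t" "t \<le> T"
  shows "\<bar>c\<bar> \<le> K"
proof (rule ccontr)
  assume n: "\<not> ?thesis"
  define k where "k = (if 0 < c then K else - K)"
  have o: "adm c \<sigma> x t" "V x t = V (zc x t c \<sigma>) \<sigma> + cost \<sigma> t c" "0 \<le> \<sigma>"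
    using e(1) by (auto simp: opt_def val_def adm_def)
  have "c \<noteq> k" using n KbigD(1)[OF K] by (auto simp: k_def)
  then have "k * F \<sigma> t c - G \<sigma> t k < cost \<sigma> t c" using cost_ge_strict[of \<sigma> t k c] o(3) e(2) by auto
  then show False using V_le_clipped[OF K o(1) e(2,3) _ k_def] n o(2) by auto
qed

text \<open>If the \<open>h\<close>-curve from \<open>(x,t)\<close> to the last zero of the path leaves the quarter plane, it is replaced by the lowest
  \<open>h\<close>-curve through \<open>(x,t)\<close> that does not. That one touches the \<open>t\<close>-axis, and the path crosses it earlier.\<close>

lemma cand_from_path:
  assumes g: "\<gamma> \<in> Gam x t" and x: "0 < x" "0 < t"
  shows "\<exists>c \<sigma>. cand c \<sigma> x t \<and> val c \<sigma> x t \<le> Jv \<gamma> t"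
proof -
  obtain L where L: "L-lipschitz_on {0..t} \<gamma>" using g by (auto simp: Gam_iff)
  have cg: "continuous_on {0..t} \<gamma>" by (rule lipschitz_on_continuous_on[OF L])
  have gp: "0 \<le> \<gamma> \<theta>" if "0 \<le> \<theta>" "\<theta> \<le> t" for \<theta> using g that by (auto simp: Gam_iff)
  have gt: "\<gamma> t = x" using g by (simp add: Gam_iff)
  define Z where "Z = {\<theta> \<in> {0..t}. \<gamma> \<theta> = 0}"
  have "closed Z" unfolding Z_def by (rule continuous_closed_preimage_constant[OF cg]) auto
  then have cZ: "compact Z" unfolding Z_def by (intro compact_eq_bounded_closed[THEN iffD2]) (auto intro: bounded_subset[of "{0..t}"])
  obtain \<sigma> where \<sigma>: "0 \<le> \<sigma>" "\<sigma> < t" "\<sigma> = 0 \<or> \<gamma> \<sigma> = 0" "\<And>\<theta>. \<sigma> < \<theta> \<Longrightarrow> \<theta> \<le> t \<Longrightarrow> \<gamma> \<theta> \<noteq> 0"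
  proof (cases "Z = {}")
    case True
    then show ?thesis using that[of 0] x by (auto simp: Z_def)
  next
    case False
    obtain \<sigma> where s: "\<sigma> \<in> Z" "\<And>\<theta>. \<theta> \<in> Z \<Longrightarrow> \<theta> \<le> \<sigma>" using compact_attains_sup[OF cZ False] by blast
    have "\<sigma> \<noteq> t" using s(1) gt x by (auto simp: Z_def)
    moreover have "\<gamma> \<theta> \<noteq> 0" if "\<sigma> < \<theta>" "\<theta> \<le> t" for \<theta>
    proof
      assume "\<gamma> \<theta> = 0"
      then have "\<theta> \<in> Z" using s(1) that by (auto simp: Z_def)
      then show False using s(2)[of \<theta>] that by simp
    qed
    ultimately show ?thesis using that[of \<sigma>] s(1) by (auto simp: Z_def)
  qed
  \<comment> \<open>After its last zero the path is positive, so the boundary rate does not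
    interfere and every \<open>k\<close> yields a lower bound.\<close>
  have Clow: "k * (x - \<gamma> s) - G s t k \<le> C \<gamma> s t" if "\<sigma> \<le> s" "s \<le> t" for s k
  proof -
    have "L-lipschitz_on {s..t} \<gamma>" by (rule lipschitz_on_subset[OF L]) (use that \<sigma> in auto)
    then show ?thesis using that \<sigma> gp gt C_lower_G[of L s t \<gamma> k] by force
  qed
  have split: "V (\<gamma> s) s + C \<gamma> s t \<le> Jv \<gamma> t" if "\<sigma> \<le> s" "s \<le> t" for s
    using W_split[OF g, of s] that \<sigma> by auto
  obtain c0 where c0: "F \<sigma> t c0 = x - \<gamma> \<sigma>" using F_surj[of \<sigma> t] \<sigma> by blast
  have z0: "zc x t c0 \<sigma> = \<gamma> \<sigma>" by (simp add: zc_def c0)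
  show ?thesis
  proof (cases "\<forall>\<theta>\<in>{\<sigma>..t}. 0 \<le> zc x t c0 \<theta>")
    case True
    then have "cand c0 \<sigma> x t" using \<sigma> z0 by (auto simp: cand_def adm_def)
    moreover have "val c0 \<sigma> x t \<le> Jv \<gamma> t"
      using Clow[of \<sigma> c0] split[of \<sigma>] \<sigma> cost_zc[of \<sigma> t c0 x] z0 by (simp add: val_def)
    ultimately show ?thesis by blast
  next
    case False
    then obtain \<theta>0 where \<theta>0: "\<theta>0 \<in> {\<sigma>..t}" "zc x t c0 \<theta>0 < 0" by (auto simp: not_le)
    have zcont: "continuous_on UNIV (\<lambda>k. zc x t k \<theta>)" if "\<theta> \<in> {\<sigma>..t}" for \<theta>
      using F_continuous_param[of \<theta> t] that \<sigma> by (auto simp: zc_def intro!: continuous_intros)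
    define A where "A = {k. \<forall>\<theta>\<in>{\<sigma>..t}. 0 \<le> zc x t k \<theta>}"
    have "A = (\<Inter>\<theta>\<in>{\<sigma>..t}. {k. 0 \<le> zc x t k \<theta>})" by (auto simp: A_def)
    moreover have "closed {k. 0 \<le> zc x t k \<theta>}" if "\<theta> \<in> {\<sigma>..t}" for \<theta>
      using closed_Collect_le[OF continuous_on_const zcont[OF that]] by simp
    ultimately have clA: "closed A" by auto
    obtain K where K: "Kbig t K" using Kbig_ex[of t] by (metis order_refl)
    have "F \<theta> t (- K) \<le> 0" if "\<theta> \<in> {\<sigma>..t}" for \<theta>
      using KbigD(4)[OF K] that \<sigma> by (intro F_sign') auto
    then have neA: "- K \<in> A" using x by (force simp: A_def zc_def)
    have ub: "k < c0" if "k \<in> A" for k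
    proof (rule ccontr)
      assume "\<not> ?thesis"
      then have "zc x t k \<theta>0 \<le> zc x t c0 \<theta>0" using \<theta>0 \<sigma> by (intro zc_anti) auto
      then show False using that \<theta>0 by (force simp: A_def)
    qed
    then have bA: "bdd_above A" by (meson bdd_aboveI less_imp_le)
    define k where "k = Sup A"
    have kA: "k \<in> A" unfolding k_def using closed_contains_Sup[OF _ bA clA] neA by blast
    have kc: "k < c0" by (rule ub[OF kA])
    have kz: "0 \<le> zc x t k \<theta>" if "\<theta> \<in> {\<sigma>..t}" for \<theta> using kA that by (auto simp: A_def)
    have "\<exists>\<tau>\<in>{\<sigma>..t}. zc x t k \<tau> = 0"
    proof -
      \<comment> \<open>Slightly larger parameters leave the quarter plane; an accumulation point of
        the times at which they do is a time where the curve with parameter \<open>k\<close> touches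
        the axis.\<close>
      define kn where "kn = (\<lambda>n. k + 1 / real (Suc n))"
      have "kn n \<notin> A" for n using cSup_upper[OF _ bA, of "kn n"] by (auto simp: kn_def k_def)
      then have "\<forall>n. \<exists>\<theta>. \<theta> \<in> {\<sigma>..t} \<and> zc x t (kn n) \<theta> < 0" by (force simp: A_def not_le)
      then obtain th where th: "\<And>n. th n \<in> {\<sigma>..t}" "\<And>n. zc x t (kn n) (th n) < 0" by metis
      obtain \<tau> r where r: "\<tau> \<in> {\<sigma>..t}" "strict_mono (r :: nat \<Rightarrow> nat)" "(th \<circ> r) \<longlonglongrightarrow> \<tau>"
        using compact_imp_seq_compact[of "{\<sigma>..t}"] th(1) unfolding seq_compact_def by (metis compact_Icc)
      have "kn \<longlonglongrightarrow> k + 0" unfolding kn_def using LIMSEQ_inverse_real_of_nat by (intro tendsto_intros) (simp add: inverse_eq_divide)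
      then have "(kn \<circ> r) \<longlonglongrightarrow> k" using LIMSEQ_subseq_LIMSEQ[OF _ r(2)] by auto
      then have "(\<lambda>n. F ((th \<circ> r) n) t ((kn \<circ> r) n)) \<longlonglongrightarrow> F \<tau> t k"
      proof (rule F_tendsto(1))
        have "0 \<le> (th \<circ> r) n \<and> (th \<circ> r) n \<le> t" for n using th(1)[of "r n"] \<sigma>(1) by auto
        then show "\<forall>\<^sub>F n in sequentially. 0 \<le> (th \<circ> r) n \<and> (th \<circ> r) n \<le> t" by simp
      qed (use r \<sigma> in \<open>auto simp: o_def\<close>)
      then have "(\<lambda>n. zc x t (kn (r n)) (th (r n))) \<longlonglongrightarrow> zc x t k \<tau>"
        unfolding zc_def by (intro tendsto_intros) (simp add: o_def)
      then have "zc x t k \<tau> \<le> 0" by (rule LIMSEQ_le_const2) (use th(2) in \<open>auto intro: less_imp_le\<close>)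
      then have "zc x t k \<tau> = 0" using kz[OF r(1)] by simp
      then show ?thesis using r(1) by blast
    qed
    then obtain \<tau> where \<tau>: "\<sigma> \<le> \<tau>" "\<tau> \<le> t" "zc x t k \<tau> = 0" by auto
    have zs: "\<gamma> \<sigma> < zc x t k \<sigma>" using zc_less_iff[of \<sigma> t x c0 k] kc z0 \<sigma> by simp
    have \<tau>': "\<tau> < t" "\<sigma> < \<tau>" using \<tau> x zs gp[of \<sigma>] \<sigma> by (auto simp: order.order_iff_strict)
    have "0 < \<gamma> \<tau>" using gp[of \<tau>] \<sigma>(4)[of \<tau>] \<tau>' \<sigma>(1) by (simp add: order.not_eq_order_implies_strict)
    \<comment> \<open>The path is left of the curve at \<open>\<sigma>\<close> and right of it at
      the touching time. From the crossing onwards the curve replaces the path, and the touching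
      point serves as foot.\<close>
    then obtain s where s: "\<sigma> \<le> s" "s \<le> \<tau>" "\<gamma> s - zc x t k s = 0"
      using IVT'[of "\<lambda>\<theta>. \<gamma> \<theta> - zc x t k \<theta>" \<sigma> 0 \<tau>] zs \<tau> \<tau>' \<sigma>
        continuous_on_diff[OF continuous_on_subset[OF cg, of "{\<sigma>..\<tau>}"] continuous_on_subset[OF zc_continuous[of \<sigma> t x k], of "{\<sigma>..\<tau>}"]]
      by auto
    have a: "adm k s x t" using kz s \<tau>' \<sigma> by (auto simp: adm_def)
    have "cand k \<tau> x t" using adm_sub(1)[OF a s(2)] \<tau> \<tau>' by (simp add: cand_def)
    moreover have "val k \<tau> x t \<le> val k s x t"
      using val_split[of s \<tau> t k x] V_le_val[OF adm_sub(2)[OF a s(2)]] s \<tau>' \<sigma> by simp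
    moreover have "val k s x t \<le> Jv \<gamma> t"
      using Clow[of s k] split[of s] s \<tau>' cost_zc[of s t k x] by (simp add: val_def)
    ultimately show ?thesis using order_trans by blast
  qed
qed

text \<open>For nearly minimal candidates the strict inequality behind \<open>ext_bound\<close> is
  not enough. Comparing the affine bounds at \<open>K\<close> and \<open>K + 1\<close>, or at their
  negatives, makes the excess over \<open>V\<close> grow with the displacement.\<close>

lemma cand_bound:
  assumes x: "0 \<le> x" "0 < t"
  obtains \<epsilon> M where "0 < \<epsilon>" "\<And>c \<sigma>. cand c \<sigma> x t \<Longrightarrow> \<sigma> = 0 \<or> 0 < x \<Longrightarrow> val c \<sigma> x t \<le> V x t + \<epsilon> \<Longrightarrow> \<bar>c\<bar> \<le> M"
proof -
  obtain K where K: "Kbig t K" using Kbig_ex[of t] by (metis order_refl)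
  have K0: "0 \<le> K" using KbigD(1)[OF K] .
  obtain S where S: "0 \<le> S" "\<And>c \<theta>. \<bar>c\<bar> \<le> K + 1 \<Longrightarrow> \<theta> \<in> {0..t} \<Longrightarrow> \<bar>spd c \<theta>\<bar> \<le> S \<and> \<bar>flx c \<theta>\<bar> \<le> S"
    using spd_bound[of "K + 1" t] by metis
  have Gb: "\<bar>G s t k\<bar> \<le> S * (t - s)" if "0 \<le> s" "s \<le> t" "\<bar>k\<bar> \<le> K + 1" for s k
    using F_G_bound(2)[of t k S s t] S(2) that by auto
  \<comment> \<open>At speeds beyond \<open>m\<close> the gain \<open>Q\<close> is at least
    \<open>4 * S * (t - \<sigma>)\<close>, so the two \<open>G\<close>-terms consume at most half of
    it.\<close>
  define m where "m = 4 * S + 1"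
  obtain v1 where v1: "df v1 = m" using df_surj by blast
  obtain v2 where v2: "df v2 = - m" using df_surj by blast
  obtain cU where cU: "\<And>c \<theta>. cU \<le> c \<Longrightarrow> \<theta> \<in> {0..t} \<Longrightarrow> v1 \<le> c * E \<theta>" using spd_ge_ex[of t v1] by blast
  obtain cL where cL: "\<And>c \<theta>. c \<le> cL \<Longrightarrow> \<theta> \<in> {0..t} \<Longrightarrow> c * E \<theta> \<le> v2" using spd_le_ex[of t v2] by blast
  \<comment> \<open>A quarter of a lower bound for \<open>Q\<close>, which is at least
    \<open>t\<close> if the foot has time 0 and equals \<open>x\<close> if the foot lies on the
    t-axis at a later time.\<close>
  define \<epsilon> where "\<epsilon> = (if 0 < x then min x t else t) / 4"
  define M where "M = max \<bar>cU\<bar> \<bar>cL\<bar> + K + 1"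
  have eps: "0 < \<epsilon>" using x by (auto simp: \<epsilon>_def)
  have "\<bar>c\<bar> \<le> M" if c: "cand c \<sigma> x t" "\<sigma> = 0 \<or> 0 < x" "val c \<sigma> x t \<le> V x t + \<epsilon>" for c \<sigma>
  proof (rule ccontr)
    assume n: "\<not> ?thesis"
    have a: "adm c \<sigma> x t" "\<sigma> < t" "0 \<le> \<sigma>" "\<sigma> = 0 \<or> zc x t c \<sigma> = 0" using c(1) by (auto simp: cand_def adm_def)
    define k where "k = (if 0 < c then K else - K)"
    define k' where "k' = (if 0 < c then K + 1 else - K - 1)"
    have nK: "K < \<bar>c\<bar>" using n by (auto simp: M_def)
    have 1: "V x t \<le> V (zc x t c \<sigma>) \<sigma> + (k * F \<sigma> t c - G \<sigma> t k)"
      by (rule V_le_clipped[OF K a(1,2) order_refl nK k_def])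
    have 2: "k' * F \<sigma> t c - G \<sigma> t k' \<le> cost \<sigma> t c" using a by (intro cost_ge) auto
    have 3: "\<bar>G \<sigma> t k\<bar> \<le> S * (t - \<sigma>)" "\<bar>G \<sigma> t k'\<bar> \<le> S * (t - \<sigma>)"
      using Gb[of \<sigma> k] Gb[of \<sigma> k'] a K0 by (auto simp: k_def k'_def)
    have "(k' - k) * F \<sigma> t c - 2 * (S * (t - \<sigma>)) \<le> val c \<sigma> x t - V x t"
      using 1 2 3 by (simp add: val_def algebra_simps)
    then have 4: "(k' - k) * F \<sigma> t c - 2 * (S * (t - \<sigma>)) \<le> \<epsilon>" using c(3) by linarith
    have mt: "m * (t - \<sigma>) \<le> (k' - k) * F \<sigma> t c"
    proof (cases "0 < c")
      case True
      have "cU \<le> c" using n True K0 by (auto simp: M_def)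
      then have "integral {\<sigma>..t} (\<lambda>_. m) \<le> F \<sigma> t c"
        unfolding F_def using cU a v1[symmetric] by (intro integral_le spd_flx_integrable) (auto simp: spd_def df_le_iff)
      then show ?thesis using True a by (simp add: k_def k'_def mult.commute)
    next
      case False
      have "c \<le> cL" using n False K0 by (auto simp: M_def)
      then have "F \<sigma> t c \<le> integral {\<sigma>..t} (\<lambda>_. - m)"
        unfolding F_def using cL a v2[symmetric] by (intro integral_le spd_flx_integrable) (auto simp: spd_def df_le_iff)
      then show ?thesis using False a by (simp add: k_def k'_def mult.commute)
    qed
    have kk: "k' - k = 1 \<or> k' - k = - 1" by (auto simp: k_def k'_def)
    define Q where "Q = (k' - k) * F \<sigma> t c"
    have m4: "4 * (S * (t - \<sigma>)) + (t - \<sigma>) \<le> Q" using mt by (simp add: Q_def m_def algebra_simps)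
    have "0 \<le> S * (t - \<sigma>)" using S a by simp
    have Qe: "4 * \<epsilon> \<le> Q"
    proof (cases "\<sigma> = 0")
      case True
      have "4 * \<epsilon> \<le> t" by (auto simp: \<epsilon>_def)
      then show ?thesis using m4 True S \<open>0 \<le> S * (t - \<sigma>)\<close> by simp
    next
      case False
      then have "F \<sigma> t c = x" "0 < x" using a c(2) by (auto simp: zc_def)
      moreover from this have "Q = x" using m4 kk \<open>0 \<le> S * (t - \<sigma>)\<close> a by (auto simp: Q_def)
      ultimately show ?thesis by (auto simp: \<epsilon>_def)
    qed
    have "Q - 2 * (S * (t - \<sigma>)) \<le> \<epsilon>" using 4 by (simp add: Q_def)
    then show False using Qe m4 eps a(2) by linarith
  qed
  then show ?thesis using that[OF eps] by blast
qed

lemma cand_limit: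
  assumes lim: "xn \<longlonglongrightarrow> x" "tn \<longlonglongrightarrow> t" "cn \<longlonglongrightarrow> c" "\<sigma>n \<longlonglongrightarrow> \<sigma>"
    and c: "\<And>n::nat. cand (cn n) (\<sigma>n n) (xn n) (tn n)" and \<sigma>t: "\<sigma> < t"
  shows "cand c \<sigma> x t" "(\<lambda>n. val (cn n) (\<sigma>n n) (xn n) (tn n)) \<longlonglongrightarrow> val c \<sigma> x t"
    "(\<lambda>n. zc (xn n) (tn n) (cn n) (\<sigma>n n)) \<longlonglongrightarrow> zc x t c \<sigma>"
proof -
  have cn: "0 \<le> \<sigma>n n" "\<sigma>n n < tn n" "\<And>\<theta>. \<theta> \<in> {\<sigma>n n..tn n} \<Longrightarrow> 0 \<le> zc (xn n) (tn n) (cn n) \<theta>"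
    "\<sigma>n n = 0 \<or> zc (xn n) (tn n) (cn n) (\<sigma>n n) = 0" for n
    using c[of n] by (auto simp: cand_def adm_def)
  have \<sigma>0: "0 \<le> \<sigma>" by (rule LIMSEQ_le_const[OF lim(4)]) (use cn in auto)
  have z: "(\<lambda>n. zc (xn n) (tn n) (cn n) (th n)) \<longlonglongrightarrow> zc x t c \<theta>"
    if "th \<longlonglongrightarrow> \<theta>" "\<And>n. th n \<in> {\<sigma>n n..tn n}" "\<theta> \<in> {\<sigma>..t}" for th \<theta>
    unfolding zc_def using that \<sigma>0
    by (intro tendsto_intros lim F_tendsto(1)) (auto intro!: always_eventually intro: order_trans[OF cn(1)])
  show z\<sigma>: "(\<lambda>n. zc (xn n) (tn n) (cn n) (\<sigma>n n)) \<longlonglongrightarrow> zc x t c \<sigma>"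
    using cn \<sigma>t by (intro z lim) (auto intro: less_imp_le)
  have pos: "0 \<le> zc x t c \<theta>" if th: "\<theta> \<in> {\<sigma>..t}" for \<theta>
  proof -
    \<comment> \<open>The relative position of \<open>\<theta>\<close> is kept, which exhibits it as
      a limit of times inside the moving intervals.\<close>
    define l where "l = (\<theta> - \<sigma>) / (t - \<sigma>)"
    have l: "0 \<le> l" "l \<le> 1" "\<theta> = \<sigma> + l * (t - \<sigma>)" using th \<sigma>t by (auto simp: l_def)
    have "\<sigma>n n + l * (tn n - \<sigma>n n) \<in> {\<sigma>n n..tn n}" for n
    proof -
      have "l * (tn n - \<sigma>n n) \<le> 1 * (tn n - \<sigma>n n)" "0 \<le> l * (tn n - \<sigma>n n)"
        using l cn(2)[of n] by (intro mult_right_mono mult_nonneg_nonneg; simp)+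
      then show ?thesis by simp
    qed
    moreover have "(\<lambda>n. \<sigma>n n + l * (tn n - \<sigma>n n)) \<longlonglongrightarrow> \<theta>"
      unfolding l(3) by (intro tendsto_intros lim)
    ultimately have "(\<lambda>n. zc (xn n) (tn n) (cn n) (\<sigma>n n + l * (tn n - \<sigma>n n))) \<longlonglongrightarrow> zc x t c \<theta>"
      using th by (intro z) auto
    then show ?thesis
      by (rule LIMSEQ_le_const) (use cn(3) \<open>\<And>n. \<sigma>n n + l * (tn n - \<sigma>n n) \<in> {\<sigma>n n..tn n}\<close> in auto)
  qed
  \<comment> \<open>The product turns the alternative that defines a foot into an equation, which
    passes to the limit.\<close>
  have "(\<lambda>n. \<sigma>n n * zc (xn n) (tn n) (cn n) (\<sigma>n n)) \<longlonglongrightarrow> \<sigma> * zc x t c \<sigma>"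
    by (intro tendsto_intros lim z\<sigma>)
  moreover have "\<sigma>n n * zc (xn n) (tn n) (cn n) (\<sigma>n n) = 0" for n using cn(4)[of n] by auto
  ultimately have "\<sigma> * zc x t c \<sigma> = 0" by (simp add: LIMSEQ_const_iff)
  then show "cand c \<sigma> x t" using pos \<sigma>0 \<sigma>t by (auto simp: cand_def adm_def)
  show "(\<lambda>n. val (cn n) (\<sigma>n n) (xn n) (tn n)) \<longlonglongrightarrow> val c \<sigma> x t"
    unfolding val_def
  proof (intro tendsto_add W_tendsto z\<sigma> lim F_tendsto(3))
    show "0 \<le> zc (xn n) (tn n) (cn n) (\<sigma>n n)" for n using cn(2)[of n] cn(3)[of "\<sigma>n n" n] by auto
  qed (use cn \<sigma>0 \<sigma>t in \<open>auto intro: less_imp_le always_eventually\<close>)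
qed

lemma bounded_pair_subsequence:
  fixes cn \<sigma>n :: "nat \<Rightarrow> real"
  assumes "\<And>n. \<bar>cn n\<bar> \<le> M" "\<And>n. \<sigma>n n \<in> {a..b}"
  obtains r c \<sigma> where "strict_mono (r :: nat \<Rightarrow> nat)" "(\<lambda>n. cn (r n)) \<longlonglongrightarrow> c" "(\<lambda>n. \<sigma>n (r n)) \<longlonglongrightarrow> \<sigma>" "\<sigma> \<in> {a..b}"
proof -
  have "seq_compact ({-M..M} \<times> {a..b})"
    by (intro compact_imp_seq_compact compact_Times compact_Icc)
  moreover have "\<forall>n. (cn n, \<sigma>n n) \<in> {-M..M} \<times> {a..b}" using assms by (auto simp: abs_le_iff minus_le_iff)
  ultimately obtain l r where l: "l \<in> {-M..M} \<times> {a..b}" "strict_mono r" "((\<lambda>n. (cn n, \<sigma>n n)) \<circ> r) \<longlonglongrightarrow> l"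
    by (rule seq_compactE)
  have "(\<lambda>n. fst (((\<lambda>n. (cn n, \<sigma>n n)) \<circ> r) n)) \<longlonglongrightarrow> fst l" "(\<lambda>n. snd (((\<lambda>n. (cn n, \<sigma>n n)) \<circ> r) n)) \<longlonglongrightarrow> snd l"
    by (intro tendsto_fst tendsto_snd l(3))+
  then show ?thesis using that[OF l(2), of "fst l" "snd l"] l(1) by (auto simp: o_def)
qed

text \<open>\<open>P\<close> prescribes the kind of foot: unrestricted, at time 0, or at position 0,
  for \<open>V\<close>, \<open>A\<close> and \<open>B\<close> respectively. Its second property
  keeps the feet of a minimizing sequence away from time \<open>t\<close>, where candidates
  degenerate.\<close>

lemma cand_minimizer:
  assumes x: "0 \<le> x" "0 < t"
    and seq: "\<And>e. 0 < e \<Longrightarrow> \<exists>c \<sigma>. cand c \<sigma> x t \<and> P \<sigma> (zc x t c \<sigma>) \<and> val c \<sigma> x t < V x t + e"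
    and P: "closed {(\<sigma>, z). P \<sigma> z}" "\<And>\<sigma> z. P \<sigma> z \<Longrightarrow> \<sigma> = 0 \<or> 0 < x"
  shows "\<exists>c \<sigma>. ext c \<sigma> x t \<and> P \<sigma> (zc x t c \<sigma>)"
proof -
  obtain \<epsilon> M where \<epsilon>: "0 < \<epsilon>" and M: "\<And>c \<sigma>. cand c \<sigma> x t \<Longrightarrow> \<sigma> = 0 \<or> 0 < x \<Longrightarrow> val c \<sigma> x t \<le> V x t + \<epsilon> \<Longrightarrow> \<bar>c\<bar> \<le> M"
    using cand_bound[OF x] by metis
  define e where "e = (\<lambda>n. min \<epsilon> (1 / real (Suc n)))"
  have e0: "0 < e n" for n using \<epsilon> by (simp add: e_def)
  obtain cn \<sigma>n where n: "\<And>n. cand (cn n) (\<sigma>n n) x t" "\<And>n. P (\<sigma>n n) (zc x t (cn n) (\<sigma>n n))" "\<And>n. val (cn n) (\<sigma>n n) x t < V x t + e n"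
    using seq[OF e0] by metis
  have cM: "\<bar>cn n\<bar> \<le> M" for n
    by (rule M[OF n(1) P(2)[OF n(2)]]) (use n(3)[of n] in \<open>auto simp: e_def\<close>)
  have ad: "0 \<le> \<sigma>n n" "\<sigma>n n < t" "\<sigma>n n = 0 \<or> zc x t (cn n) (\<sigma>n n) = 0" for n using n(1)[of n] by (auto simp: cand_def adm_def)
  obtain S where S: "0 \<le> S" "\<And>c \<theta>. \<bar>c\<bar> \<le> M \<Longrightarrow> \<theta> \<in> {0..t} \<Longrightarrow> \<bar>spd c \<theta>\<bar> \<le> S \<and> \<bar>flx c \<theta>\<bar> \<le> S"
    using spd_bound[of M t] by metis
  \<comment> \<open>At speed at most \<open>S\<close>, a curve from the t-axis needs time at least
    \<open>x / (S + 1)\<close> to reach \<open>x\<close>.\<close>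
  define \<delta> where "\<delta> = (if 0 < x then min t (x / (S + 1)) else t)"
  have \<delta>: "0 < \<delta>" using x S(1) by (auto simp: \<delta>_def)
  have gap: "\<sigma>n n \<le> t - \<delta>" for n
  proof (cases "\<sigma>n n = 0")
    case False
    then have "0 < x" using P(2)[OF n(2)] by blast
    have "x = F (\<sigma>n n) t (cn n)" using ad(3)[of n] False by (simp add: zc_def)
    also have "\<dots> \<le> S * (t - \<sigma>n n)" using F_G_bound(1)[of t "cn n" S "\<sigma>n n" t] S(2)[OF cM] ad(1,2)[of n] by auto
    also have "\<dots> \<le> (S + 1) * (t - \<sigma>n n)" using ad(2)[of n] by (intro mult_right_mono) auto
    finally have "x / (S + 1) \<le> t - \<sigma>n n" using S(1) by (simp add: field_simps)
    then show ?thesis using \<open>0 < x\<close> by (auto simp: \<delta>_def)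
  qed (auto simp: \<delta>_def)
  obtain r c \<sigma> where r: "strict_mono (r :: nat \<Rightarrow> nat)" "(\<lambda>n. cn (r n)) \<longlonglongrightarrow> c" "(\<lambda>n. \<sigma>n (r n)) \<longlonglongrightarrow> \<sigma>" "\<sigma> \<in> {0..t - \<delta>}"
    using bounded_pair_subsequence[of cn M \<sigma>n 0 "t - \<delta>"] cM ad(1) gap by (metis atLeastAtMost_iff)
  have st: "\<sigma> < t" using r(4) \<delta> by auto
  note l = cand_limit[OF tendsto_const tendsto_const r(2,3) n(1) st]
  have "val c \<sigma> x t \<le> V x t"
  proof (rule LIMSEQ_le[OF l(2)])
    have "(\<lambda>n. 1 / real (Suc n)) \<longlonglongrightarrow> 0" using LIMSEQ_inverse_real_of_nat by (simp add: inverse_eq_divide)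
    then have "(\<lambda>n. V x t + 1 / real (Suc (r n))) \<longlonglongrightarrow> V x t + 0"
      using LIMSEQ_subseq_LIMSEQ[OF _ r(1), of "\<lambda>n. 1 / real (Suc n)" 0] by (intro tendsto_intros) (simp add: o_def)
    then show "(\<lambda>n. V x t + 1 / real (Suc (r n))) \<longlonglongrightarrow> V x t" by simp
    have "val (cn (r k)) (\<sigma>n (r k)) x t \<le> V x t + 1 / real (Suc (r k))" for k
      using n(3)[of "r k"] min.cobounded2[of \<epsilon> "1 / real (Suc (r k))"] unfolding e_def by linarith
    then show "\<exists>N. \<forall>n\<ge>N. val (cn (r n)) (\<sigma>n (r n)) x t \<le> V x t + 1 / real (Suc (r n))" by blast
  qed
  then have "ext c \<sigma> x t"
    using V_le_val[of c \<sigma> x t] l(1) by (auto simp: ext_def cand_def)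
  moreover have "(\<sigma>, zc x t c \<sigma>) \<in> {(\<sigma>, z). P \<sigma> z}"
    by (rule closed_sequentially[OF P(1) _ tendsto_Pair[OF r(3) l(3)]]) (use n(2) in auto)
  ultimately show ?thesis by auto
qed

lemma ext_exists:
  assumes "0 < x" "0 < t"
  shows "\<exists>c \<sigma>. ext c \<sigma> x t"
proof -
  have "\<exists>c \<sigma>. ext c \<sigma> x t \<and> (\<lambda>_ _. True) \<sigma> (zc x t c \<sigma>)"
  proof (rule cand_minimizer)
    fix e :: real assume "0 < e"
    have "\<exists>\<gamma>\<in>Gam x t. Jv \<gamma> t < V x t + e"
    proof (rule ccontr)
      assume "\<not> ?thesis"
      then have "V x t + e \<le> V x t" using assms by (intro W_ge) (auto simp: not_less)
      then show False using \<open>0 < e\<close> by simp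
    qed
    then show "\<exists>c \<sigma>. cand c \<sigma> x t \<and> True \<and> val c \<sigma> x t < V x t + e"
      using cand_from_path[OF _ assms] by (metis order_le_less_trans)
  qed (use assms in auto)
  then show ?thesis by blast
qed

text \<open>The uniform gap keeps the feet from running into the endpoints. With the common bound on
  the parameters, a subsequence of parameters and feet converges, and Lipschitz continuity of
  \<open>V\<close> preserves optimality.\<close>

lemma ext_compact:
  assumes lim: "xn \<longlonglongrightarrow> x" "tn \<longlonglongrightarrow> t" and e: "\<And>n::nat. ext (cn n) (\<sigma>n n) (xn n) (tn n)"
    and gap: "0 < \<delta>" "\<And>n. \<sigma>n n \<le> tn n - \<delta>"
  obtains r c \<sigma> where "strict_mono (r :: nat \<Rightarrow> nat)" "(\<lambda>n. cn (r n)) \<longlonglongrightarrow> c" "(\<lambda>n. \<sigma>n (r n)) \<longlonglongrightarrow> \<sigma>" "ext c \<sigma> x t"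
    "(\<lambda>n. zc (xn (r n)) (tn (r n)) (cn (r n)) (\<sigma>n (r n))) \<longlonglongrightarrow> zc x t c \<sigma>"
proof -
  obtain T where T: "\<And>n. tn n \<le> T"
    using convergent_imp_Bseq[of tn] lim(2) by (metis BseqE abs_le_D1 convergentI real_norm_def)
  obtain K where K: "Kbig T K" using Kbig_ex[of T] by (metis order_refl)
  have cK: "\<bar>cn n\<bar> \<le> K" for n using ext_bound[OF K ext_opt[OF e]] extD(2)[OF e] T by auto
  obtain r c \<sigma> where r: "strict_mono (r :: nat \<Rightarrow> nat)" "(\<lambda>n. cn (r n)) \<longlonglongrightarrow> c" "(\<lambda>n. \<sigma>n (r n)) \<longlonglongrightarrow> \<sigma>"
    using bounded_pair_subsequence[of cn K \<sigma>n 0 T] cK extD(1,2)[OF e] T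
    by (metis atLeastAtMost_iff less_imp_le order_trans)
  have lx: "(\<lambda>n. xn (r n)) \<longlonglongrightarrow> x" "(\<lambda>n. tn (r n)) \<longlonglongrightarrow> t"
    using LIMSEQ_subseq_LIMSEQ[OF lim(1) r(1)] LIMSEQ_subseq_LIMSEQ[OF lim(2) r(1)] by (auto simp: o_def)
  have "\<sigma> \<le> t - \<delta>"
    by (rule LIMSEQ_le[OF r(3) tendsto_diff[OF lx(2) tendsto_const]]) (use gap(2) in auto)
  then have st: "\<sigma> < t" using gap(1) by simp
  have c: "cand (cn (r n)) (\<sigma>n (r n)) (xn (r n)) (tn (r n))" for n using e by (simp add: ext_def)
  note l = cand_limit[OF lx r(2,3) c st]
  have "(\<lambda>n. V (xn (r n)) (tn (r n))) \<longlonglongrightarrow> V x t"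
  proof (intro W_tendsto lx)
    fix n show "0 \<le> xn (r n)" "0 \<le> tn (r n)" using extD(1,2,5)[OF e[of "r n"]] by auto
  qed
  moreover have "V (xn (r n)) (tn (r n)) = val (cn (r n)) (\<sigma>n (r n)) (xn (r n)) (tn (r n))" for n
    using e by (simp add: ext_def)
  ultimately have "V x t = val c \<sigma> x t" using l(2) LIMSEQ_unique by auto
  then have "ext c \<sigma> x t" using l(1) by (simp add: ext_def)
  then show ?thesis using that r l(3) by blast
qed

lemma ext_gap:
  assumes "0 < x0" "0 < t0"
  obtains \<delta> where "0 < \<delta>" "\<And>c \<sigma> x t. ext c \<sigma> x t \<Longrightarrow> x0 \<le> x \<Longrightarrow> t0 \<le> t \<Longrightarrow> t \<le> T \<Longrightarrow> \<sigma> \<le> t - \<delta>"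
proof -
  obtain K where K: "Kbig T K" using Kbig_ex[of T] by (metis order_refl)
  obtain S where S: "0 \<le> S" "\<And>c \<theta>. \<bar>c\<bar> \<le> K \<Longrightarrow> \<theta> \<in> {0..T} \<Longrightarrow> \<bar>spd c \<theta>\<bar> \<le> S \<and> \<bar>flx c \<theta>\<bar> \<le> S"
    using spd_bound[of K T] by metis
  show ?thesis
  proof (rule that[of "min t0 (x0 / (S + 1))"])
    fix c \<sigma> x t assume a: "ext c \<sigma> x t" "x0 \<le> x" "t0 \<le> t" "t \<le> T"
    show "\<sigma> \<le> t - min t0 (x0 / (S + 1))"
    proof (cases "\<sigma> = 0")
      case False
      then have "x = F \<sigma> t c" using extD(4)[OF a(1)] by (simp add: zc_def)
      also have "\<dots> \<le> S * (t - \<sigma>)"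
        using F_G_bound(1)[of T c S \<sigma> t] S(2)[OF ext_bound[OF K ext_opt[OF a(1)] extD(2)[OF a(1)] a(4)]] extD(1,2)[OF a(1)] a(4) by auto
      also have "\<dots> \<le> (S + 1) * (t - \<sigma>)" using extD(2)[OF a(1)] by (intro mult_right_mono) auto
      finally have "x0 / (S + 1) \<le> t - \<sigma>" using S(1) a(2) by (simp add: field_simps)
      then show ?thesis by auto
    qed (use a in auto)
  qed (use assms S in auto)
qed

lemma ext_speed_bound:
  obtains S where "0 \<le> S" "\<And>c \<sigma> x t a b. ext c \<sigma> x t \<Longrightarrow> t \<le> T \<Longrightarrow> 0 \<le> a \<Longrightarrow> a \<le> b \<Longrightarrow> b \<le> T \<Longrightarrow> \<bar>F a b c\<bar> \<le> S * (b - a)"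
proof -
  obtain K where K: "Kbig T K" using Kbig_ex[of T] by (metis order_refl)
  obtain S where S: "0 \<le> S" "\<And>c \<theta>. \<bar>c\<bar> \<le> K \<Longrightarrow> \<theta> \<in> {0..T} \<Longrightarrow> \<bar>spd c \<theta>\<bar> \<le> S \<and> \<bar>flx c \<theta>\<bar> \<le> S"
    using spd_bound[of K T] by metis
  show ?thesis
  proof (rule that[OF S(1)])
    fix c \<sigma> x t a b assume a: "ext c \<sigma> x t" "t \<le> T" "0 \<le> a" "a \<le> b" "b \<le> T"
    show "\<bar>F a b c\<bar> \<le> S * (b - a)"
      using F_G_bound(1)[of T c S a b] S(2)[OF ext_bound[OF K ext_opt[OF a(1)] extD(2)[OF a(1)] a(2)]] a by auto
  qed
qed

end

lemma is_arg_min_iff_attained: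
  fixes g :: "'a \<Rightarrow> 'b :: linorder"
  assumes "\<exists>y. P y \<and> g y = v" "\<And>y. P y \<Longrightarrow> v \<le> g y"
  shows "is_arg_min g P y \<longleftrightarrow> P y \<and> g y = v"
proof
  assume "is_arg_min g P y"
  then show "P y \<and> g y = v" using assms(1) assms(2)[of y] by (auto simp: is_arg_min_def not_less)
qed (use assms(2) in \<open>auto simp: is_arg_min_def not_less\<close>)

context halfline
begin

subsection \<open>Initial and boundary functionals\<close>

abbreviation "mA x t \<equiv> minA f \<alpha> u0 x t"
abbreviation "mB x t \<equiv> minB f \<alpha> u0 ub x t"

lemma zc_jp_foot: "0 \<le> s \<Longrightarrow> s < t \<Longrightarrow> zc x t (jp s t (x - y)) s = y"
  by (simp add: zc_def)

lemma jp_zc: "0 \<le> s \<Longrightarrow> s < t \<Longrightarrow> jp s t (x - zc x t c s) = c"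
  by (rule jp_eq) (auto simp: zc_def)

lemma cost_integral:
  "0 \<le> s \<Longrightarrow> integral {s..t} (\<lambda>\<theta>. exp (- beta \<alpha> \<theta>) * fstar f (df (c * E \<theta>))) = cost s t c"
proof -
  assume s: "0 \<le> s"
  have "exp (- beta \<alpha> \<theta>) * fstar f (df (c * E \<theta>)) = c * spd c \<theta> - flx c \<theta>" for \<theta>
  proof -
    have "exp (- beta \<alpha> \<theta>) * fstar f (df (c * E \<theta>)) = c * spd c \<theta> * (E \<theta> * exp (- beta \<alpha> \<theta>)) - flx c \<theta>"
      by (simp add: spd_def fstar_eq flx_def algebra_simps)
    then show ?thesis by (simp add: exp_minus)
  qed
  then have "integral {s..t} (\<lambda>\<theta>. exp (- beta \<alpha> \<theta>) * fstar f (df (c * E \<theta>))) = integral {s..t} (\<lambda>\<theta>. c * spd c \<theta> - flx c \<theta>)"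
    by simp
  also have "\<dots> = cost s t c"
    unfolding cost_def F_def G_def using spd_flx_integrable[OF s, of c t]
    by (subst integral_diff) (auto intro: integrable_on_mult_right)
  finally show ?thesis .
qed

lemma curveA_eq:
  assumes "0 < t" "0 \<le> \<theta>" "\<theta> \<le> t"
  shows "curveA f \<alpha> x t y \<theta> = zc x t (jp 0 t (x - y)) \<theta>"
proof -
  have "curveA f \<alpha> x t y \<theta> = y + F 0 \<theta> (jp 0 t (x - y))"
    unfolding curveA_def F_def spd_def hA_eq[OF assms(1)] ..
  also have "\<dots> = zc x t (jp 0 t (x - y)) \<theta>"
    using zc_forward[of 0 \<theta> t x "jp 0 t (x - y)"] assms by (simp add: zc_jp_foot)
  finally show ?thesis .
qed

lemma curveB_eq:
  assumes "0 \<le> \<tau>" "\<tau> < t" "\<tau> \<le> \<theta>" "\<theta> \<le> t"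
  shows "curveB f \<alpha> x t \<tau> \<theta> = zc x t (jp \<tau> t x) \<theta>"
proof -
  have "curveB f \<alpha> x t \<tau> \<theta> = F \<tau> \<theta> (jp \<tau> t x)"
    unfolding curveB_def F_def spd_def hB_eq[OF assms(1,2)] ..
  also have "\<dots> = zc x t (jp \<tau> t x) \<theta>"
    using zc_forward[of \<tau> \<theta> t x "jp \<tau> t x"] zc_jp_foot[of \<tau> t x 0] assms by simp
  finally show ?thesis .
qed

lemma HA_iff: "0 < t \<Longrightarrow> y \<in> HA f \<alpha> x t \<longleftrightarrow> adm (jp 0 t (x - y)) 0 x t"
  using curveA_eq[of t _ x y] by (auto simp: HA_def adm_def curveA_def)

lemma HB_iff: "\<tau> < t \<Longrightarrow> \<tau> \<in> HB f \<alpha> x t \<longleftrightarrow> 0 \<le> \<tau> \<and> adm (jp \<tau> t x) \<tau> x t"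
  using curveB_eq[of \<tau> t _ x] by (auto simp: HB_def adm_def curveB_def)

lemma HB_end: "0 \<le> t \<Longrightarrow> t \<in> HB f \<alpha> x t \<longleftrightarrow> x = 0"
  by (auto simp: HB_def)

lemma funA_eq: "0 < t \<Longrightarrow> 0 \<le> y \<Longrightarrow> funA f \<alpha> u0 y x t = val (jp 0 t (x - y)) 0 x t"
  by (simp add: funA_def val_def hA_eq cost_integral zc_jp_foot W_time0 U0_def)

lemma funB_eq: "0 \<le> \<tau> \<Longrightarrow> \<tau> < t \<Longrightarrow> funB f \<alpha> u0 ub \<tau> x t = val (jp \<tau> t x) \<tau> x t"
  using zc_jp_foot[of \<tau> t x 0] by (simp add: funB_def val_def hB_eq cost_integral)

lemma funB_end: "funB f \<alpha> u0 ub t x t = V 0 t"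
  by (simp add: funB_def)

lemma adm_foot_nonneg: "adm c s x t \<Longrightarrow> 0 \<le> zc x t c s" "adm c s x t \<Longrightarrow> 0 \<le> s"
  by (auto simp: adm_def)

lemma HA_nonneg: "0 < t \<Longrightarrow> y \<in> HA f \<alpha> x t \<Longrightarrow> 0 \<le> y"
  using adm_foot_nonneg(1)[of "jp 0 t (x - y)" 0 x t] by (simp add: HA_iff zc_jp_foot)

lemma funA_ge: "0 < t \<Longrightarrow> y \<in> HA f \<alpha> x t \<Longrightarrow> V x t \<le> funA f \<alpha> u0 y x t"
  using V_le_val[of "jp 0 t (x - y)" 0 x t] HA_nonneg[of t y x] by (simp add: HA_iff funA_eq)

lemma funB_ge: "0 < t \<Longrightarrow> \<tau> \<in> HB f \<alpha> x t \<Longrightarrow> V x t \<le> funB f \<alpha> u0 ub \<tau> x t"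
proof (cases "\<tau> < t")
  case True
  then show "\<tau> \<in> HB f \<alpha> x t \<Longrightarrow> ?thesis" using V_le_val[of "jp \<tau> t x" \<tau> x t] by (auto simp: HB_iff funB_eq)
next
  case False
  assume "0 < t" "\<tau> \<in> HB f \<alpha> x t"
  moreover from this have "\<tau> = t" using False by (auto simp: HB_def)
  ultimately show ?thesis by (simp add: HB_end funB_end)
qed

lemma HA_nonempty:
  assumes "0 \<le> x" "0 < t" shows "HA f \<alpha> x t \<noteq> {}"
proof -
  obtain K where K: "Kbig t K" using Kbig_ex[of t] by (metis order_refl)
  have "F \<theta> t (- K) \<le> 0" if "\<theta> \<in> {0..t}" for \<theta> using KbigD(4)[OF K] that by (intro F_sign') auto
  then have "adm (- K) 0 x t" using assms by (force simp: adm_def zc_def)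
  then have "zc x t (- K) 0 \<in> HA f \<alpha> x t" using assms by (simp add: HA_iff jp_zc)
  then show ?thesis by blast
qed

lemma HB_nonempty:
  assumes "0 \<le> x" "0 < t" shows "HB f \<alpha> x t \<noteq> {}"
proof (cases "x = 0")
  case True
  then show ?thesis using HB_end[of t x] assms by auto
next
  case False
  obtain K where K: "Kbig t K" using Kbig_ex[of t] by (metis order_refl)
  \<comment> \<open>At least \<open>K\<close>, so that the speed is nonnegative, and at least the
    parameter of the curve from the origin, so that the curve meets the axis at a nonnegative
    time.\<close>
  define c where "c = max K (jp 0 t x)"
  have sp: "0 \<le> spd c \<theta>" if "\<theta> \<in> {0..t}" for \<theta>
  proof -
    have "K * E \<theta> \<le> c * E \<theta>" by (simp add: c_def)
    then have "spd K \<theta> \<le> spd c \<theta>" by (simp add: spd_def df_le_iff)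
    then show ?thesis using KbigD(3)[OF K that] by simp
  qed
  have "F 0 t (jp 0 t x) \<le> F 0 t c" using assms by (intro F_mono) (auto simp: c_def)
  then have "zc x t c 0 \<le> 0" using assms by (simp add: zc_def)
  then obtain \<tau> where \<tau>: "0 \<le> \<tau>" "\<tau> \<le> t" "zc x t c \<tau> = 0"
    using IVT'[of "zc x t c" 0 0 t] assms zc_continuous[of 0 t x c] by auto
  have "\<tau> \<noteq> t" using \<tau>(3) False by auto
  then have \<tau>t: "\<tau> < t" using \<tau> by simp
  have "0 \<le> zc x t c \<theta>" if "\<theta> \<in> {\<tau>..t}" for \<theta>
    using zc_forward[of \<tau> \<theta> t x c] F_sign[of \<tau> \<theta> c] sp \<tau> that by auto
  then have "adm c \<tau> x t" using \<tau> by (simp add: adm_def)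
  moreover have "jp \<tau> t x = c" using jp_zc[of \<tau> t x c] \<tau> \<tau>t by simp
  ultimately have "\<tau> \<in> HB f \<alpha> x t" using \<tau> \<tau>t by (simp add: HB_iff)
  then show ?thesis by blast
qed

lemma minA_ge: "0 \<le> x \<Longrightarrow> 0 < t \<Longrightarrow> V x t \<le> mA x t"
  unfolding minA_def using HA_nonempty funA_ge by (intro cINF_greatest) auto

lemma minB_ge: "0 \<le> x \<Longrightarrow> 0 < t \<Longrightarrow> V x t \<le> mB x t"
  unfolding minB_def using HB_nonempty funB_ge by (intro cINF_greatest) auto

lemma minA_le: "0 < t \<Longrightarrow> y \<in> HA f \<alpha> x t \<Longrightarrow> mA x t \<le> funA f \<alpha> u0 y x t"
  unfolding minA_def using funA_ge by (intro cINF_lower) (auto simp: bdd_below_def)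

lemma minB_le: "0 < t \<Longrightarrow> \<tau> \<in> HB f \<alpha> x t \<Longrightarrow> mB x t \<le> funB f \<alpha> u0 ub \<tau> x t"
  unfolding minB_def using funB_ge by (intro cINF_lower) (auto simp: bdd_below_def)

lemma extA_HA: "ext c 0 x t \<Longrightarrow> zc x t c 0 \<in> HA f \<alpha> x t \<and> funA f \<alpha> u0 (zc x t c 0) x t = V x t"
  using extD(2)[of c 0 x t] extD(3)[of c 0 x t 0] by (auto simp: HA_iff jp_zc funA_eq ext_def cand_def)

lemma extB_HB:
  assumes "ext c \<sigma> x t" "zc x t c \<sigma> = 0"
  shows "c = jp \<sigma> t x" "\<sigma> \<in> HB f \<alpha> x t" "funB f \<alpha> u0 ub \<sigma> x t = V x t"
  using extD(1,2)[OF assms(1)] jp_zc[of \<sigma> t x c] assms by (auto simp: HB_iff funB_eq ext_def cand_def)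

text \<open>Minimizers of \<open>A\<close> are feet of extremal curves once \<open>A\<close> attains
  \<open>V\<close>; this equivalence therefore decides which of the two functionals describes the
  extremal curves of a point.\<close>

lemma minA_eq_iff:
  assumes "0 \<le> x" "0 < t"
  shows "mA x t = V x t \<longleftrightarrow> (\<exists>c. ext c 0 x t)"
proof
  assume "\<exists>c. ext c 0 x t"
  then show "mA x t = V x t" using extA_HA minA_le[OF assms(2)] minA_ge[OF assms] by (metis order_antisym)
next
  assume a: "mA x t = V x t"
  have "\<exists>c \<sigma>. ext c \<sigma> x t \<and> (\<lambda>\<sigma> _. \<sigma> = 0) \<sigma> (zc x t c \<sigma>)"
  proof (rule cand_minimizer[OF assms])
    fix e :: real assume "0 < e"
    then obtain y where y: "y \<in> HA f \<alpha> x t" "funA f \<alpha> u0 y x t < V x t + e"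
      using cINF_less_iff[of "HA f \<alpha> x t" "\<lambda>y. funA f \<alpha> u0 y x t" "V x t + e"] HA_nonempty[OF assms] funA_ge[OF assms(2)] a
      unfolding minA_def by (fastforce simp: bdd_below_def)
    then have "cand (jp 0 t (x - y)) 0 x t \<and> 0 = (0::real) \<and> val (jp 0 t (x - y)) 0 x t < V x t + e"
      using assms HA_nonneg[OF assms(2) y(1)] by (auto simp: cand_def HA_iff funA_eq)
    then show "\<exists>c \<sigma>. cand c \<sigma> x t \<and> \<sigma> = 0 \<and> val c \<sigma> x t < V x t + e" by blast
  next
    have "{(\<sigma>, z). \<sigma> = 0} = {0::real} \<times> (UNIV :: real set)" by auto
    then show "closed {(\<sigma>, z :: real). \<sigma> = (0::real)}" by (simp add: closed_Times)
  qed simp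
  then show "\<exists>c. ext c 0 x t" by auto
qed

lemma minB_boundary: "0 < t \<Longrightarrow> mB 0 t = V 0 t"
  using minB_le[of t t 0] minB_ge[of 0 t] HB_end[of t 0] funB_end[of t 0] by auto

lemma minB_eq_iff:
  assumes "0 < x" "0 < t"
  shows "mB x t = V x t \<longleftrightarrow> (\<exists>c \<sigma>. ext c \<sigma> x t \<and> zc x t c \<sigma> = 0)"
proof
  assume "\<exists>c \<sigma>. ext c \<sigma> x t \<and> zc x t c \<sigma> = 0"
  then show "mB x t = V x t" using extB_HB minB_le[OF assms(2)] minB_ge[of x t] assms by (metis less_imp_le order_antisym)
next
  assume a: "mB x t = V x t"
  show "\<exists>c \<sigma>. ext c \<sigma> x t \<and> zc x t c \<sigma> = 0"
  proof (rule cand_minimizer)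
    fix e :: real assume "0 < e"
    then obtain \<tau> where y: "\<tau> \<in> HB f \<alpha> x t" "funB f \<alpha> u0 ub \<tau> x t < V x t + e"
      using cINF_less_iff[of "HB f \<alpha> x t" "\<lambda>y. funB f \<alpha> u0 ub y x t" "V x t + e"] HB_nonempty[of x t] funB_ge[OF assms(2)] a assms
      unfolding minB_def by (fastforce simp: bdd_below_def)
    then have "\<tau> < t" using assms by (auto simp: HB_def order.order_iff_strict)
    then have "cand (jp \<tau> t x) \<tau> x t \<and> zc x t (jp \<tau> t x) \<tau> = 0 \<and> val (jp \<tau> t x) \<tau> x t < V x t + e"
      using y zc_jp_foot[of \<tau> t x 0] by (auto simp: cand_def HB_iff funB_eq)
    then show "\<exists>c \<sigma>. cand c \<sigma> x t \<and> zc x t c \<sigma> = 0 \<and> val c \<sigma> x t < V x t + e" by blast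
  next
    have "{(\<sigma>, z). z = 0} = (UNIV :: real set) \<times> {0::real}" by auto
    then show "closed {(\<sigma> :: real, z). z = (0::real)}" by (simp add: closed_Times)
  qed (use assms in auto)
qed

lemma minA_or_minB:
  assumes "0 < x" "0 < t" shows "mA x t = V x t \<or> mB x t = V x t"
proof -
  obtain c \<sigma> where e: "ext c \<sigma> x t" using ext_exists[OF assms] by blast
  show ?thesis using extD(4)[OF e] e minA_eq_iff[of x t] minB_eq_iff[OF assms] assms by auto
qed

lemma minimizerA_iff:
  assumes "0 \<le> x" "0 < t" "mA x t = V x t"
  shows "minimizerA f \<alpha> u0 x t y \<longleftrightarrow> ext (jp 0 t (x - y)) 0 x t"
proof -
  obtain c where "ext c 0 x t" using minA_eq_iff[OF assms(1,2)] assms(3) by blast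
  from extA_HA[OF this] have "minimizerA f \<alpha> u0 x t y \<longleftrightarrow> y \<in> HA f \<alpha> x t \<and> funA f \<alpha> u0 y x t = V x t"
    unfolding minimizerA_def by (intro is_arg_min_iff_attained funA_ge[OF assms(2)]) auto
  also have "\<dots> \<longleftrightarrow> ext (jp 0 t (x - y)) 0 x t"
  proof -
    have "funA f \<alpha> u0 y x t = val (jp 0 t (x - y)) 0 x t" if "adm (jp 0 t (x - y)) 0 x t"
      using HA_nonneg[OF assms(2), of y x] assms(2) that by (intro funA_eq) (auto simp: HA_iff)
    then show ?thesis using assms(2) by (auto simp: HA_iff ext_def cand_def)
  qed
  finally show ?thesis .
qed

text \<open>On the axis the one-point curve with \<open>\<tau> = t\<close> is a minimizer for which
  no extremal curve accounts; hence the second alternative.\<close>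

lemma minimizerB_iff:
  assumes "0 \<le> x" "0 < t" "mB x t = V x t"
  shows "minimizerB f \<alpha> u0 ub x t \<tau> \<longleftrightarrow> (\<tau> < t \<and> ext (jp \<tau> t x) \<tau> x t) \<or> (\<tau> = t \<and> x = 0)"
proof -
  have "\<exists>\<tau>'. \<tau>' \<in> HB f \<alpha> x t \<and> funB f \<alpha> u0 ub \<tau>' x t = V x t"
  proof (cases "x = 0")
    case True
    then show ?thesis using HB_end[of t x] funB_end[of t x] assms by auto
  next
    case False
    then show ?thesis using minB_eq_iff[of x t] assms extB_HB by (metis order.not_eq_order_implies_strict)
  qed
  then have "minimizerB f \<alpha> u0 ub x t \<tau> \<longleftrightarrow> \<tau> \<in> HB f \<alpha> x t \<and> funB f \<alpha> u0 ub \<tau> x t = V x t"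
    unfolding minimizerB_def by (intro is_arg_min_iff_attained funB_ge[OF assms(2)]) auto
  also have "\<dots> \<longleftrightarrow> (\<tau> < t \<and> ext (jp \<tau> t x) \<tau> x t) \<or> (\<tau> = t \<and> x = 0)"
  proof (cases "\<tau> < t")
    case True
    then show ?thesis
      using zc_jp_foot[of \<tau> t x 0] funB_eq[of \<tau> t x] by (auto simp: HB_iff ext_def cand_def adm_def)
  next
    case False
    then show ?thesis
      using HB_end[of t x] funB_end[of t x] assms by (auto simp: HB_def)
  qed
  finally show ?thesis .
qed

lemma extA_range:
  assumes "0 < t" "\<exists>c. ext c 0 x t"
  obtains cm cM where "ext cm 0 x t" "ext cM 0 x t" "\<And>c. ext c 0 x t \<Longrightarrow> cm \<le> c \<and> c \<le> cM"
proof -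
  define A where "A = {c. ext c 0 x t}"
  obtain K where K: "Kbig t K" using Kbig_ex[of t] by (metis order_refl)
  have "A \<subseteq> {-K..K}" using ext_bound[OF K ext_opt] extD(2) by (force simp: A_def abs_le_iff)
  then have "bounded A" by (rule bounded_subset[OF compact_imp_bounded[OF compact_Icc]])
  moreover have "closed A"
    unfolding closed_sequential_limits
  proof (intro allI impI, elim conjE)
    fix cn c assume c: "\<forall>n. cn n \<in> A" "cn \<longlonglongrightarrow> c"
    have e: "ext (cn n) 0 x t" for n using c(1) by (simp add: A_def)
    obtain r c' \<sigma> where r: "strict_mono (r :: nat \<Rightarrow> nat)" "(\<lambda>n. cn (r n)) \<longlonglongrightarrow> c'" "(\<lambda>n. 0) \<longlonglongrightarrow> \<sigma>" "ext c' \<sigma> x t"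
      by (rule ext_compact[where xn = "\<lambda>_. x" and tn = "\<lambda>_. t" and cn = cn and \<sigma>n = "\<lambda>_. 0" and \<delta> = t,
            OF tendsto_const tendsto_const e assms(1)]) (auto intro: that)
    have "(\<lambda>n. cn (r n)) \<longlonglongrightarrow> c" using LIMSEQ_subseq_LIMSEQ[OF c(2) r(1)] by (simp add: o_def)
    then show "c \<in> A" using r LIMSEQ_unique LIMSEQ_const_iff by (metis A_def mem_Collect_eq)
  qed
  ultimately have cA: "compact A" by (simp add: compact_eq_bounded_closed)
  have "A \<noteq> {}" using assms(2) by (simp add: A_def)
  then show ?thesis
    using compact_attains_inf[OF cA] compact_attains_sup[OF cA] that by (force simp: A_def)
qed

lemma extB_compact:
  assumes "0 < \<delta>" shows "compact {\<tau>. \<tau> \<le> t - \<delta> \<and> ext (jp \<tau> t x) \<tau> x t}" (is "compact ?A")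
proof -
  have "?A \<subseteq> {0..t - \<delta>}" using extD(1) by auto
  then have "bounded ?A" by (rule bounded_subset[OF compact_imp_bounded[OF compact_Icc]])
  moreover have "closed ?A"
    unfolding closed_sequential_limits
  proof (intro allI impI, elim conjE)
    fix \<tau>n \<tau> assume c: "\<forall>n. \<tau>n n \<in> ?A" "\<tau>n \<longlonglongrightarrow> \<tau>"
    have e: "ext (jp (\<tau>n n) t x) (\<tau>n n) x t" "\<tau>n n \<le> t - \<delta>" for n using c(1) by auto
    obtain r c' \<sigma> where r: "strict_mono (r :: nat \<Rightarrow> nat)" "(\<lambda>n. \<tau>n (r n)) \<longlonglongrightarrow> \<sigma>" "ext c' \<sigma> x t"
      "(\<lambda>n. zc x t (jp (\<tau>n (r n)) t x) (\<tau>n (r n))) \<longlonglongrightarrow> zc x t c' \<sigma>"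
      by (rule ext_compact[where xn = "\<lambda>_. x" and tn = "\<lambda>_. t" and cn = "\<lambda>n. jp (\<tau>n n) t x" and \<sigma>n = \<tau>n,
            OF tendsto_const tendsto_const e(1) assms e(2)]) (blast intro: that)
    have "(\<lambda>n. \<tau>n (r n)) \<longlonglongrightarrow> \<tau>" using LIMSEQ_subseq_LIMSEQ[OF c(2) r(1)] by (simp add: o_def)
    then have st: "\<sigma> = \<tau>" using r(2) LIMSEQ_unique by blast
    have "zc x t (jp (\<tau>n (r n)) t x) (\<tau>n (r n)) = 0" for n
      using zc_jp_foot[of "\<tau>n (r n)" t x 0] extD(1,2)[OF e(1)[of "r n"]] by simp
    then have "zc x t c' \<sigma> = 0" using r(4) by (simp add: LIMSEQ_const_iff)
    then have "ext (jp \<tau> t x) \<tau> x t" using extB_HB(1)[OF r(3)] r(3) st by simp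
    moreover have "\<tau> \<le> t - \<delta>" by (rule LIMSEQ_le_const2[OF c(2)]) (use e(2) in auto)
    ultimately show "\<tau> \<in> ?A" by simp
  qed
  ultimately show ?thesis by (simp add: compact_eq_bounded_closed)
qed

text \<open>The order is reversed: through a fixed endpoint a larger parameter leads to a foot
  further left, so the least minimizer belongs to the largest parameter.\<close>

lemma y_low_up:
  assumes "0 \<le> x" "0 < t" "mA x t = V x t"
  obtains cm cM where "ext cm 0 x t" "ext cM 0 x t" "\<And>c. ext c 0 x t \<Longrightarrow> cm \<le> c \<and> c \<le> cM"
    "y_low f \<alpha> u0 x t = zc x t cM 0" "y_up f \<alpha> u0 x t = zc x t cm 0"
proof -
  obtain cm cM where c: "ext cm 0 x t" "ext cM 0 x t" "\<And>c. ext c 0 x t \<Longrightarrow> cm \<le> c \<and> c \<le> cM"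
    using extA_range[OF assms(2)] minA_eq_iff[OF assms(1,2)] assms(3) by metis
  have m: "minimizerA f \<alpha> u0 x t (zc x t c 0)" if "ext c 0 x t" for c
    using that minimizerA_iff[OF assms] assms(2) by (simp add: jp_zc)
  have b: "zc x t cM 0 \<le> y \<and> y \<le> zc x t cm 0" if "minimizerA f \<alpha> u0 x t y" for y
  proof -
    have "ext (jp 0 t (x - y)) 0 x t" using that minimizerA_iff[OF assms] by simp
    from c(3)[OF this] have "zc x t cM 0 \<le> zc x t (jp 0 t (x - y)) 0 \<and> zc x t (jp 0 t (x - y)) 0 \<le> zc x t cm 0"
      using assms(2) by (auto intro: zc_anti)
    then show ?thesis using assms(2) by (simp add: zc_jp_foot)
  qed
  have "y_low f \<alpha> u0 x t = zc x t cM 0"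
    unfolding y_low_def using m[OF c(2)] b by (intro Least_equality) auto
  moreover have "y_up f \<alpha> u0 x t = zc x t cm 0"
    unfolding y_up_def using m[OF c(1)] b by (intro Greatest_equality) auto
  ultimately show ?thesis using that c by blast
qed

text \<open>At \<open>x = 0\<close> minimizers may accumulate at \<open>t\<close>; the least one is
  therefore sought below some minimizer \<open>\<tau>0 < t\<close>, and the greatest is
  \<open>t\<close> itself. For \<open>x > 0\<close> all feet keep a uniform distance from
  \<open>t\<close>.\<close>

lemma tau_low_up:
  assumes "0 \<le> x" "0 < t" "mB x t = V x t"
  shows "minimizerB f \<alpha> u0 ub x t (tau_low f \<alpha> u0 ub x t)" "minimizerB f \<alpha> u0 ub x t (tau_up f \<alpha> u0 ub x t)"
    "\<And>\<tau>. minimizerB f \<alpha> u0 ub x t \<tau> \<Longrightarrow> tau_low f \<alpha> u0 ub x t \<le> \<tau> \<and> \<tau> \<le> tau_up f \<alpha> u0 ub x t"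
proof -
  note iff = minimizerB_iff[OF assms]
  have "\<exists>s. minimizerB f \<alpha> u0 ub x t s \<and> (\<forall>\<tau>. minimizerB f \<alpha> u0 ub x t \<tau> \<longrightarrow> s \<le> \<tau>)"
  proof (cases "\<exists>\<tau>0<t. ext (jp \<tau>0 t x) \<tau>0 x t")
    case True
    then obtain \<tau>0 where t0: "\<tau>0 < t" "ext (jp \<tau>0 t x) \<tau>0 x t" by blast
    define A where "A = {\<tau>. \<tau> \<le> t - (t - \<tau>0) \<and> ext (jp \<tau> t x) \<tau> x t}"
    have "compact A" unfolding A_def using t0 by (intro extB_compact) simp
    moreover have "\<tau>0 \<in> A" using t0 by (simp add: A_def)
    ultimately obtain s where s: "s \<in> A" "\<And>\<tau>. \<tau> \<in> A \<Longrightarrow> s \<le> \<tau>" using compact_attains_inf[of A] by blast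
    have sb: "s \<le> \<tau>0" "s < t" "ext (jp s t x) s x t" using s(1) t0 by (auto simp: A_def)
    have "s \<le> \<tau>" if "minimizerB f \<alpha> u0 ub x t \<tau>" for \<tau>
      using that s(2)[of \<tau>] sb unfolding iff A_def by (cases "\<tau> \<le> \<tau>0") auto
    then show ?thesis using sb iff by blast
  next
    case False
    then have "x = 0" using assms minB_eq_iff[of x t] extB_HB(1) extD(2) by (metis order.not_eq_order_implies_strict)
    then show ?thesis using False iff by auto
  qed
  then obtain s1 where s1: "minimizerB f \<alpha> u0 ub x t s1" "\<And>\<tau>. minimizerB f \<alpha> u0 ub x t \<tau> \<Longrightarrow> s1 \<le> \<tau>" by blast
  have "\<exists>s. minimizerB f \<alpha> u0 ub x t s \<and> (\<forall>\<tau>. minimizerB f \<alpha> u0 ub x t \<tau> \<longrightarrow> \<tau> \<le> s)"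
  proof (cases "x = 0")
    case True
    then show ?thesis using iff by (intro exI[of _ t]) auto
  next
    case False
    then have x: "0 < x" using assms by simp
    obtain \<delta> where \<delta>: "0 < \<delta>" "\<And>c \<sigma> x' t'. ext c \<sigma> x' t' \<Longrightarrow> x \<le> x' \<Longrightarrow> t \<le> t' \<Longrightarrow> t' \<le> t \<Longrightarrow> \<sigma> \<le> t' - \<delta>"
      using ext_gap[OF x assms(2), of t] by metis
    define A where "A = {\<tau>. \<tau> \<le> t - \<delta> \<and> ext (jp \<tau> t x) \<tau> x t}"
    have A: "\<tau> \<in> A \<longleftrightarrow> minimizerB f \<alpha> u0 ub x t \<tau>" for \<tau>
      unfolding iff A_def using \<delta>(1) \<delta>(2)[of "jp \<tau> t x" \<tau> x t] x extD(2) by auto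
    have "compact A" unfolding A_def by (rule extB_compact[OF \<delta>(1)])
    moreover have "s1 \<in> A" using s1 A by simp
    ultimately show ?thesis using compact_attains_sup[of A] A by blast
  qed
  then obtain s2 where s2: "minimizerB f \<alpha> u0 ub x t s2" "\<And>\<tau>. minimizerB f \<alpha> u0 ub x t \<tau> \<Longrightarrow> \<tau> \<le> s2" by blast
  have "tau_low f \<alpha> u0 ub x t = s1" "tau_up f \<alpha> u0 ub x t = s2"
    unfolding tau_low_def tau_up_def using s1 s2 by (auto intro: Least_equality Greatest_equality)
  then show "minimizerB f \<alpha> u0 ub x t (tau_low f \<alpha> u0 ub x t)" "minimizerB f \<alpha> u0 ub x t (tau_up f \<alpha> u0 ub x t)"
    "\<And>\<tau>. minimizerB f \<alpha> u0 ub x t \<tau> \<Longrightarrow> tau_low f \<alpha> u0 ub x t \<le> \<tau> \<and> \<tau> \<le> tau_up f \<alpha> u0 ub x t"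
    using s1 s2 by auto
qed

subsection \<open>Characteristic triangles in terms of extremal curves\<close>

text \<open>At time \<open>\<sigma>'\<close> the first curve has already started, so it is not to
  the left of the foot of the second.\<close>

lemma foot_order:
  assumes "ext c \<sigma> x t" "ext c' \<sigma>' x t" "zc x t c' \<sigma>' = 0" "\<sigma> \<le> \<sigma>'"
  shows "c \<le> c'"
  using zc_le_iff[of \<sigma>' t x c' c] extD(3)[OF assms(1), of \<sigma>'] extD(1,2)[OF assms(2)] assms(3,4) by auto

lemma extB_minimizer:
  assumes "0 < t" "0 \<le> x" "mB x t = V x t" "ext c \<sigma> x t" "zc x t c \<sigma> = 0"
  shows "minimizerB f \<alpha> u0 ub x t \<sigma>" "c = jp \<sigma> t x"
  using minimizerB_iff[OF assms(2,1,3)] extB_HB(1)[OF assms(4,5)] assms(4) extD(2)[OF assms(4)] by auto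

text \<open>The curve with the latest foot bounds all extremal curves on the left, including those
  that end on the x-axis.\<close>

lemma tau_up_max:
  assumes "0 < x" "0 < t" "mB x t = V x t"
  defines "s \<equiv> tau_up f \<alpha> u0 ub x t"
  shows "ext (jp s t x) s x t" "s < t" "0 \<le> s" "zc x t (jp s t x) s = 0"
    "\<And>c \<sigma>. ext c \<sigma> x t \<Longrightarrow> \<sigma> \<le> s \<and> c \<le> jp s t x"
proof -
  have x0: "0 \<le> x" using assms by simp
  note tl = tau_low_up[OF x0 assms(2,3)]
  show e: "ext (jp s t x) s x t" "s < t"
    using tl(2) minimizerB_iff[OF x0 assms(2,3)] assms(1) by (auto simp: s_def)
  then show s0: "0 \<le> s" using extD(1) by blast
  show z: "zc x t (jp s t x) s = 0" using zc_jp_foot[of s t x 0] e s0 by simp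
  show "\<sigma> \<le> s \<and> c \<le> jp s t x" if c: "ext c \<sigma> x t" for c \<sigma>
  proof -
    have "\<sigma> \<le> s"
    proof (cases "zc x t c \<sigma> = 0")
      case True
      then show ?thesis using extB_minimizer(1)[OF assms(2) x0 assms(3) c] tl(3) by (simp add: s_def)
    qed (use extD(4)[OF c] s0 in auto)
    then show ?thesis using foot_order[OF c e(1) z] by simp
  qed
qed

text \<open>The strict inequality excludes feet at time 0, so only feet on the t-axis compete for
  the right boundary.\<close>

lemma tau_low_min:
  assumes "0 \<le> x" "0 < t" "mB x t = V x t" "mB x t < mA x t"
  defines "s \<equiv> tau_low f \<alpha> u0 ub x t"
  shows "(s = t \<and> x = 0) \<or> (s < t \<and> ext (jp s t x) s x t)"
    "\<And>c \<sigma>. ext c \<sigma> x t \<Longrightarrow> s \<le> \<sigma> \<and> jp s t x \<le> c"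
proof -
  note tl = tau_low_up[OF assms(1-3)]
  have noA: "\<not> ext c 0 x t" for c using minA_eq_iff[OF assms(1,2)] assms(3,4) by auto
  show 1: "(s = t \<and> x = 0) \<or> (s < t \<and> ext (jp s t x) s x t)"
    using tl(1) minimizerB_iff[OF assms(1-3)] by (auto simp: s_def)
  show "s \<le> \<sigma> \<and> jp s t x \<le> c" if c: "ext c \<sigma> x t" for c \<sigma>
  proof -
    have z: "zc x t c \<sigma> = 0" using extD(4)[OF c] c noA by auto
    have m: "minimizerB f \<alpha> u0 ub x t \<sigma>" using extB_minimizer(1)[OF assms(2,1,3) c z] .
    have s\<sigma>: "s \<le> \<sigma>" using tl(3)[OF m] by (simp add: s_def)
    then have "ext (jp s t x) s x t" using 1 extD(2)[OF c] by auto
    from foot_order[OF this c z s\<sigma>] show ?thesis using s\<sigma> by simp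
  qed
qed

lemma y_up_min:
  assumes "0 \<le> x" "0 < t" "mA x t = V x t"
  defines "c0 \<equiv> jp 0 t (x - y_up f \<alpha> u0 x t)"
  shows "ext c0 0 x t" "\<And>c \<sigma>. ext c \<sigma> x t \<Longrightarrow> c0 \<le> c"
proof -
  obtain cm cM where c: "ext cm 0 x t" "ext cM 0 x t" "\<And>c. ext c 0 x t \<Longrightarrow> cm \<le> c \<and> c \<le> cM"
    "y_low f \<alpha> u0 x t = zc x t cM 0" "y_up f \<alpha> u0 x t = zc x t cm 0"
    using y_low_up[OF assms(1-3)] by metis
  have c0: "c0 = cm" using c(5) assms(2) by (simp add: c0_def jp_zc)
  show "ext c0 0 x t" using c c0 by simp
  show "c0 \<le> c'" if e: "ext c' \<sigma> x t" for c' \<sigma>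
    using extD(4)[OF e] foot_order[OF c(1) e] extD(1)[OF e] c(3)[of c'] e c0 by auto
qed

lemma y_low_max:
  assumes "0 < x" "0 < t" "mA x t < mB x t"
  defines "c0 \<equiv> jp 0 t (x - y_low f \<alpha> u0 x t)"
  shows "mA x t = V x t" "ext c0 0 x t" "\<And>c \<sigma>. ext c \<sigma> x t \<Longrightarrow> \<sigma> = 0 \<and> c \<le> c0"
proof -
  have x0: "0 \<le> x" using assms by simp
  show a: "mA x t = V x t" using minA_or_minB[OF assms(1,2)] minA_ge[OF x0 assms(2)] assms(3) by auto
  have noB: "zc x t c \<sigma> \<noteq> 0" if "ext c \<sigma> x t" for c \<sigma>
    using that minB_eq_iff[OF assms(1,2)] a assms(3) by auto
  obtain cm cM where c: "ext cm 0 x t" "ext cM 0 x t" "\<And>c. ext c 0 x t \<Longrightarrow> cm \<le> c \<and> c \<le> cM"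
    "y_low f \<alpha> u0 x t = zc x t cM 0" "y_up f \<alpha> u0 x t = zc x t cm 0"
    using y_low_up[OF x0 assms(2) a] by metis
  have c0: "c0 = cM" using c(4) assms(2) by (simp add: c0_def jp_zc)
  show "ext c0 0 x t" using c c0 by simp
  show "\<sigma> = 0 \<and> c' \<le> c0" if e: "ext c' \<sigma> x t" for c' \<sigma>
    using extD(4)[OF e] noB[OF e] c(3)[of c'] e c0 by auto
qed

text \<open>Asking for some extremal curve on the right of the point, instead of naming the
  outermost one, removes the distinction between \<open>A\<close> and \<open>B\<close> and gives a
  condition that passes to limits.\<close>

definition above_tri :: "real \<Rightarrow> real \<Rightarrow> real \<Rightarrow> real \<Rightarrow> bool" where
  "above_tri x t \<xi> \<theta> \<longleftrightarrow> (\<exists>c \<sigma>. ext c \<sigma> x t \<and> \<sigma> \<le> \<theta> \<and> \<xi> \<le> zc x t c \<theta>)"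

text \<open>A curve that starts only after \<open>\<theta>\<close> counts as lying on the left,
  since below its foot the t-axis continues it; for \<open>x = 0\<close> this axis is the whole left
  boundary.\<close>

definition below_tri :: "real \<Rightarrow> real \<Rightarrow> real \<Rightarrow> real \<Rightarrow> bool" where
  "below_tri x t \<xi> \<theta> \<longleftrightarrow> x = 0 \<or> (\<exists>c \<sigma>. ext c \<sigma> x t \<and> (\<theta> < \<sigma> \<or> zc x t c \<theta> \<le> \<xi>))"

definition tri :: "real \<Rightarrow> real \<Rightarrow> real \<Rightarrow> real \<Rightarrow> bool" where
  "tri x t \<xi> \<theta> \<longleftrightarrow> 0 \<le> \<theta> \<and> 0 \<le> \<xi> \<and> (\<theta> = t \<and> \<xi> = x \<or> \<theta> < t \<and> above_tri x t \<xi> \<theta> \<and> below_tri x t \<xi> \<theta>)"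

lemma above_tri_iff:
  assumes "ext c0 \<sigma>0 x t" "\<And>c \<sigma>. ext c \<sigma> x t \<Longrightarrow> \<sigma>0 \<le> \<sigma> \<and> c0 \<le> c" "0 \<le> \<theta>" "\<theta> < t"
  shows "above_tri x t \<xi> \<theta> \<longleftrightarrow> \<sigma>0 \<le> \<theta> \<and> \<xi> \<le> zc x t c0 \<theta>"
proof
  assume "above_tri x t \<xi> \<theta>"
  then obtain c \<sigma> where c: "ext c \<sigma> x t" "\<sigma> \<le> \<theta>" "\<xi> \<le> zc x t c \<theta>" by (auto simp: above_tri_def)
  then show "\<sigma>0 \<le> \<theta> \<and> \<xi> \<le> zc x t c0 \<theta>"
    using assms(2)[OF c(1)] zc_anti[of \<theta> t c0 c x] assms(3,4) by auto
qed (use assms(1) in \<open>auto simp: above_tri_def\<close>)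

lemma below_tri_iff:
  assumes "ext c0 \<sigma>0 x t" "\<And>c \<sigma>. ext c \<sigma> x t \<Longrightarrow> \<sigma> \<le> \<sigma>0 \<and> c \<le> c0" "0 \<le> \<theta>" "\<theta> < t" "x \<noteq> 0"
  shows "below_tri x t \<xi> \<theta> \<longleftrightarrow> \<theta> < \<sigma>0 \<or> zc x t c0 \<theta> \<le> \<xi>"
proof
  assume "below_tri x t \<xi> \<theta>"
  then obtain c \<sigma> where c: "ext c \<sigma> x t" "\<theta> < \<sigma> \<or> zc x t c \<theta> \<le> \<xi>" using assms(5) by (auto simp: below_tri_def)
  then show "\<theta> < \<sigma>0 \<or> zc x t c0 \<theta> \<le> \<xi>"
    using assms(2)[OF c(1)] zc_anti[of \<theta> t c c0 x] assms(3,4) by auto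
qed (use assms(1) in \<open>auto simp: below_tri_def\<close>)

lemma left_boundary_iff:
  assumes "ext (jp s t x) s x t" "0 \<le> s" "s < t" "zc x t (jp s t x) s = 0" "\<theta> \<le> t" "0 \<le> \<xi>"
  shows "(if \<theta> \<le> s then 0 else curveB f \<alpha> x t s \<theta>) \<le> \<xi> \<longleftrightarrow> \<theta> < s \<or> zc x t (jp s t x) \<theta> \<le> \<xi>"
  using assms curveB_eq[of s t \<theta> x] by (cases "\<theta> = s") auto

lemma left_boundary_nonneg:
  assumes "ext (jp s t x) s x t" "0 \<le> s" "s < t" "\<theta> \<le> t"
  shows "0 \<le> (if \<theta> \<le> s then 0 else curveB f \<alpha> x t s \<theta>)"
  using assms curveB_eq[of s t \<theta> x] extD(3)[OF assms(1), of \<theta>] by auto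

lemma char_triangle_iff:
  assumes "0 \<le> x" "0 < t"
  shows "(\<xi>, \<theta>) \<in> char_triangle f \<alpha> u0 ub x t \<longleftrightarrow> tri x t \<xi> \<theta>"
proof -
  define y1 y2 s1 s2 where "y1 = y_low f \<alpha> u0 x t" and "y2 = y_up f \<alpha> u0 x t"
    and "s1 = tau_low f \<alpha> u0 ub x t" and "s2 = tau_up f \<alpha> u0 ub x t"
  note defs = char_triangle_def Let_def y1_def[symmetric] y2_def[symmetric] s1_def[symmetric] s2_def[symmetric]
  have mem: "(\<xi>, \<theta>) \<in> char_triangle f \<alpha> u0 ub x t \<longleftrightarrow>
      (if mA x t < mB x t \<and> x \<noteq> 0 then
         0 \<le> \<theta> \<and> \<theta> \<le> t \<and> curveA f \<alpha> x t y1 \<theta> \<le> \<xi> \<and> \<xi> \<le> curveA f \<alpha> x t y2 \<theta>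
       else if mA x t < mB x t then 0 \<le> \<theta> \<and> \<theta> \<le> t \<and> 0 \<le> \<xi> \<and> \<xi> \<le> curveA f \<alpha> x t y2 \<theta>
       else if mB x t < mA x t then
         s1 \<le> \<theta> \<and> \<theta> \<le> t \<and> (if \<theta> \<le> s2 then 0 else curveB f \<alpha> x t s2 \<theta>) \<le> \<xi> \<and> \<xi> \<le> curveB f \<alpha> x t s1 \<theta>
       else 0 \<le> \<theta> \<and> \<theta> \<le> t \<and> (if \<theta> \<le> s2 then 0 else curveB f \<alpha> x t s2 \<theta>) \<le> \<xi> \<and> \<xi> \<le> curveA f \<alpha> x t y2 \<theta>)"
    unfolding defs
    by (cases "mA x t < mB x t"; cases "x = 0"; cases "mB x t < mA x t"; simp)
  \<comment> \<open>On the axis \<open>mB x t\<close> equals \<open>V x t\<close> and hence is at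
    most \<open>mA x t\<close>; this leaves five cases.\<close>
  consider "x = 0" "mB x t < mA x t" | "x = 0" "mA x t = mB x t"
    | "0 < x" "mA x t < mB x t" | "0 < x" "mB x t < mA x t" | "0 < x" "mA x t = mB x t"
    using minB_boundary[OF assms(2)] minA_ge[of 0 t] assms by fastforce
  then show ?thesis
  proof cases
    case 1
    have b: "mB x t = V x t" using minB_boundary[OF assms(2)] 1 by simp
    note s1 = tau_low_min[OF assms b 1(2), folded s1_def]
    \<comment> \<open>The latest foot is the point itself, so the left boundary is the t-axis at all
      times.\<close>
    have s2: "s2 = t"
      using tau_low_up(2,3)[OF assms b] minimizerB_iff[OF assms b] 1(1) unfolding s2_def by (metis order_antisym less_imp_le order_refl)
    have D: "(\<xi>, \<theta>) \<in> char_triangle f \<alpha> u0 ub x t \<longleftrightarrow> s1 \<le> \<theta> \<and> \<theta> \<le> t \<and> 0 \<le> \<xi> \<and> \<xi> \<le> curveB f \<alpha> x t s1 \<theta>"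
      unfolding mem using 1 by (auto simp: s2)
    from s1(1) show ?thesis
    proof
      assume st: "s1 = t \<and> x = 0"
      then have "\<not> ext c \<sigma> x t" for c \<sigma> using s1(2)[of c \<sigma>] extD(2)[of c \<sigma> x t] by auto
      then show ?thesis unfolding D tri_def using st assms(2) by (auto simp: above_tri_def curveB_def)
    next
      assume st: "s1 < t \<and> ext (jp s1 t x) s1 x t"
      then have s0: "0 \<le> s1" using extD(1) by blast
      have cB: "curveB f \<alpha> x t s1 \<theta> = zc x t (jp s1 t x) \<theta>" if "s1 \<le> \<theta>" "\<theta> \<le> t"
        using curveB_eq[of s1 t \<theta> x] st s0 that by auto
      show ?thesis
      proof (cases "0 \<le> \<theta> \<and> \<theta> < t")
        case True
        then show ?thesis unfolding D tri_def
          using above_tri_iff[of "jp s1 t x" s1 x t \<theta> \<xi>] s1(2) st cB 1(1) by (auto simp: below_tri_def)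
      next
        case False
        then show ?thesis unfolding D tri_def using cB s0 st 1(1) by auto
      qed
    qed
  next
    case 2
    have b: "mB x t = V x t" "mA x t = V x t" using minB_boundary[OF assms(2)] 2 by auto
    have s2: "s2 = t"
      using tau_low_up(2,3)[OF assms b(1)] minimizerB_iff[OF assms b(1)] 2(1) unfolding s2_def by (metis order_antisym less_imp_le order_refl)
    note y = y_up_min[OF assms b(2), folded y2_def]
    have D: "(\<xi>, \<theta>) \<in> char_triangle f \<alpha> u0 ub x t \<longleftrightarrow> 0 \<le> \<theta> \<and> \<theta> \<le> t \<and> 0 \<le> \<xi> \<and> \<xi> \<le> zc x t (jp 0 t (x - y2)) \<theta>"
      unfolding mem using 2 curveA_eq[of t \<theta> x y2] assms by (auto simp: s2)
    show ?thesis
    proof (cases "0 \<le> \<theta> \<and> \<theta> < t")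
      case True
      then show ?thesis unfolding D tri_def
        using above_tri_iff[OF y(1), of \<theta> \<xi>] y(2) extD(1) 2(1) by (auto simp: below_tri_def)
    next
      case False
      then show ?thesis unfolding D tri_def using assms 2(1) by auto
    qed
  next
    case 3
    note y1 = y_low_max[OF 3(1) assms(2) 3(2), folded y1_def]
    note y2 = y_up_min[OF assms y1(1), folded y2_def]
    have D: "(\<xi>, \<theta>) \<in> char_triangle f \<alpha> u0 ub x t \<longleftrightarrow> 0 \<le> \<theta> \<and> \<theta> \<le> t \<and> zc x t (jp 0 t (x - y1)) \<theta> \<le> \<xi> \<and> \<xi> \<le> zc x t (jp 0 t (x - y2)) \<theta>"
      unfolding mem using 3 curveA_eq[of t \<theta> x y2] curveA_eq[of t \<theta> x y1] assms by auto
    show ?thesis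
    proof (cases "0 \<le> \<theta> \<and> \<theta> < t")
      case True
      have "above_tri x t \<xi> \<theta> \<longleftrightarrow> 0 \<le> \<theta> \<and> \<xi> \<le> zc x t (jp 0 t (x - y2)) \<theta>"
        by (rule above_tri_iff[OF y2(1)]) (use y2(2) extD(1) True in auto)
      moreover have "below_tri x t \<xi> \<theta> \<longleftrightarrow> \<theta> < 0 \<or> zc x t (jp 0 t (x - y1)) \<theta> \<le> \<xi>"
        by (rule below_tri_iff[OF y1(2)]) (use y1(3) True 3 in auto)
      moreover have "0 \<le> zc x t (jp 0 t (x - y1)) \<theta>" using extD(3)[OF y1(2), of \<theta>] True by auto
      ultimately show ?thesis unfolding D tri_def using True by auto
    next
      case False
      then show ?thesis unfolding D tri_def using assms by auto
    qed
  next
    case 4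
    have b: "mB x t = V x t" using minA_or_minB[OF 4(1) assms(2)] minB_ge[OF assms] 4(2) by auto
    note s1 = tau_low_min[OF assms b 4(2), folded s1_def]
    note s2 = tau_up_max[OF 4(1) assms(2) b, folded s2_def]
    have st: "s1 < t" "ext (jp s1 t x) s1 x t" using s1(1) 4 by auto
    have s0: "0 \<le> s1" using extD(1)[OF st(2)] .
    have D: "(\<xi>, \<theta>) \<in> char_triangle f \<alpha> u0 ub x t \<longleftrightarrow> s1 \<le> \<theta> \<and> \<theta> \<le> t \<and>
        (if \<theta> \<le> s2 then 0 else curveB f \<alpha> x t s2 \<theta>) \<le> \<xi> \<and> \<xi> \<le> zc x t (jp s1 t x) \<theta>"
      unfolding mem using 4 curveB_eq[of s1 t \<theta> x] st s0 by auto
    have above: "above_tri x t \<xi> \<theta> \<longleftrightarrow> s1 \<le> \<theta> \<and> \<xi> \<le> zc x t (jp s1 t x) \<theta>" if "0 \<le> \<theta>" "\<theta> < t"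
      by (rule above_tri_iff[OF st(2)]) (use s1(2) that in auto)
    have below: "below_tri x t \<xi> \<theta> \<longleftrightarrow> \<theta> < s2 \<or> zc x t (jp s2 t x) \<theta> \<le> \<xi>" if "0 \<le> \<theta>" "\<theta> < t"
      by (rule below_tri_iff[OF s2(1)]) (use s2(5) that 4 in auto)
    note lb = left_boundary_nonneg[OF s2(1,3,2), of \<theta>] left_boundary_iff[OF s2(1,3,2,4), of \<theta> \<xi>]
    show ?thesis
    proof (cases "0 \<le> \<theta> \<and> \<theta> < t")
      case True
      show ?thesis
      proof (cases "0 \<le> \<xi>")
        case \<xi>: True
        then show ?thesis unfolding D tri_def using above below lb(2) True by (simp add: conj_ac)
      next
        case False
        then show ?thesis unfolding D tri_def using lb(1) True by auto
      qed
    next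
      case False
      then show ?thesis unfolding D tri_def using assms s0 st s2 curveB_eq[of s2 t t x] by auto
    qed
  next
    case 5
    have b: "mB x t = V x t" "mA x t = V x t" using minA_or_minB[OF 5(1) assms(2)] 5(2) by auto
    note s2 = tau_up_max[OF 5(1) assms(2) b(1), folded s2_def]
    note y2 = y_up_min[OF assms b(2), folded y2_def]
    have D: "(\<xi>, \<theta>) \<in> char_triangle f \<alpha> u0 ub x t \<longleftrightarrow> 0 \<le> \<theta> \<and> \<theta> \<le> t \<and>
        (if \<theta> \<le> s2 then 0 else curveB f \<alpha> x t s2 \<theta>) \<le> \<xi> \<and> \<xi> \<le> zc x t (jp 0 t (x - y2)) \<theta>"
      unfolding mem using 5 curveA_eq[of t \<theta> x y2] assms by auto
    have above: "above_tri x t \<xi> \<theta> \<longleftrightarrow> 0 \<le> \<theta> \<and> \<xi> \<le> zc x t (jp 0 t (x - y2)) \<theta>" if "0 \<le> \<theta>" "\<theta> < t"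
      by (rule above_tri_iff[OF y2(1)]) (use y2(2) extD(1) that in auto)
    have below: "below_tri x t \<xi> \<theta> \<longleftrightarrow> \<theta> < s2 \<or> zc x t (jp s2 t x) \<theta> \<le> \<xi>" if "0 \<le> \<theta>" "\<theta> < t"
      by (rule below_tri_iff[OF s2(1)]) (use s2(5) that 5 in auto)
    note lb = left_boundary_nonneg[OF s2(1,3,2), of \<theta>] left_boundary_iff[OF s2(1,3,2,4), of \<theta> \<xi>]
    show ?thesis
    proof (cases "0 \<le> \<theta> \<and> \<theta> < t")
      case True
      show ?thesis
      proof (cases "0 \<le> \<xi>")
        case \<xi>: True
        then show ?thesis unfolding D tri_def using above below lb(2) True by (simp add: conj_ac)
      next
        case False
        then show ?thesis unfolding D tri_def using lb(1) True by auto
      qed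
    next
      case False
      then show ?thesis unfolding D tri_def using assms s2 curveB_eq[of s2 t t x] by auto
    qed
  qed
qed

subsection \<open>Ordering of extremal curves\<close>

lemma zc_agree:
  assumes "zc x t c r = zc x' t' c r" "0 \<le> r" "r \<le> b" "b \<le> t" "b \<le> t'"
  shows "zc x t c b = zc x' t' c b"
  using assms zc_forward[of r b t x c] zc_forward[of r b t' x' c] by simp

text \<open>Two curves that change order meet in between, and then their parameters agree, so they
  cannot separate again. The alternative \<open>s\<close> excludes the one exception, a fan of
  curves leaving a common foot at time \<open>a\<close>.\<close>

lemma no_overtake:
  assumes e: "ext c1 \<sigma>1 x t" "ext c2 \<sigma>2 x' t'" and a: "\<sigma>1 \<le> a" "\<sigma>2 \<le> a" "a < b" "b \<le> t" "b \<le> t'"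
    and s: "\<sigma>1 < a \<or> \<sigma>2 < a \<or> zc x t c1 a < zc x' t' c2 a"
    and z: "zc x t c1 a \<le> zc x' t' c2 a" "zc x' t' c2 b < zc x t c1 b"
  shows False
proof -
  have a0: "0 \<le> a" using a extD(1)[OF e(1)] by simp
  obtain r where r: "a \<le> r" "r \<le> b" "zc x t c1 r - zc x' t' c2 r = 0"
    using IVT'[of "\<lambda>\<theta>. zc x t c1 \<theta> - zc x' t' c2 \<theta>" a 0 b] z a a0
      continuous_on_diff[OF continuous_on_subset[OF zc_continuous[of a t x c1], of "{a..b}"]
        continuous_on_subset[OF zc_continuous[of a t' x' c2], of "{a..b}"]] by auto
  have "r \<noteq> b" using r z by auto
  then have rb: "r < b" using r by simp
  have "\<sigma>1 < r \<or> \<sigma>2 < r" using s r a by (cases "r = a") auto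
  then have "c1 = c2"
    using ext_no_cross[OF e(1) _ _ e(2), of r] ext_no_cross[OF e(2) _ _ e(1), of r] r rb a by auto
  then show False using zc_agree[of x t c1 r x' t' b] r a a0 z by auto
qed

text \<open>Having one parameter, the two curves coincide below the common point too, and the foot
  of the second becomes a foot for the endpoint of the first.\<close>

lemma touch_eq:
  assumes e: "ext c1 \<sigma>1 x t" "ext c2 \<sigma>2 x' t'" and r: "\<sigma>1 \<le> r" "r < t" "\<sigma>2 < r" "r \<le> t'" "zc x t c1 r = zc x' t' c2 r"
  shows "c1 = c2" "ext c2 \<sigma>2 x t" "\<And>\<theta>. 0 \<le> \<theta> \<Longrightarrow> \<theta> \<le> r \<Longrightarrow> zc x t c1 \<theta> = zc x' t' c2 \<theta>"
proof -
  show c: "c1 = c2" by (rule ext_no_cross[OF e(1) r(1,2) e(2) r(3-5)])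
  have "ext c2 \<sigma>2 (zc x t c2 r) r" using ext_restart[OF e(2) r(3,4)] r(5) c by simp
  then show "ext c2 \<sigma>2 x t" using ext_join[OF _ _ r(1,2)] e(1) c by blast
  show "zc x t c1 \<theta> = zc x' t' c2 \<theta>" if "0 \<le> \<theta>" "\<theta> \<le> r" for \<theta>
    using zc_restart[of \<theta> r t x c1] zc_restart[of \<theta> r t' x' c2] r that c by auto
qed

lemma ext_start_less: "ext c \<sigma> x t \<Longrightarrow> \<sigma> \<le> \<theta> \<Longrightarrow> 0 < \<theta> \<Longrightarrow> 0 < zc x t c \<theta> \<Longrightarrow> \<sigma> < \<theta>"
  using extD(4)[of c \<sigma> x t] by (cases "\<sigma> = \<theta>") auto

text \<open>Some curve of the left endpoint passes through \<open>(\<xi>,\<theta>)\<close> or to its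
  right, and some curve of the right endpoint passes through it, to its left, or starts later; they
  would have to change order. As \<open>\<xi>\<close> is positive, the former curve starts strictly
  before \<open>\<theta>\<close>, which rules out a fan.\<close>

lemma tri_unique_less:
  assumes tr: "tri x t \<xi> \<theta>" "tri x' t \<xi> \<theta>" and less: "x < x'" and p: "0 \<le> x" "0 < \<xi>" "0 < \<theta>"
  shows False
proof (cases "\<theta> < t")
  case True
  obtain c \<sigma> where c: "ext c \<sigma> x t" "\<sigma> \<le> \<theta>" "\<xi> \<le> zc x t c \<theta>" using tr(1) True by (auto simp: tri_def above_tri_def)
  obtain c' \<sigma>' where c': "ext c' \<sigma>' x' t" "\<theta> < \<sigma>' \<or> zc x' t c' \<theta> \<le> \<xi>"
    using tr(2) True less p by (auto simp: tri_def below_tri_def)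
  show False
  proof (cases "\<theta> < \<sigma>'")
    case th: True
    then have "zc x' t c' \<sigma>' = 0" using extD(4)[OF c'(1)] p by auto
    moreover have "0 \<le> zc x t c \<sigma>'" using extD(3)[OF c(1), of \<sigma>'] c th extD(2)[OF c'(1)] by auto
    ultimately show False
      using no_overtake[OF c'(1) c(1), of \<sigma>' t] c th extD(2)[OF c'(1)] less by auto
  next
    case False
    then show False
      using no_overtake[OF c'(1) c(1), of \<theta> t] c c' True less ext_start_less[OF c(1,2) p(3)] p by auto
  qed
qed (use tr less in \<open>auto simp: tri_def\<close>)

lemma tri_unique:
  assumes "tri x t \<xi> \<theta>" "tri x' t \<xi> \<theta>" "0 \<le> x" "0 \<le> x'" "0 < \<xi>" "0 < \<theta>"
  shows "x = x'"
  using tri_unique_less[of x t \<xi> \<theta> x'] tri_unique_less[of x' t \<xi> \<theta> x] assms by (metis linorder_neqE_linordered_idom)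

text \<open>The common point \<open>(x1,t1)\<close> fixes the order: at time \<open>s\<close> the
  curves of \<open>(x,t)\<close>, or the axis, lie on both sides of \<open>p\<close>. As they cannot
  cross the curves of \<open>(p,s)\<close>, they enclose its whole triangle.\<close>

lemma tri_mono:
  assumes tp: "tri p s x1 t1" and tx: "tri x t x1 t1" and x1: "0 < x1" "0 < t1" and st: "t1 \<le> s" "s \<le> t"
    and nn: "0 \<le> p" "0 \<le> x" and q: "tri p s \<xi> \<theta>"
  shows "tri x t \<xi> \<theta>"
proof (cases "s = t")
  case True
  then show ?thesis using tri_unique[OF tp _ nn x1, of] tx q by simp
next
  case False
  then have s: "s < t" using st by simp
  then have t1t: "t1 < t" using st by simp
  have p_end: "p = x1" if "t1 = s" using tp that by (auto simp: tri_def)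
  have tp': "above_tri p s x1 t1" "below_tri p s x1 t1" if "t1 < s" using tp that by (auto simp: tri_def)
  obtain c \<sigma> where c: "ext c \<sigma> x t" "\<sigma> \<le> t1" "x1 \<le> zc x t c t1"
    using tx t1t by (auto simp: tri_def above_tri_def)
  have \<sigma>t1: "\<sigma> < t1" using ext_start_less[OF c(1,2) x1(2)] c(3) x1 by simp
  have up: "p \<le> zc x t c s"
  proof (rule ccontr)
    assume n: "\<not> ?thesis"
    have "0 \<le> zc x t c s" using extD(3)[OF c(1), of s] c st s by auto
    then have p0: "0 < p" using n by simp
    have t1s: "t1 < s" using p_end c(3) n st by (cases "t1 = s") auto
    obtain c' \<sigma>' where c': "ext c' \<sigma>' p s" "t1 < \<sigma>' \<or> zc p s c' t1 \<le> x1"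
      using tp'(2)[OF t1s] p0 by (auto simp: below_tri_def)
    show False
    proof (cases "t1 < \<sigma>'")
      case True
      then have "zc p s c' \<sigma>' = 0" using extD(4)[OF c'(1)] x1 by auto
      moreover have "0 \<le> zc x t c \<sigma>'" using extD(3)[OF c(1), of \<sigma>'] c True extD(2)[OF c'(1)] s by auto
      ultimately show False
        using no_overtake[OF c'(1) c(1), of \<sigma>' s] c True extD(2)[OF c'(1)] n s by auto
    next
      case False
      then show False using no_overtake[OF c'(1) c(1), of t1 s] c c' \<sigma>t1 t1s n s by auto
    qed
  qed
  have low: "x = 0 \<or> (\<exists>c' \<sigma>'. ext c' \<sigma>' x t \<and> (s < \<sigma>' \<or> zc x t c' s \<le> p))"
  proof (cases "x = 0")
    case False
    then obtain c' \<sigma>' where c': "ext c' \<sigma>' x t" "t1 < \<sigma>' \<or> zc x t c' t1 \<le> x1"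
      using tx t1t by (auto simp: tri_def below_tri_def)
    have "s < \<sigma>' \<or> zc x t c' s \<le> p"
    proof (rule ccontr)
      assume "\<not> ?thesis"
      then have n: "\<sigma>' \<le> s" "p < zc x t c' s" by auto
      have t1s: "t1 < s" using p_end c'(2) n st by (cases "t1 = s") auto
      obtain d \<rho> where d: "ext d \<rho> p s" "\<rho> \<le> t1" "x1 \<le> zc p s d t1"
        using tp'(1)[OF t1s] by (auto simp: above_tri_def)
      have \<rho>: "\<rho> < t1" using ext_start_less[OF d(1,2) x1(2)] d(3) x1 by simp
      show False
      proof (cases "t1 < \<sigma>'")
        case True
        then have z: "zc x t c' \<sigma>' = 0" using extD(4)[OF c'(1)] x1 by auto
        then have "\<sigma>' < s" using n nn by (cases "\<sigma>' = s") auto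
        moreover from this have "0 \<le> zc p s d \<sigma>'" using extD(3)[OF d(1), of \<sigma>'] d True by auto
        ultimately show False
          using no_overtake[OF c'(1) d(1), of \<sigma>' s] d True n s z by auto
      next
        case False
        then show False using no_overtake[OF c'(1) d(1), of t1 s] d c' \<rho> t1s n s by auto
      qed
    qed
    then show ?thesis using c' by blast
  qed simp
  have q0: "0 \<le> \<theta>" "0 \<le> \<xi>" using q by (auto simp: tri_def)
  show ?thesis
  proof (cases "\<theta> = s")
    case True
    then have "\<xi> = p" using q by (auto simp: tri_def)
    then show ?thesis
    proof -
      have "above_tri x t p s"
        unfolding above_tri_def by (rule exI[of _ c], rule exI[of _ \<sigma>]) (use c up st in auto)
      then show ?thesis using True q0 s low \<open>\<xi> = p\<close> by (simp add: tri_def below_tri_def)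
    qed
  next
    case False
    then have \<theta>s: "\<theta> < s" "above_tri p s \<xi> \<theta>" "below_tri p s \<xi> \<theta>" using q by (auto simp: tri_def)
    obtain d \<rho> where d: "ext d \<rho> p s" "\<rho> \<le> \<theta>" "\<xi> \<le> zc p s d \<theta>" using \<theta>s(2) by (auto simp: above_tri_def)
    have above: "above_tri x t \<xi> \<theta>"
    proof (cases "p = zc x t c s")
      case True
      \<comment> \<open>A curve through \<open>(p,s)\<close> itself coincides below \<open>s\<close>
        with the witness \<open>d\<close> and takes over its foot.\<close>
      then have z: "zc x t c s = zc p s d s" by simp
      note te = touch_eq[OF c(1) d(1) _ s extD(2)[OF d(1)] order_refl z]
      show ?thesis using te d q0 \<theta>s c st unfolding above_tri_def by (intro exI[of _ d] exI[of _ \<rho>]) auto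
    next
      case ne: False
      then have pz: "p < zc x t c s" using up by simp
      \<comment> \<open>Starting later than \<open>d\<close>, the curve would start on the axis, not
        to the right of \<open>d\<close>, and yet overtake it by time \<open>s\<close>.\<close>
      have \<sigma>\<rho>: "\<sigma> \<le> \<rho>"
      proof (rule ccontr)
        assume n: "\<not> ?thesis"
        then have "zc x t c \<sigma> = 0" using extD(4)[OF c(1)] extD(1)[OF d(1)] by auto
        moreover have "\<sigma> < s" using \<sigma>t1 st by simp
        moreover have "0 \<le> zc p s d \<sigma>" using extD(3)[OF d(1), of \<sigma>] n \<open>\<sigma> < s\<close> by auto
        ultimately show False using no_overtake[OF c(1) d(1), of \<sigma> s] n pz s by auto
      qed
      have "zc p s d \<theta> \<le> zc x t c \<theta>"
      proof (rule ccontr)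
        assume "\<not> ?thesis"
        then show False using no_overtake[OF c(1) d(1), of \<theta> s] \<sigma>\<rho> d \<theta>s pz s by auto
      qed
      then show ?thesis using c d \<sigma>\<rho> unfolding above_tri_def by (intro exI[of _ c] exI[of _ \<sigma>]) auto
    qed
    have below: "below_tri x t \<xi> \<theta>"
    proof (cases "x = 0")
      case x: False
      then obtain c' \<sigma>' where c': "ext c' \<sigma>' x t" "s < \<sigma>' \<or> zc x t c' s \<le> p" using low by blast
      show ?thesis
      proof (cases "\<theta> < \<sigma>'")
        case True
        then show ?thesis using c' by (auto simp: below_tri_def)
      next
        case False
        then have \<sigma>': "\<sigma>' \<le> \<theta>" "\<sigma>' \<le> s" "zc x t c' s \<le> p" using \<theta>s c' by auto
        show ?thesis
        proof (cases "p = 0")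
          case True
          \<comment> \<open>The curve touches the axis at time \<open>s\<close>, which may be taken
            as its foot; it then counts as starting after \<open>\<theta>\<close>.\<close>
          then have "zc x t c' s = 0" using \<sigma>' extD(3)[OF c'(1), of s] s by auto
          then have "ext c' s x t" using ext_refoot[OF c'(1) \<sigma>'(2) s] by simp
          then show ?thesis using \<theta>s by (auto simp: below_tri_def)
        next
          case p: False
          then obtain d \<rho> where d: "ext d \<rho> p s" "\<theta> < \<rho> \<or> zc p s d \<theta> \<le> \<xi>" using \<theta>s(3) by (auto simp: below_tri_def)
          show ?thesis
          proof (cases "zc x t c' s = p")
            case True
            then have z: "zc x t c' s = zc p s d s" by simp
            note te = touch_eq[OF c'(1) d(1) \<sigma>'(2) s extD(2)[OF d(1)] order_refl z]
            have "ext d \<rho> x t \<and> (\<theta> < \<rho> \<or> zc x t d \<theta> \<le> \<xi>)"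
              using te(1,2) te(3)[of \<theta>] d(2) q0(1) \<theta>s(1) by auto
            then show ?thesis unfolding below_tri_def by blast
          next
            case ne: False
            then have pz: "zc x t c' s < p" using \<sigma>' by simp
            have \<rho>: "\<rho> \<le> \<theta>"
            proof (rule ccontr)
              assume n: "\<not> ?thesis"
              then have "zc p s d \<rho> = 0" using extD(4)[OF d(1)] q0 by auto
              moreover have "0 \<le> zc x t c' \<rho>" using extD(3)[OF c'(1), of \<rho>] n \<sigma>' extD(2)[OF d(1)] s by auto
              ultimately show False
                using no_overtake[OF d(1) c'(1), of \<rho> s] n pz s \<sigma>' extD(2)[OF d(1)] by auto
            qed
            have "zc x t c' \<theta> \<le> zc p s d \<theta>"
            proof (rule ccontr)
              assume "\<not> ?thesis"
              then show False using no_overtake[OF d(1) c'(1), of \<theta> s] \<rho> \<sigma>' \<theta>s pz s by auto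
            qed
            then show ?thesis using c' d \<rho> unfolding below_tri_def by (intro disjI2 exI[of _ c'] exI[of _ \<sigma>']) auto
          qed
        qed
      qed
    qed (simp add: below_tri_def)
    show ?thesis using above below q0 \<theta>s s by (simp add: tri_def)
  qed
qed

section \<open>Existence of an endpoint whose triangle contains a given point\<close>

lemma zc_tendsto:
  assumes "xn \<longlonglongrightarrow> x" "tn \<longlonglongrightarrow> t" "cn \<longlonglongrightarrow> c" "\<theta>n \<longlonglongrightarrow> \<theta>" "\<And>n::nat. 0 \<le> \<theta>n n" "\<And>n. \<theta>n n \<le> tn n"
  shows "(\<lambda>n. zc (xn n) (tn n) (cn n) (\<theta>n n)) \<longlonglongrightarrow> zc x t c \<theta>"
  unfolding zc_def
proof (intro tendsto_diff F_tendsto(1) assms)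
  show "0 \<le> \<theta>" by (rule LIMSEQ_le_const[OF assms(4)]) (use assms(5) in auto)
  show "\<theta> \<le> t" by (rule LIMSEQ_le[OF assms(4,2)]) (use assms(6) in auto)
qed (use assms in auto)

lemma tri_exists:
  assumes x1: "0 < x1" "0 < t1" "t1 \<le> t"
  shows "\<exists>x\<ge>0. tri x t x1 t1"
proof (cases "t1 = t")
  case True
  then show ?thesis using x1 by (auto simp: tri_def)
next
  case False
  then have t1t: "t1 < t" using x1 by simp
  define S where "S = {x. 0 \<le> x \<and> above_tri x t x1 t1}"
  define S' where "S' = {x. 0 \<le> x \<and> below_tri x t x1 t1}"
  have "closed S"
    unfolding closed_sequential_limits
  proof (intro allI impI, elim conjE)
    fix xn x assume xn: "\<forall>n. xn n \<in> S" "xn \<longlonglongrightarrow> x"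
    then obtain cn \<sigma>n where c: "\<And>n. ext (cn n) (\<sigma>n n) (xn n) t" "\<And>n. \<sigma>n n \<le> t1" "\<And>n. x1 \<le> zc (xn n) t (cn n) t1"
      unfolding S_def above_tri_def mem_Collect_eq by metis
    obtain r c \<sigma> where r: "strict_mono (r :: nat \<Rightarrow> nat)" "(\<lambda>n. cn (r n)) \<longlonglongrightarrow> c" "(\<lambda>n. \<sigma>n (r n)) \<longlonglongrightarrow> \<sigma>" "ext c \<sigma> x t"
      by (rule ext_compact[where xn = xn and tn = "\<lambda>_. t" and cn = cn and \<sigma>n = \<sigma>n and \<delta> = "t - t1", OF xn(2) tendsto_const c(1)])
        (use c(2) t1t that in auto)
    have "\<sigma> \<le> t1" by (rule LIMSEQ_le_const2[OF r(3)]) (use c(2) in auto)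
    moreover have "(\<lambda>n. zc (xn (r n)) t (cn (r n)) t1) \<longlonglongrightarrow> zc x t c t1"
      using LIMSEQ_subseq_LIMSEQ[OF xn(2) r(1)] x1 r(2) by (intro zc_tendsto) (auto simp: o_def)
    then have "x1 \<le> zc x t c t1" by (rule LIMSEQ_le_const) (use c(3) in auto)
    ultimately show "x \<in> S" using r(4) extD(5)[OF r(4)] by (auto simp: S_def above_tri_def)
  qed
  \<comment> \<open>A curve starting after \<open>t1\<close> has its foot on the axis, left of
    \<open>x1\<close>. Evaluation at the later of the two times merges the alternative into one
    closed condition.\<close>
  have key: "(t1 < \<sigma> \<or> zc x t c t1 \<le> x1) \<longleftrightarrow> zc x t c (max t1 \<sigma>) \<le> x1" if "ext c \<sigma> x t" for c \<sigma> x
    using extD(4)[OF that] x1 by (cases "t1 = \<sigma>") (auto simp: max_def)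
  have "closed S'"
    unfolding closed_sequential_limits
  proof (intro allI impI, elim conjE)
    fix xn x assume xn: "\<forall>n. xn n \<in> S'" "xn \<longlonglongrightarrow> x"
    have x0: "0 \<le> x" by (rule LIMSEQ_le_const[OF xn(2)]) (use xn(1) in \<open>auto simp: S'_def\<close>)
    show "x \<in> S'"
    proof (cases "x = 0")
      case False
      then have xp: "0 < x" using x0 by simp
      \<comment> \<open>The uniform gap below the endpoints is available only away from the
        axis.\<close>
      have "\<forall>\<^sub>F n in sequentially. x / 2 < xn n" using xn(2) xp by (intro order_tendstoD) auto
      then obtain N where N: "\<And>n. N \<le> n \<Longrightarrow> x / 2 < xn n" by (auto simp: eventually_sequentially)
      define yn where "yn = (\<lambda>n. xn (n + N))"
      have y: "yn \<longlonglongrightarrow> x" "\<And>n. x / 2 \<le> yn n" "\<And>n. yn n \<in> S'"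
        unfolding yn_def using LIMSEQ_ignore_initial_segment[OF xn(2)] N xn(1) by (auto intro: less_imp_le)
      have "\<forall>n. \<exists>c \<sigma>. ext c \<sigma> (yn n) t \<and> zc (yn n) t c (max t1 \<sigma>) \<le> x1"
      proof
        fix n
        have "yn n \<noteq> 0" using y(2)[of n] xp by auto
        then obtain c \<sigma> where "ext c \<sigma> (yn n) t" "t1 < \<sigma> \<or> zc (yn n) t c t1 \<le> x1"
          using y(3)[of n] by (auto simp: S'_def below_tri_def)
        then show "\<exists>c \<sigma>. ext c \<sigma> (yn n) t \<and> zc (yn n) t c (max t1 \<sigma>) \<le> x1" using key by blast
      qed
      then obtain cn \<sigma>n where c: "\<And>n. ext (cn n) (\<sigma>n n) (yn n) t" "\<And>n. zc (yn n) t (cn n) (max t1 (\<sigma>n n)) \<le> x1" by metis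
      obtain \<delta> where \<delta>: "0 < \<delta>" "\<And>c \<sigma> x' t'. ext c \<sigma> x' t' \<Longrightarrow> x / 2 \<le> x' \<Longrightarrow> t \<le> t' \<Longrightarrow> t' \<le> t \<Longrightarrow> \<sigma> \<le> t' - \<delta>"
        by (rule ext_gap[of "x / 2" t t]) (use xp t1t x1 that in auto)
      obtain r c \<sigma> where r: "strict_mono (r :: nat \<Rightarrow> nat)" "(\<lambda>n. cn (r n)) \<longlonglongrightarrow> c" "(\<lambda>n. \<sigma>n (r n)) \<longlonglongrightarrow> \<sigma>" "ext c \<sigma> x t"
        by (rule ext_compact[where xn = yn and tn = "\<lambda>_. t" and cn = cn and \<sigma>n = \<sigma>n and \<delta> = \<delta>, OF y(1) tendsto_const c(1) \<delta>(1)])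
          (use \<delta>(2)[OF c(1)] y(2) that in auto)
      have "(\<lambda>n. zc (yn (r n)) t (cn (r n)) (max t1 (\<sigma>n (r n)))) \<longlonglongrightarrow> zc x t c (max t1 \<sigma>)"
        using LIMSEQ_subseq_LIMSEQ[OF y(1) r(1)] x1 r(2,3) t1t extD(2)[OF c(1)]
        by (intro zc_tendsto tendsto_max) (auto simp: o_def intro: less_imp_le)
      then have "zc x t c (max t1 \<sigma>) \<le> x1" by (rule LIMSEQ_le_const2) (use c(2) in auto)
      then show ?thesis using key[OF r(4)] r(4) x0 by (auto simp: S'_def below_tri_def)
    qed (simp add: S'_def below_tri_def)
  qed
  have cover: "{0..} \<subseteq> S \<union> S'"
  proof
    fix x :: real assume "x \<in> {0..}"
    then have x: "0 \<le> x" by simp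
    show "x \<in> S \<union> S'"
    proof (cases "x = 0")
      case False
      then obtain c \<sigma> where e: "ext c \<sigma> x t" using ext_exists[of x t] x t1t x1 by auto
      show ?thesis
      proof (cases "t1 < \<sigma> \<or> zc x t c t1 \<le> x1")
        case True
        then show ?thesis using e x by (auto simp: S'_def below_tri_def)
      next
        case False
        have "above_tri x t x1 t1"
          unfolding above_tri_def by (rule exI[of _ c], rule exI[of _ \<sigma>]) (use e False in auto)
        then show ?thesis using x by (simp add: S_def)
      qed
    qed (simp add: S'_def below_tri_def)
  qed
  obtain B where B: "0 \<le> B" "\<And>c \<sigma> x t' a b. ext c \<sigma> x t' \<Longrightarrow> t' \<le> t \<Longrightarrow> 0 \<le> a \<Longrightarrow> a \<le> b \<Longrightarrow> b \<le> t \<Longrightarrow> \<bar>F a b c\<bar> \<le> B * (b - a)"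
    using ext_speed_bound[of t] by metis
  \<comment> \<open>So far to the right that at speed at most \<open>B\<close> a curve traced back
    from there stays right of \<open>x1\<close> for the whole time \<open>t\<close>.\<close>
  define xl where "xl = x1 + B * t"
  have xl: "0 < xl" using x1 B by (auto simp: xl_def intro: add_pos_nonneg)
  obtain c \<sigma> where e: "ext c \<sigma> xl t" using ext_exists[of xl t] xl t1t x1 by auto
  have zl: "x1 \<le> zc xl t c \<theta>" if "0 \<le> \<theta>" "\<theta> \<le> t" for \<theta>
  proof -
    have "F \<theta> t c \<le> B * (t - \<theta>)" using B(2)[OF e order_refl, of \<theta> t] that by auto
    also have "\<dots> \<le> B * t" using B(1) that by (intro mult_left_mono) auto
    finally show ?thesis by (simp add: zc_def xl_def)
  qed
  have "\<sigma> = 0" using extD(4)[OF e] zl[of \<sigma>] extD(1,2)[OF e] x1 by auto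
  have "above_tri xl t x1 t1"
    unfolding above_tri_def by (rule exI[of _ c], rule exI[of _ \<sigma>]) (use e \<open>\<sigma> = 0\<close> zl[of t1] x1 t1t in auto)
  then have "xl \<in> S" using xl by (simp add: S_def)
  moreover have "0 \<in> S'" by (simp add: S'_def below_tri_def)
  moreover have "connected {0::real..}" by (intro convex_connected) simp
  ultimately have "S \<inter> S' \<inter> {0..} \<noteq> {}"
    using \<open>closed S\<close> \<open>closed S'\<close> cover xl unfolding connected_closed by (metis atLeast_iff disjoint_iff less_imp_le order_refl)
  then obtain x where "x \<in> S" "x \<in> S'" by blast
  then show ?thesis using x1 t1t by (auto simp: S_def S'_def tri_def)
qed

end

lemma diff_divide_diff_flip:
  fixes a b c d :: real
  shows "(a - b) / (c - d) = (b - a) / (d - c)"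
  by (metis minus_diff_eq minus_divide_divide)

lemma LIMSEQ_subseq_criterion:
  fixes u :: "nat \<Rightarrow> real"
  assumes "\<And>r :: nat \<Rightarrow> nat. strict_mono r \<Longrightarrow> \<exists>s. strict_mono (s :: nat \<Rightarrow> nat) \<and> (\<lambda>n. u (r (s n))) \<longlonglongrightarrow> l"
  shows "u \<longlonglongrightarrow> l"
proof (rule ccontr)
  assume "\<not> ?thesis"
  then obtain e where e: "0 < e" "\<And>N. \<exists>n\<ge>N. e \<le> dist (u n) l"
    by (auto simp: lim_sequentially not_less)
  have "infinite {n. e \<le> dist (u n) l}"
    unfolding infinite_nat_iff_unbounded_le using e(2) by auto
  then obtain r :: "nat \<Rightarrow> nat" where r: "strict_mono r" "\<And>n. r n \<in> {n. e \<le> dist (u n) l}"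
    using infinite_enumerate by blast
  obtain s where s: "strict_mono (s :: nat \<Rightarrow> nat)" "(\<lambda>n. u (r (s n))) \<longlonglongrightarrow> l"
    using assms[OF r(1)] by blast
  have "\<forall>\<^sub>F n in sequentially. dist (u (r (s n))) l < e" using s(2) e(1) by (rule tendstoD)
  then obtain n where "dist (u (r (s n))) l < e" by (auto simp: eventually_sequentially)
  then show False using r(2)[of "s n"] by simp
qed

context halfline
begin

subsection \<open>The speed of the curve\<close>

text \<open>By the mean value theorem each average is the integrand at an intermediate time; joint
  continuity allows the parameter to vary along with it.\<close>

lemma mean_flux_tendsto:
  assumes lim: "cn \<longlonglongrightarrow> c" "an \<longlonglongrightarrow> t0" "bn \<longlonglongrightarrow> t0" and ab: "\<And>n::nat. t0 \<le> an n" "\<And>n. an n < bn n" and t0: "0 \<le> t0"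
  shows "(\<lambda>n. F (an n) (bn n) (cn n) / (bn n - an n)) \<longlonglongrightarrow> spd c t0"
    "(\<lambda>n. G (an n) (bn n) (cn n) / (bn n - an n)) \<longlonglongrightarrow> flx c t0"
proof -
  have *: "(\<lambda>n. integral {an n..bn n} (\<psi> (cn n)) / (bn n - an n)) \<longlonglongrightarrow> \<psi> c t0"
    if \<psi>: "continuous_on (UNIV \<times> {0..}) (\<lambda>(c, \<theta>). \<psi> c \<theta>)" "\<And>s t k. 0 \<le> s \<Longrightarrow> continuous_on {s..t} (\<psi> k)" for \<psi> :: "real \<Rightarrow> real \<Rightarrow> real"
  proof -
    have "\<exists>z\<in>{an n<..<bn n}. integral {an n..bn n} (\<psi> (cn n)) = \<psi> (cn n) z * (bn n - an n)" for n
    proof -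
      have a0: "0 \<le> an n" using ab(1)[of n] t0 by simp
      have "((\<lambda>r. integral {an n..r} (\<psi> (cn n))) has_derivative (*) (\<psi> (cn n) x)) (at x within {an n..bn n})" if "x \<in> {an n..bn n}" for x
        using integral_has_real_derivative[OF \<psi>(2)[OF a0] that] by (simp add: has_field_derivative_def)
      from mvt_simple[OF ab(2) this] show ?thesis by auto
    qed
    then obtain z where z: "\<And>n. z n \<in> {an n<..<bn n}" "\<And>n. integral {an n..bn n} (\<psi> (cn n)) = \<psi> (cn n) (z n) * (bn n - an n)"
      by metis
    have zl: "z \<longlonglongrightarrow> t0"
      by (rule tendsto_sandwich[OF _ _ lim(2,3)]) (use z(1) in \<open>auto intro!: always_eventually less_imp_le\<close>)
    have "(\<lambda>n. (\<lambda>(c, \<theta>). \<psi> c \<theta>) (cn n, z n)) \<longlonglongrightarrow> (\<lambda>(c, \<theta>). \<psi> c \<theta>) (c, t0)"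
    proof (rule continuous_on_tendsto_compose[OF \<psi>(1) tendsto_Pair[OF lim(1) zl]])
      have "0 \<le> z n" for n using z(1)[of n] ab(1)[of n] t0 by auto
      then show "\<forall>\<^sub>F n in sequentially. (cn n, z n) \<in> UNIV \<times> {0..}" by simp
    qed (use t0 in auto)
    moreover have "integral {an n..bn n} (\<psi> (cn n)) / (bn n - an n) = \<psi> (cn n) (z n)" for n
      using z(2)[of n] ab(2)[of n] by simp
    ultimately show ?thesis by simp
  qed
  show "(\<lambda>n. F (an n) (bn n) (cn n) / (bn n - an n)) \<longlonglongrightarrow> spd c t0"
    unfolding F_def by (rule *[OF spd_flx_joint_continuous(1) spd_flx_continuous(1)])
  show "(\<lambda>n. G (an n) (bn n) (cn n) / (bn n - an n)) \<longlonglongrightarrow> flx c t0"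
    unfolding G_def by (rule *[OF spd_flx_joint_continuous(2) spd_flx_continuous(2)])
qed

text \<open>Strict monotonicity in the parameter inverts the convergence of displacements: a
  parameter staying away from \<open>k0\<close> would shift the displacement by a definite
  amount.\<close>

lemma param_tendsto:
  assumes "(\<lambda>n. F s (bn n) (kn n)) \<longlonglongrightarrow> F s t0 k0" "bn \<longlonglongrightarrow> t0" "0 \<le> s" "s < t0" "\<And>n::nat. t0 \<le> bn n"
  shows "kn \<longlonglongrightarrow> k0"
proof -
  have l: "(\<lambda>n. F s (bn n) k) \<longlonglongrightarrow> F s t0 k" for k
  proof (rule F_tendsto(1)[OF tendsto_const tendsto_const assms(2)])
    have "0 \<le> s \<and> s \<le> bn n" for n using assms(3,4) assms(5)[of n] by auto
    then show "\<forall>\<^sub>F n in sequentially. 0 \<le> s \<and> s \<le> bn n" by simp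
  qed (use assms in auto)
  have sb: "s < bn n" for n using assms(4) assms(5)[of n] by simp
  show ?thesis
  proof (rule order_tendstoI)
    fix a assume "a < k0"
    then have "F s t0 a < F s t0 k0" using F_strict assms by auto
    then have "\<forall>\<^sub>F n in sequentially. 0 < F s (bn n) (kn n) - F s (bn n) a"
      by (intro order_tendstoD(1)[OF tendsto_diff[OF assms(1) l]]) simp
    then show "\<forall>\<^sub>F n in sequentially. a < kn n"
      by eventually_elim (use F_less_iff[OF assms(3) sb] in auto)
  next
    fix a assume "k0 < a"
    then have "F s t0 k0 < F s t0 a" using F_strict assms by auto
    then have "\<forall>\<^sub>F n in sequentially. 0 < F s (bn n) a - F s (bn n) (kn n)"
      by (intro order_tendstoD(1)[OF tendsto_diff[OF l assms(1)]]) simp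
    then show "\<forall>\<^sub>F n in sequentially. kn n < a"
      by eventually_elim (use F_less_iff[OF assms(3) sb] in auto)
  qed
qed

text \<open>Joining a point of an extremal curve of \<open>(X t, t)\<close> to \<open>(X u, u)\<close> by an \<open>h\<close>-curve bounds
  the increment of the value function by the affine function that the parameter of that curve defines.\<close>

lemma increment_bound:
  assumes lim: "tn \<longlonglongrightarrow> t0" "un \<longlonglongrightarrow> t0" "\<And>n::nat. t0 \<le> tn n" "\<And>n. t0 \<le> un n"
    and X: "(\<lambda>n. X (tn n)) \<longlonglongrightarrow> x0" "(\<lambda>n. X (un n)) \<longlonglongrightarrow> x0" and pos: "0 < x0"
    and e: "\<And>n. ext (cn n) (\<sigma>n n) (X (tn n)) (tn n)" "cn \<longlonglongrightarrow> k0"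
    and gap: "\<And>n. \<sigma>n n \<le> \<theta>1" "0 \<le> \<theta>1" "\<theta>1 < t0"
  obtains s kn where "0 \<le> s" "s < t0" "kn \<longlonglongrightarrow> k0"
    "\<forall>\<^sub>F n in sequentially. V (X (un n)) (un n) - V (X (tn n)) (tn n) \<le> kn n * (X (un n) - X (tn n)) - (G s (un n) (kn n) - G s (tn n) (kn n))"
proof -
  obtain S where S: "0 \<le> S" "\<And>c \<theta>. \<bar>c\<bar> \<le> \<bar>k0\<bar> + 1 \<Longrightarrow> \<theta> \<in> {0..t0 + 1} \<Longrightarrow> \<bar>spd c \<theta>\<bar> \<le> S \<and> \<bar>flx c \<theta>\<bar> \<le> S"
    using spd_bound[of "\<bar>k0\<bar> + 1" "t0 + 1"] by metis
  \<comment> \<open>So close to \<open>t0\<close> that at speed at most \<open>S\<close> the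
    connecting curve cannot get from near \<open>x0\<close> down to the axis.\<close>
  define s where "s = max \<theta>1 (t0 - x0 / (2 * (S + 1)))"
  have s: "0 \<le> s" "\<theta>1 \<le> s" "s < t0" using gap pos S(1) by (auto simp: s_def)
  have Ss: "S * (t0 - s) < x0"
  proof -
    have "S * (t0 - s) \<le> (S + 1) * (x0 / (2 * (S + 1)))"
      using S(1) pos s by (intro mult_mono) (auto simp: s_def)
    also have "\<dots> = x0 / 2" using S(1) by (simp add: field_simps)
    finally show ?thesis using pos by simp
  qed
  define \<zeta> where "\<zeta> = (\<lambda>n. zc (X (tn n)) (tn n) (cn n) s)"
  define kn where "kn = (\<lambda>n. jp s (un n) (X (un n) - \<zeta> n))"
  have su: "s < un n" "s < tn n" for n using s(3) lim(3,4)[of n] by auto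
  have Fk: "F s (un n) (kn n) = X (un n) - \<zeta> n" for n using s(1) su[of n] by (simp add: kn_def)
  have "\<zeta> \<longlonglongrightarrow> zc x0 t0 k0 s"
    unfolding \<zeta>_def using s(1) su by (intro zc_tendsto X lim e tendsto_const) (auto intro: less_imp_le)
  then have "(\<lambda>n. F s (un n) (kn n)) \<longlonglongrightarrow> x0 - zc x0 t0 k0 s"
    unfolding Fk by (intro tendsto_diff X)
  then have kl: "kn \<longlonglongrightarrow> k0"
    using param_tendsto[OF _ lim(2) s(1,3) lim(4)] by (simp add: zc_def)
  have "\<forall>\<^sub>F n in sequentially. dist (kn n) k0 < 1" using kl by (rule tendstoD) simp
  moreover have "\<forall>\<^sub>F n in sequentially. un n < t0 + 1" using lim(2) by (rule order_tendstoD) simp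
  moreover have "\<forall>\<^sub>F n in sequentially. 0 < X (un n) - S * (un n - s)"
    by (rule order_tendstoD(1)[OF tendsto_diff[OF X(2) tendsto_mult[OF tendsto_const tendsto_diff[OF lim(2) tendsto_const]]]]) (use Ss in simp)
  ultimately have "\<forall>\<^sub>F n in sequentially. V (X (un n)) (un n) - V (X (tn n)) (tn n) \<le> kn n * (X (un n) - X (tn n)) - (G s (un n) (kn n) - G s (tn n) (kn n))"
  proof eventually_elim
    case (elim n)
    have kb: "\<bar>kn n\<bar> \<le> \<bar>k0\<bar> + 1" using elim(1) by (simp add: dist_real_def)
    have zs: "zc (X (un n)) (un n) (kn n) s = \<zeta> n" by (simp add: zc_def Fk)
    have nn: "0 \<le> zc (X (un n)) (un n) (kn n) \<theta>" if "\<theta> \<in> {s..un n}" for \<theta>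
    proof -
      have "F \<theta> (un n) (kn n) \<le> S * (un n - \<theta>)"
        using F_G_bound(1)[of "t0 + 1" "kn n" S \<theta> "un n"] S(2)[OF kb] that s elim(2) by auto
      also have "\<dots> \<le> S * (un n - s)" using that S(1) by (intro mult_left_mono) auto
      finally show ?thesis using elim(3) by (simp add: zc_def)
    qed
    have "V (X (un n)) (un n) \<le> V (\<zeta> n) s + cost s (un n) (kn n)"
      using W_zc[of s "un n" "X (un n)" "kn n"] nn s su[of n] zs by auto
    moreover have "V (X (tn n)) (tn n) = V (\<zeta> n) s + cost s (tn n) (cn n)"
      using opt_sub(1)[OF ext_opt[OF e(1)], of n s] gap(1)[of n] s su[of n] by (auto simp: opt_def val_def \<zeta>_def)
    moreover have "kn n * F s (tn n) (cn n) - G s (tn n) (kn n) \<le> cost s (tn n) (cn n)"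
      using s su[of n] by (intro cost_ge) auto
    moreover have "F s (tn n) (cn n) = X (tn n) - \<zeta> n" by (simp add: \<zeta>_def zc_def)
    moreover have "cost s (un n) (kn n) = kn n * (X (un n) - \<zeta> n) - G s (un n) (kn n)" by (simp add: cost_def Fk)
    ultimately show ?case by (simp add: algebra_simps)
  qed
  then show ?thesis using that s kl by blast
qed

text \<open>Comparing two expansions of \<open>V\<close> determines the quotient only if the
  outermost parameters differ. If they agree, the quotient is squeezed between the mean speeds of
  extremal curves whose parameters share one limit.\<close>

lemma speed_pair_limit:
  assumes t0: "0 < t0" and x0: "0 < X t0"
    and Xnn: "\<And>t. t0 \<le> t \<Longrightarrow> 0 \<le> X t" and lip: "L-lipschitz_on {t0..t0 + 1} X"
    and mono: "\<And>s t \<xi> \<theta>. t0 \<le> s \<Longrightarrow> s \<le> t \<Longrightarrow> tri (X s) s \<xi> \<theta> \<Longrightarrow> tri (X t) t \<xi> \<theta>"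
    and cm: "ext cm \<sigma>m (X t0) t0" and cM: "ext cM \<sigma>M (X t0) t0"
    and ext: "\<And>c \<sigma>. ext c \<sigma> (X t0) t0 \<Longrightarrow> cm \<le> c \<and> c \<le> cM"
    and lim: "an \<longlonglongrightarrow> t0" "bn \<longlonglongrightarrow> t0" and ab: "\<And>n::nat. t0 \<le> an n" "\<And>n. an n < bn n"
  shows "(\<lambda>n. (X (bn n) - X (an n)) / (bn n - an n)) \<longlonglongrightarrow> shock_speed f (cm * E t0) (cM * E t0)"
proof -
  have L: "0 \<le> L" using lip by (simp add: lipschitz_on_def)
  have Xc: "(\<lambda>n. X (tn n)) \<longlonglongrightarrow> X t0" if "tn \<longlonglongrightarrow> t0" "\<And>n. t0 \<le> tn n" for tn :: "nat \<Rightarrow> real"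
  proof -
    have "\<forall>\<^sub>F n in sequentially. tn n < t0 + 1" using that(1) by (rule order_tendstoD) simp
    then have "\<forall>\<^sub>F n in sequentially. tn n \<in> {t0..t0 + 1}" by eventually_elim (use that(2) in auto)
    then show ?thesis
      by (intro continuous_on_tendsto_compose[OF lipschitz_on_continuous_on[OF lip] that(1)]) auto
  qed
  obtain \<delta> where \<delta>: "0 < \<delta>" "\<And>c \<sigma> x t. ext c \<sigma> x t \<Longrightarrow> X t0 / 2 \<le> x \<Longrightarrow> t0 \<le> t \<Longrightarrow> t \<le> t0 + 1 \<Longrightarrow> \<sigma> \<le> t - \<delta>"
    by (rule ext_gap[of "X t0 / 2" t0 "t0 + 1"]) (use x0 t0 that in auto)
  define \<theta>1 where "\<theta>1 = max 0 (t0 - \<delta> / 2)"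
  have \<theta>1: "0 \<le> \<theta>1" "\<theta>1 < t0" using \<delta>(1) t0 by (auto simp: \<theta>1_def)
  define near where "near = (\<lambda>t. t0 \<le> t \<and> t < t0 + min 1 (\<delta> / 2) \<and> X t0 / 2 < X t)"
  have near_ev: "\<forall>\<^sub>F n in sequentially. near (tn n)" if "tn \<longlonglongrightarrow> t0" "\<And>n. t0 \<le> tn n" for tn :: "nat \<Rightarrow> real"
  proof -
    have "\<forall>\<^sub>F n in sequentially. tn n < t0 + min 1 (\<delta> / 2)" using that(1) \<delta>(1) by (intro order_tendstoD) auto
    moreover have "\<forall>\<^sub>F n in sequentially. X t0 / 2 < X (tn n)" using Xc[OF that] x0 by (intro order_tendstoD) auto
    ultimately show ?thesis by eventually_elim (use that(2) in \<open>auto simp: near_def\<close>)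
  qed
  have foot: "\<sigma> \<le> \<theta>1" "\<sigma> \<le> t - \<delta>" if "ext c \<sigma> (X t) t" "near t" for c \<sigma> t
  proof -
    show "\<sigma> \<le> t - \<delta>" using \<delta>(2)[OF that(1)] that(2) by (auto simp: near_def)
    then show "\<sigma> \<le> \<theta>1" using that(2) by (auto simp: near_def \<theta>1_def)
  qed
  have compact: "\<exists>s c \<sigma>. strict_mono (s :: nat \<Rightarrow> nat) \<and> (\<lambda>n. cn (s n)) \<longlonglongrightarrow> c \<and> ext c \<sigma> (X t0) t0"
    if e: "\<And>n. ext (cn n) (\<sigma>n n) (X (tn n)) (tn n)" and t: "tn \<longlonglongrightarrow> t0" "\<And>n. near (tn n)" for cn \<sigma>n tn
  proof -
    have t': "\<And>n. t0 \<le> tn n" using t(2) by (auto simp: near_def)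
    show ?thesis
      by (rule ext_compact[where xn = "\<lambda>n. X (tn n)" and tn = tn and cn = cn and \<sigma>n = \<sigma>n and \<delta> = \<delta>, OF Xc[OF t(1) t'] t(1) e \<delta>(1)])
        (use foot(2)[OF e t(2)] in blast)+
  qed
  have near0: "near t0" using \<delta>(1) x0 by (auto simp: near_def)
  \<comment> \<open>A time after all feet of nearby curve points and before \<open>t0\<close>: for a
    fixed endpoint the position at \<open>\<theta>0\<close> determines the parameter and can stand
    in for it.\<close>
  define \<theta>0 where "\<theta>0 = (\<theta>1 + t0) / 2"
  have \<theta>0: "\<theta>1 < \<theta>0" "\<theta>0 < t0" "0 < \<theta>0" using \<theta>1 by (auto simp: \<theta>0_def)
  have tri_in: "tri (X t0) t0 (zc (X t0) t0 c \<theta>0) \<theta>0" if e: "ext c \<sigma> (X t0) t0" for c \<sigma>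
  proof -
    have "\<sigma> \<le> \<theta>0" using foot(1)[OF e near0] \<theta>0 by simp
    then have "above_tri (X t0) t0 (zc (X t0) t0 c \<theta>0) \<theta>0" "below_tri (X t0) t0 (zc (X t0) t0 c \<theta>0) \<theta>0"
      using e unfolding above_tri_def below_tri_def by blast+
    moreover have "0 \<le> zc (X t0) t0 c \<theta>0" using extD(3)[OF e, of \<theta>0] \<open>\<sigma> \<le> \<theta>0\<close> \<theta>0 by simp
    ultimately show ?thesis using \<theta>0 by (simp add: tri_def)
  qed
  have zlim: "(\<lambda>n. zc (X (tn n)) (tn n) (cn n) \<theta>0) \<longlonglongrightarrow> zc (X t0) t0 c \<theta>0"
    if "tn \<longlonglongrightarrow> t0" "\<And>n. near (tn n)" "cn \<longlonglongrightarrow> c" for tn cn c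
  proof -
    have t': "t0 \<le> tn n" for n using that(2)[of n] by (simp add: near_def)
    show ?thesis
      using \<theta>0 t' by (intro zc_tendsto Xc that(1,3) tendsto_const) (auto intro: order_trans[OF less_imp_le])
  qed
  \<comment> \<open>As the triangles increase, the point at time \<open>\<theta>0\<close> on the
    rightmost curve of \<open>(X t0, t0)\<close> stays in the triangle of every later point of the
    curve.\<close>
  have upper: "\<exists>c \<sigma>. ext c \<sigma> (X t) t \<and> zc (X t0) t0 cm \<theta>0 \<le> zc (X t) t c \<theta>0" if "near t" for t
    using mono[OF order_refl _ tri_in[OF cm], of t] that \<theta>0 by (auto simp: tri_def above_tri_def near_def)
  have lower: "\<exists>c \<sigma>. ext c \<sigma> (X t) t \<and> zc (X t) t c \<theta>0 \<le> zc (X t0) t0 cM \<theta>0" if n: "near t" for t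
  proof -
    have "below_tri (X t) t (zc (X t0) t0 cM \<theta>0) \<theta>0" "X t \<noteq> 0"
      using mono[OF order_refl _ tri_in[OF cM], of t] n \<theta>0 x0 by (auto simp: tri_def near_def)
    then obtain c \<sigma> where "ext c \<sigma> (X t) t" "\<theta>0 < \<sigma> \<or> zc (X t) t c \<theta>0 \<le> zc (X t0) t0 cM \<theta>0" by (auto simp: below_tri_def)
    then show ?thesis using foot(1)[of c \<sigma> t] n \<theta>0 by force
  qed
  \<comment> \<open>Every subsequence has a further one whose parameters tend to that of an extremal
    curve of \<open>(X t0, t0)\<close>, and the closed set \<open>A\<close> of positions singles out
    \<open>k0\<close> among these.\<close>
  have seq_lim: "cn \<longlonglongrightarrow> k0"
    if c: "\<And>n. ext (cn n) (\<sigma>n n) (X (tn n)) (tn n)" "\<And>n. zc (X (tn n)) (tn n) (cn n) \<theta>0 \<in> A" and A: "closed A"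
      and k0: "\<And>c \<sigma>. ext c \<sigma> (X t0) t0 \<Longrightarrow> zc (X t0) t0 c \<theta>0 \<in> A \<Longrightarrow> c = k0"
      and t: "tn \<longlonglongrightarrow> t0" "\<And>n. near (tn n)" for cn \<sigma>n tn k0 A
  proof (rule LIMSEQ_subseq_criterion)
    fix r :: "nat \<Rightarrow> nat" assume r: "strict_mono r"
    have tr: "(\<lambda>n. tn (r n)) \<longlonglongrightarrow> t0" using LIMSEQ_subseq_LIMSEQ[OF t(1) r] by (simp add: o_def)
    obtain s c' \<sigma> where s: "strict_mono (s :: nat \<Rightarrow> nat)" "(\<lambda>n. cn (r (s n))) \<longlonglongrightarrow> c'" "ext c' \<sigma> (X t0) t0"
      using compact[of "\<lambda>n. cn (r n)" "\<lambda>n. \<sigma>n (r n)" "\<lambda>n. tn (r n)"] c(1) tr t(2) by blast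
    have "(\<lambda>n. tn (r (s n))) \<longlonglongrightarrow> t0" using LIMSEQ_subseq_LIMSEQ[OF tr s(1)] by (simp add: o_def)
    then have "zc (X t0) t0 c' \<theta>0 \<in> A"
      by (intro closed_sequentially[OF A _ zlim[OF _ _ s(2)]]) (use t(2) c(2) in auto)
    then show "\<exists>s. strict_mono (s :: nat \<Rightarrow> nat) \<and> (\<lambda>n. cn (r (s n))) \<longlonglongrightarrow> k0" using s k0 by blast
  qed
  have approx_m: "\<exists>cn \<sigma>n. (\<forall>n. ext (cn n) (\<sigma>n n) (X (tn n)) (tn n)) \<and> cn \<longlonglongrightarrow> cm"
    if t: "tn \<longlonglongrightarrow> t0" "\<And>n. near (tn n)" for tn :: "nat \<Rightarrow> real"
  proof -
    obtain cn \<sigma>n where c: "\<And>n. ext (cn n) (\<sigma>n n) (X (tn n)) (tn n)" "\<And>n. zc (X t0) t0 cm \<theta>0 \<le> zc (X (tn n)) (tn n) (cn n) \<theta>0"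
      using upper[OF t(2)] by metis
    have "cn \<longlonglongrightarrow> cm"
      by (rule seq_lim[OF c(1) _ _ _ t, of "{zc (X t0) t0 cm \<theta>0..}"])
        (use c(2) zc_le_iff[of \<theta>0 t0 "X t0" cm] \<theta>0 ext in \<open>auto intro: antisym\<close>)
    then show ?thesis using c(1) by blast
  qed
  have approx_M: "\<exists>cn \<sigma>n. (\<forall>n. ext (cn n) (\<sigma>n n) (X (tn n)) (tn n)) \<and> cn \<longlonglongrightarrow> cM"
    if t: "tn \<longlonglongrightarrow> t0" "\<And>n. near (tn n)" for tn :: "nat \<Rightarrow> real"
  proof -
    obtain cn \<sigma>n where c: "\<And>n. ext (cn n) (\<sigma>n n) (X (tn n)) (tn n)" "\<And>n. zc (X (tn n)) (tn n) (cn n) \<theta>0 \<le> zc (X t0) t0 cM \<theta>0"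
      using lower[OF t(2)] by metis
    have "cn \<longlonglongrightarrow> cM"
      by (rule seq_lim[OF c(1) _ _ _ t, of "{..zc (X t0) t0 cM \<theta>0}"])
        (use c(2) zc_le_iff[of \<theta>0 t0 "X t0" _ cM] \<theta>0 ext in \<open>auto intro: antisym\<close>)
    then show ?thesis using c(1) by blast
  qed
  have ab': "t0 \<le> bn n" for n using ab[of n] by simp
  obtain N where N: "\<And>n. N \<le> n \<Longrightarrow> near (an n) \<and> near (bn n)"
    using eventually_conj[OF near_ev[OF lim(1) ab(1)] near_ev[OF lim(2) ab']] by (auto simp: eventually_sequentially)
  define a b where "a = (\<lambda>n. an (n + N))" and "b = (\<lambda>n. bn (n + N))"
  have A: "a \<longlonglongrightarrow> t0" "b \<longlonglongrightarrow> t0" "\<And>n. near (a n)" "\<And>n. near (b n)" "\<And>n. a n < b n" "\<And>n. t0 \<le> a n" "\<And>n. t0 \<le> b n"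
    unfolding a_def b_def using LIMSEQ_ignore_initial_segment[OF lim(1)] LIMSEQ_ignore_initial_segment[OF lim(2)] N ab ab' by auto
  define q where "q = (\<lambda>n. (X (b n) - X (a n)) / (b n - a n))"
  have qX: "X (b n) - X (a n) = q n * (b n - a n)" for n using A(5)[of n] by (simp add: q_def)
  have qb: "\<bar>q n\<bar> \<le> L" for n
  proof -
    have "dist (X (b n)) (X (a n)) \<le> L * dist (b n) (a n)"
      using A(3,4)[of n] by (intro lipschitz_onD[OF lip]) (auto simp: near_def)
    then show ?thesis using A(5)[of n] by (simp add: q_def dist_real_def field_simps)
  qed
  define \<omega> where "\<omega> = (\<lambda>n. (V (X (b n)) (b n) - V (X (a n)) (a n)) / (b n - a n))"
  \<comment> \<open>The increment bound is used in both time directions; the errors from replacing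
    \<open>k0\<close> by nearby parameters vanish because \<open>q\<close> is bounded by
    \<open>L\<close>.\<close>
  have key: "(\<lambda>n. \<omega> n - k0 * q n) \<longlonglongrightarrow> - flx k0 t0"
    if ap: "\<And>tn. tn \<longlonglongrightarrow> t0 \<Longrightarrow> (\<And>n. near (tn n)) \<Longrightarrow> \<exists>cn \<sigma>n. (\<forall>n::nat. ext (cn n) (\<sigma>n n) (X (tn n)) (tn n)) \<and> cn \<longlonglongrightarrow> k0" for k0
  proof -
    obtain ca \<sigma>a where ca: "\<And>n. ext (ca n) (\<sigma>a n) (X (a n)) (a n)" "ca \<longlonglongrightarrow> k0" using ap[OF A(1,3)] by blast
    obtain cb \<sigma>b where cb: "\<And>n. ext (cb n) (\<sigma>b n) (X (b n)) (b n)" "cb \<longlonglongrightarrow> k0" using ap[OF A(2,4)] by blast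
    obtain s1 kn where k: "0 \<le> s1" "s1 < t0" "kn \<longlonglongrightarrow> k0"
      "\<forall>\<^sub>F n in sequentially. V (X (b n)) (b n) - V (X (a n)) (a n) \<le> kn n * (X (b n) - X (a n)) - (G s1 (b n) (kn n) - G s1 (a n) (kn n))"
      by (rule increment_bound[where X = X, OF A(1,2,6,7) Xc[OF A(1,6)] Xc[OF A(2,7)] x0 ca foot(1)[OF ca(1) A(3)] \<theta>1])
    obtain s2 ln where l: "0 \<le> s2" "s2 < t0" "ln \<longlonglongrightarrow> k0"
      "\<forall>\<^sub>F n in sequentially. V (X (a n)) (a n) - V (X (b n)) (b n) \<le> ln n * (X (a n) - X (b n)) - (G s2 (a n) (ln n) - G s2 (b n) (ln n))"
      by (rule increment_bound[where X = X, OF A(2,1,7,6) Xc[OF A(2,7)] Xc[OF A(1,6)] x0 cb foot(1)[OF cb(1) A(4)] \<theta>1])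
    have Gab: "G s (b n) k - G s (a n) k = G (a n) (b n) k" if "0 \<le> s" "s < t0" for s n k
      using G_add[of s "a n" "b n" k] that A(5,6)[of n] by auto
    have q0: "(\<lambda>n. (hn n - k0) * q n) \<longlonglongrightarrow> 0" if "hn \<longlonglongrightarrow> k0" for hn
    proof (rule Lim_null_comparison)
      show "\<forall>\<^sub>F n in sequentially. norm ((hn n - k0) * q n) \<le> \<bar>hn n - k0\<bar> * L"
        using qb by (auto simp: abs_mult intro!: always_eventually mult_left_mono)
      have "(\<lambda>n. \<bar>hn n - k0\<bar> * L) \<longlonglongrightarrow> \<bar>k0 - k0\<bar> * L" by (intro tendsto_intros that)
      then show "(\<lambda>n. \<bar>hn n - k0\<bar> * L) \<longlonglongrightarrow> 0" by simp
    qed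
    have bound_lim: "(\<lambda>n. (hn n - k0) * q n - G (a n) (b n) (hn n) / (b n - a n)) \<longlonglongrightarrow> - flx k0 t0" if "hn \<longlonglongrightarrow> k0" for hn
      using tendsto_diff[OF q0[OF that] mean_flux_tendsto(2)[OF that A(1,2,6,5)]] t0 by simp
    show ?thesis
    proof (rule tendsto_sandwich[OF _ _ bound_lim[OF l(3)] bound_lim[OF k(3)]])
      show "\<forall>\<^sub>F n in sequentially. \<omega> n - k0 * q n \<le> (kn n - k0) * q n - G (a n) (b n) (kn n) / (b n - a n)"
        using k(4)
      proof eventually_elim
        case (elim n)
        then have "V (X (b n)) (b n) - V (X (a n)) (a n) \<le> (kn n * q n) * (b n - a n) - G (a n) (b n) (kn n)"
          unfolding Gab[OF k(1,2)] qX by (simp add: mult.assoc)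
        then have "\<omega> n \<le> ((kn n * q n) * (b n - a n) - G (a n) (b n) (kn n)) / (b n - a n)"
          unfolding \<omega>_def using A(5)[of n] by (intro divide_right_mono) auto
        also have "\<dots> = kn n * q n - G (a n) (b n) (kn n) / (b n - a n)" using A(5)[of n] by (simp add: diff_divide_distrib)
        finally show ?case by (simp add: algebra_simps)
      qed
      show "\<forall>\<^sub>F n in sequentially. (ln n - k0) * q n - G (a n) (b n) (ln n) / (b n - a n) \<le> \<omega> n - k0 * q n"
        using l(4)
      proof eventually_elim
        case (elim n)
        have "G s2 (a n) (ln n) - G s2 (b n) (ln n) = - G (a n) (b n) (ln n)" "X (a n) - X (b n) = - (q n * (b n - a n))"
          using Gab[OF l(1,2), of n "ln n"] qX[of n] by auto
        with elim have "(ln n * q n) * (b n - a n) - G (a n) (b n) (ln n) \<le> V (X (b n)) (b n) - V (X (a n)) (a n)"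
          by (simp add: mult.assoc)
        then have "((ln n * q n) * (b n - a n) - G (a n) (b n) (ln n)) / (b n - a n) \<le> \<omega> n"
          unfolding \<omega>_def using A(5)[of n] by (intro divide_right_mono) auto
        moreover have "((ln n * q n) * (b n - a n) - G (a n) (b n) (ln n)) / (b n - a n) = ln n * q n - G (a n) (b n) (ln n) / (b n - a n)"
          using A(5)[of n] by (simp add: diff_divide_distrib)
        ultimately show ?case by (simp add: algebra_simps)
      qed
    qed
  qed
  have "q \<longlonglongrightarrow> shock_speed f (cm * E t0) (cM * E t0)"
  proof (cases "cm = cM")
    case False
    \<comment> \<open>Subtraction eliminates the increment of \<open>V\<close> and leaves the
      Rankine-Hugoniot relation.\<close>
    have "(\<lambda>n. (\<omega> n - cM * q n) - (\<omega> n - cm * q n)) \<longlonglongrightarrow> - flx cM t0 - (- flx cm t0)"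
      by (intro tendsto_diff key approx_m approx_M)
    then have "(\<lambda>n. (cm - cM) * q n) \<longlonglongrightarrow> flx cm t0 - flx cM t0" by (simp add: algebra_simps)
    then have "(\<lambda>n. (cm - cM) * q n / (cm - cM)) \<longlonglongrightarrow> (flx cm t0 - flx cM t0) / (cm - cM)"
      using False by (intro tendsto_divide tendsto_const) auto
    moreover have "(flx cm t0 - flx cM t0) / (cm - cM) = shock_speed f (cm * E t0) (cM * E t0)"
    proof -
      have e1: "flx cm t0 - flx cM t0 = (f (cm * E t0) - f (cM * E t0)) / E t0"
        by (simp add: flx_def exp_minus divide_inverse algebra_simps)
      have e2: "cm * E t0 - cM * E t0 = E t0 * (cm - cM)" by (simp add: algebra_simps)
      show ?thesis unfolding e1 shock_speed_def e2 using False by simp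
    qed
    ultimately show ?thesis using False by simp
  next
    case True
    have all_lim: "cn \<longlonglongrightarrow> cm" if e: "\<And>n. ext (cn n) (\<sigma>n n) (X (b n)) (b n)" for cn \<sigma>n
      by (rule seq_lim[OF e _ _ _ A(2,4), of UNIV]) (use ext True in \<open>auto intro: antisym\<close>)
    \<comment> \<open>The earlier point of the curve lies in the triangle of the later one, so
      extremal curves of the later point pass on both sides of it.\<close>
    have tri_ab: "tri (X (b n)) (b n) (X (a n)) (a n)" for n
      using mono[of "a n" "b n" "X (a n)" "a n"] A(5,6)[of n] Xnn[of "a n"] t0 by (auto simp: tri_def)
    have "\<exists>c \<sigma>. ext c \<sigma> (X (b n)) (b n) \<and> X (a n) \<le> zc (X (b n)) (b n) c (a n)" for n
      using tri_ab[of n] A(5)[of n] by (auto simp: tri_def above_tri_def)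
    then obtain c1 \<sigma>1 where c1: "\<And>n. ext (c1 n) (\<sigma>1 n) (X (b n)) (b n)" "\<And>n. X (a n) \<le> zc (X (b n)) (b n) (c1 n) (a n)" by metis
    have "\<exists>c \<sigma>. ext c \<sigma> (X (b n)) (b n) \<and> zc (X (b n)) (b n) c (a n) \<le> X (a n)" for n
    proof -
      have "X (b n) \<noteq> 0" using A(4)[of n] x0 by (auto simp: near_def)
      then obtain c \<sigma> where c: "ext c \<sigma> (X (b n)) (b n)" "a n < \<sigma> \<or> zc (X (b n)) (b n) c (a n) \<le> X (a n)"
        using tri_ab[of n] A(5)[of n] by (auto simp: tri_def below_tri_def)
      then show ?thesis using foot(1)[OF c(1) A(4)] \<theta>1 A(6)[of n] by force
    qed
    then obtain c2 \<sigma>2 where c2: "\<And>n. ext (c2 n) (\<sigma>2 n) (X (b n)) (b n)" "\<And>n. zc (X (b n)) (b n) (c2 n) (a n) \<le> X (a n)" by metis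
    have t0': "0 \<le> t0" using t0 by simp
    have "q \<longlonglongrightarrow> spd cm t0"
    proof (rule tendsto_sandwich[OF _ _ mean_flux_tendsto(1)[OF all_lim[OF c1(1)] A(1,2,6,5) t0'] mean_flux_tendsto(1)[OF all_lim[OF c2(1)] A(1,2,6,5) t0']])
      have "F (a n) (b n) (c1 n) / (b n - a n) \<le> q n" "q n \<le> F (a n) (b n) (c2 n) / (b n - a n)" for n
        unfolding q_def using c1(2)[of n] c2(2)[of n] A(5)[of n] by (intro divide_right_mono; simp add: zc_def)+
      then show "\<forall>\<^sub>F n in sequentially. F (a n) (b n) (c1 n) / (b n - a n) \<le> q n"
        "\<forall>\<^sub>F n in sequentially. q n \<le> F (a n) (b n) (c2 n) / (b n - a n)" by auto
    qed
    then show ?thesis using True by (simp add: shock_speed_def spd_def)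
  qed
  then have "(\<lambda>n. (X (bn (n + N)) - X (an (n + N))) / (bn (n + N) - an (n + N))) \<longlonglongrightarrow> shock_speed f (cm * E t0) (cM * E t0)"
    by (simp add: q_def a_def b_def)
  then show ?thesis by (rule LIMSEQ_offset)
qed

lemma forward_speed:
  assumes "0 < t0" "0 < X t0" "\<And>t. t0 \<le> t \<Longrightarrow> 0 \<le> X t" "L-lipschitz_on {t0..t0 + 1} X"
    "\<And>s t \<xi> \<theta>. t0 \<le> s \<Longrightarrow> s \<le> t \<Longrightarrow> tri (X s) s \<xi> \<theta> \<Longrightarrow> tri (X t) t \<xi> \<theta>"
    "ext cm \<sigma>m (X t0) t0" "ext cM \<sigma>M (X t0) t0" "\<And>c \<sigma>. ext c \<sigma> (X t0) t0 \<Longrightarrow> cm \<le> c \<and> c \<le> cM"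
  shows "has_forward_speed X (shock_speed f (cm * E t0) (cM * E t0)) t0"
  unfolding has_forward_speed_def tendsto_at_iff_sequentially
proof (intro allI impI)
  fix p :: "nat \<Rightarrow> real \<times> real"
  assume p: "\<forall>i. p i \<in> {(t'', t'). t0 \<le> t'' \<and> t0 \<le> t' \<and> t'' \<noteq> t'} - {(t0, t0)}" "p \<longlonglongrightarrow> (t0, t0)"
  have P: "t0 \<le> fst (p i)" "t0 \<le> snd (p i)" "fst (p i) \<noteq> snd (p i)" for i using p(1) by (auto simp: case_prod_unfold)
  \<comment> \<open>The difference quotient is symmetric in its two times, so they may be put in
    order.\<close>
  define an bn where "an = (\<lambda>i. min (fst (p i)) (snd (p i)))" and "bn = (\<lambda>i. max (fst (p i)) (snd (p i)))"
  have l: "(\<lambda>i. fst (p i)) \<longlonglongrightarrow> t0" "(\<lambda>i. snd (p i)) \<longlonglongrightarrow> t0" using tendsto_fst[OF p(2)] tendsto_snd[OF p(2)] by auto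
  have "an \<longlonglongrightarrow> t0" "bn \<longlonglongrightarrow> t0" unfolding an_def bn_def using tendsto_min[OF l] tendsto_max[OF l] by auto
  moreover have "t0 \<le> an i" "an i < bn i" for i using P[of i] by (auto simp: an_def bn_def)
  ultimately have lim: "(\<lambda>n. (X (bn n) - X (an n)) / (bn n - an n)) \<longlonglongrightarrow> shock_speed f (cm * E t0) (cM * E t0)"
    by (intro speed_pair_limit[OF assms(1,2) _ assms(4) _ assms(6,7)]) (use assms(3,5,8) in blast)+
  have "(X (bn n) - X (an n)) / (bn n - an n) = ((\<lambda>(t'', t'). (X t'' - X t') / (t'' - t')) \<circ> p) n" for n
    using diff_divide_diff_flip[of "X (fst (p n))" "X (snd (p n))" "fst (p n)" "snd (p n)"]
    by (auto simp: an_def bn_def case_prod_unfold min_def max_def)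
  then show "((\<lambda>(t'', t'). (X t'' - X t') / (t'' - t')) \<circ> p) \<longlonglongrightarrow> shock_speed f (cm * E t0) (cM * E t0)"
    using lim by (simp add: o_def)
qed

text \<open>The dictionary between outermost parameters and values of \<open>h\<close>:
  \<open>cm\<close> belongs to the right boundary of the triangle, \<open>cM\<close> to the left
  one.\<close>

lemma ext_range:
  assumes x: "0 < x" "0 < t"
  obtains cm cM \<sigma>m \<sigma>M where "ext cm \<sigma>m x t" "ext cM \<sigma>M x t" "\<And>c \<sigma>. ext c \<sigma> x t \<Longrightarrow> cm \<le> c \<and> c \<le> cM"
    "mA x t < mB x t \<Longrightarrow> hA f \<alpha> (x - y_low f \<alpha> u0 x t) t = cM \<and> hA f \<alpha> (x - y_up f \<alpha> u0 x t) t = cm"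
    "mB x t < mA x t \<Longrightarrow> hB f \<alpha> x t (tau_low f \<alpha> u0 ub x t) = cm \<and> hB f \<alpha> x t (tau_up f \<alpha> u0 ub x t) = cM"
    "mA x t = mB x t \<Longrightarrow> hA f \<alpha> (x - y_up f \<alpha> u0 x t) t = cm \<and> hB f \<alpha> x t (tau_up f \<alpha> u0 ub x t) = cM"
proof -
  have x0: "0 \<le> x" using x by simp
  consider "mA x t < mB x t" | "mB x t < mA x t" | "mA x t = mB x t" by linarith
  then show ?thesis
  proof cases
    case 1
    note l = y_low_max[OF x 1]
    note u = y_up_min[OF x0 x(2) l(1)]
    show ?thesis
      by (rule that[of "jp 0 t (x - y_up f \<alpha> u0 x t)" 0 "jp 0 t (x - y_low f \<alpha> u0 x t)" 0])
        (use l u 1 x in \<open>auto simp: hA_eq\<close>)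
  next
    case 2
    have b: "mB x t = V x t" using minA_or_minB[OF x] minB_ge[OF x0 x(2)] 2 by auto
    note l = tau_low_min[OF x0 x(2) b 2]
    note u = tau_up_max[OF x b]
    have e: "ext (jp (tau_low f \<alpha> u0 ub x t) t x) (tau_low f \<alpha> u0 ub x t) x t" "tau_low f \<alpha> u0 ub x t < t"
      using l(1) x by auto
    show ?thesis
      by (rule that[of "jp (tau_low f \<alpha> u0 ub x t) t x" "tau_low f \<alpha> u0 ub x t"
            "jp (tau_up f \<alpha> u0 ub x t) t x" "tau_up f \<alpha> u0 ub x t"])
        (use l(2) u e extD(1)[OF e(1)] 2 in \<open>auto simp: hB_eq\<close>)
  next
    case 3
    have b: "mA x t = V x t" "mB x t = V x t" using minA_or_minB[OF x] 3 by auto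
    note l = y_up_min[OF x0 x(2) b(1)]
    note u = tau_up_max[OF x b(2)]
    show ?thesis
      by (rule that[of "jp 0 t (x - y_up f \<alpha> u0 x t)" 0 "jp (tau_up f \<alpha> u0 ub x t) t x" "tau_up f \<alpha> u0 ub x t"])
        (use l u 3 x in \<open>auto simp: hA_eq hB_eq\<close>)
  qed
qed

section \<open>Construction and uniqueness of the curve\<close>

lemma tri_lipschitz:
  assumes x1: "0 < x1" "0 < t1"
    and X: "\<And>t. t1 \<le> t \<Longrightarrow> 0 \<le> X t" "\<And>s t. t1 \<le> s \<Longrightarrow> s \<le> t \<Longrightarrow> tri (X t) t (X s) s"
  shows "\<exists>L. L-lipschitz_on {t1..T} X"
proof -
  obtain S where S: "0 \<le> S" "\<And>c \<sigma> x t' a b. ext c \<sigma> x t' \<Longrightarrow> t' \<le> T \<Longrightarrow> 0 \<le> a \<Longrightarrow> a \<le> b \<Longrightarrow> b \<le> T \<Longrightarrow> \<bar>F a b c\<bar> \<le> S * (b - a)"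
    using ext_speed_bound[of T] by metis
  have *: "\<bar>X t - X s\<bar> \<le> S * (t - s)" if st: "t1 \<le> s" "s < t" "t \<le> T" for s t
  proof -
    have s0: "0 \<le> s" using st x1 by simp
    have a: "above_tri (X t) t (X s) s" "below_tri (X t) t (X s) s" using X(2)[of s t] st by (auto simp: tri_def)
    obtain c \<sigma> where c: "ext c \<sigma> (X t) t" "X s \<le> zc (X t) t c s" using a(1) by (auto simp: above_tri_def)
    have 1: "- (S * (t - s)) \<le> X t - X s"
      using c(2) S(2)[OF c(1) st(3) s0, of t] st by (auto simp: zc_def abs_le_iff)
    have 2: "X t - X s \<le> S * (t - s)"
    proof (cases "X t = 0")
      case True
      moreover have "0 \<le> S * (t - s)" using S(1) st by simp
      ultimately show ?thesis using X(1)[of s] st by simp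
    next
      case False
      then obtain c' \<sigma>' where c': "ext c' \<sigma>' (X t) t" "s < \<sigma>' \<or> zc (X t) t c' s \<le> X s" using a(2) by (auto simp: below_tri_def)
      show ?thesis
      proof (cases "s < \<sigma>'")
        case True
        \<comment> \<open>The extremal curve leaves the axis after time \<open>s\<close>, so it
          covers the whole distance \<open>X t\<close> in less time than
          \<open>t - s\<close>.\<close>
        then have "X t = F \<sigma>' t c'" using extD(4)[OF c'(1)] s0 by (auto simp: zc_def)
        also have "\<dots> \<le> S * (t - \<sigma>')" using S(2)[OF c'(1) st(3), of \<sigma>' t] extD(1,2)[OF c'(1)] st by auto
        also have "\<dots> \<le> S * (t - s)" using S(1) True by (intro mult_left_mono) auto
        finally show ?thesis using X(1)[of s] st by simp
      next
        case False
        then show ?thesis using c' S(2)[OF c'(1) st(3) s0, of t] st by (auto simp: zc_def abs_le_iff)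
      qed
    qed
    show ?thesis using 1 2 by (simp add: abs_le_iff)
  qed
  have "S-lipschitz_on {t1..T} X"
  proof (rule lipschitz_onI)
    fix s t assume "s \<in> {t1..T}" "t \<in> {t1..T}"
    then show "dist (X s) (X t) \<le> S * dist s t"
      using *[of s t] *[of t s] by (cases s t rule: linorder_cases) (auto simp: dist_real_def abs_minus_commute)
  qed (rule S)
  then show ?thesis by blast
qed

text \<open>Uniqueness rests on this: any increasing curve keeps its initial point in all its
  triangles, which already determines its position at every later time.\<close>

lemma increasing_triangle_curve_tri:
  assumes x1: "0 < x1" "0 < t1" and Y: "increasing_triangle_curve f \<alpha> u0 ub x1 t1 Y" and t: "t1 \<le> t"
  shows "0 \<le> Y t" "tri (Y t) t x1 t1"
proof -
  show Yt: "0 \<le> Y t" using Y t by (simp add: increasing_triangle_curve_def)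
  have "Y t1 = x1" "\<forall>s t. t1 \<le> s \<and> s \<le> t \<longrightarrow> char_triangle f \<alpha> u0 ub (Y s) s \<subseteq> char_triangle f \<alpha> u0 ub (Y t) t"
    using Y by (simp_all add: increasing_triangle_curve_def)
  then have "Y t1 = x1" "char_triangle f \<alpha> u0 ub (Y t1) t1 \<subseteq> char_triangle f \<alpha> u0 ub (Y t) t"
    using t by blast+
  moreover have "(x1, t1) \<in> char_triangle f \<alpha> u0 ub x1 t1"
    using x1 by (subst char_triangle_iff) (auto simp: tri_def)
  ultimately show "tri (Y t) t x1 t1" using char_triangle_iff[OF Yt, of t x1 t1] t x1 by auto
qed

lemma increasing_triangle_curve_exists:
  assumes x1: "0 < x1" "0 < t1"
  obtains X where "increasing_triangle_curve f \<alpha> u0 ub x1 t1 X"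
    "\<And>t. t1 \<le> t \<Longrightarrow> 0 \<le> X t" "\<And>t. t1 \<le> t \<Longrightarrow> tri (X t) t x1 t1"
    "\<And>s t \<xi> \<theta>. t1 \<le> s \<Longrightarrow> s \<le> t \<Longrightarrow> tri (X s) s \<xi> \<theta> \<Longrightarrow> tri (X t) t \<xi> \<theta>"
    "\<And>T. \<exists>L. L-lipschitz_on {t1..T} X"
proof -
  have "\<forall>t. \<exists>x. t1 \<le> t \<longrightarrow> 0 \<le> x \<and> tri x t x1 t1" using tri_exists[OF x1] by blast
  then obtain X where X: "\<And>t. t1 \<le> t \<Longrightarrow> 0 \<le> X t" "\<And>t. t1 \<le> t \<Longrightarrow> tri (X t) t x1 t1" by metis
  have mono: "tri (X t) t \<xi> \<theta>" if "t1 \<le> s" "s \<le> t" "tri (X s) s \<xi> \<theta>" for s t \<xi> \<theta>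
    using tri_mono[OF X(2) X(2) x1 that(1,2) X(1) X(1) that(3)] that by auto
  have ts: "tri (X t) t (X s) s" if "t1 \<le> s" "s \<le> t" for s t
    using mono[OF that] X(1)[of s] that x1 by (simp add: tri_def)
  have lip: "\<exists>L. L-lipschitz_on {t1..T} X" for T by (rule tri_lipschitz[OF x1 X(1) ts])
  have "X t1 = x1" using X(2)[of t1] by (simp add: tri_def)
  moreover have "char_triangle f \<alpha> u0 ub (X s) s \<subseteq> char_triangle f \<alpha> u0 ub (X t) t" if "t1 \<le> s" "s \<le> t" for s t
  proof (rule subrelI)
    fix \<xi> \<theta> assume "(\<xi>, \<theta>) \<in> char_triangle f \<alpha> u0 ub (X s) s"
    then show "(\<xi>, \<theta>) \<in> char_triangle f \<alpha> u0 ub (X t) t"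
      using char_triangle_iff[OF X(1)] mono[OF that] that x1 by auto
  qed
  ultimately have "increasing_triangle_curve f \<alpha> u0 ub x1 t1 X"
    using X(1) lip by (simp add: increasing_triangle_curve_def)
  then show ?thesis using that X mono lip by blast
qed

end

lemma shock_speed_commute: "shock_speed f a b = shock_speed f b a"
  using diff_divide_diff_flip[of "f a" "f b" a b] by (auto simp: shock_speed_def)

theorem theorem3p1:
  fixes f \<alpha> u0 ub :: "real \<Rightarrow> real" and t1 :: real
  assumes f_C2: "C2_fun f"
    and f_convex: "strictly_convex f"
    and f_superlinear: "filterlim (\<lambda>u. f u / \<bar>u\<bar>) at_top at_infinity"
    and alpha: "Linf_halfline \<alpha>"
    and u0: "Linf_halfline u0"
    and ub: "BV_halfline ub"
    and t1: "0 < t1"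
  shows "\<forall>x1>0. \<exists>X.
    increasing_triangle_curve f \<alpha> u0 ub x1 t1 X \<and>
    (\<forall>Y. increasing_triangle_curve f \<alpha> u0 ub x1 t1 Y \<longrightarrow> (\<forall>t\<ge>t1. Y t = X t)) \<and>
    (\<forall>x t. t1 \<le> t \<and> x = X t \<and> 0 < x \<longrightarrow>
      (\<exists>D. has_forward_speed X D t \<and>
        (minA f \<alpha> u0 x t < minB f \<alpha> u0 ub x t \<longrightarrow>
          (y_low f \<alpha> u0 x t = y_up f \<alpha> u0 x t \<longrightarrow>
             D = deriv f (hA f \<alpha> (x - y_low f \<alpha> u0 x t) t * exp (beta \<alpha> t))) \<and>
          (y_low f \<alpha> u0 x t < y_up f \<alpha> u0 x t \<longrightarrow>
             D = shock_speed f (hA f \<alpha> (x - y_low f \<alpha> u0 x t) t * exp (beta \<alpha> t))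
                               (hA f \<alpha> (x - y_up f \<alpha> u0 x t) t * exp (beta \<alpha> t)))) \<and>
        (minB f \<alpha> u0 ub x t < minA f \<alpha> u0 x t \<longrightarrow>
          (tau_low f \<alpha> u0 ub x t = tau_up f \<alpha> u0 ub x t \<longrightarrow>
             D = deriv f (hB f \<alpha> x t (tau_low f \<alpha> u0 ub x t) * exp (beta \<alpha> t))) \<and>
          (tau_low f \<alpha> u0 ub x t < tau_up f \<alpha> u0 ub x t \<longrightarrow>
             D = shock_speed f (hB f \<alpha> x t (tau_low f \<alpha> u0 ub x t) * exp (beta \<alpha> t))
                               (hB f \<alpha> x t (tau_up f \<alpha> u0 ub x t) * exp (beta \<alpha> t)))) \<and>
        (minA f \<alpha> u0 x t = minB f \<alpha> u0 ub x t \<and>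
         (y_up f \<alpha> u0 x t \<noteq> 0 \<or> tau_up f \<alpha> u0 ub x t \<noteq> 0) \<longrightarrow>
             D = shock_speed f (hA f \<alpha> (x - y_up f \<alpha> u0 x t) t * exp (beta \<alpha> t))
                               (hB f \<alpha> x t (tau_up f \<alpha> u0 ub x t) * exp (beta \<alpha> t))) \<and>
        (minA f \<alpha> u0 x t = minB f \<alpha> u0 ub x t \<and>
         y_up f \<alpha> u0 x t = 0 \<and> tau_up f \<alpha> u0 ub x t = 0 \<longrightarrow>
             D = deriv f (hA f \<alpha> x t * exp (beta \<alpha> t)))))"
proof (intro allI impI, goal_cases)
  case (1 x1)
  interpret halfline f \<alpha> u0 ub
    by unfold_locales (fact f_C2 f_convex f_superlinear alpha u0 ub)+
  obtain X where X: "increasing_triangle_curve f \<alpha> u0 ub x1 t1 X"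
    "\<And>t. t1 \<le> t \<Longrightarrow> 0 \<le> X t" "\<And>t. t1 \<le> t \<Longrightarrow> tri (X t) t x1 t1"
    "\<And>s t \<xi> \<theta>. t1 \<le> s \<Longrightarrow> s \<le> t \<Longrightarrow> tri (X s) s \<xi> \<theta> \<Longrightarrow> tri (X t) t \<xi> \<theta>"
    "\<And>T. \<exists>L. L-lipschitz_on {t1..T} X"
    using increasing_triangle_curve_exists[OF 1 t1] by blast
  show ?case
  proof (intro exI[of _ X] conjI allI impI, goal_cases)
    case (2 Y t)
    then show ?case
      using tri_unique[OF _ X(3) _ X(2) 1 t1] increasing_triangle_curve_tri[OF 1 t1] by blast
  next
    case (3 x t)
    then have t: "t1 \<le> t" "x = X t" "0 < x" "0 < t" using t1 by auto
    show ?case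
    proof (rule ext_range[OF t(3,4)])
      fix cm cM \<sigma>m \<sigma>M
      assume c: "ext cm \<sigma>m x t" "ext cM \<sigma>M x t" "\<And>c \<sigma>. ext c \<sigma> x t \<Longrightarrow> cm \<le> c \<and> c \<le> cM"
        and A: "mA x t < mB x t \<Longrightarrow> hA f \<alpha> (x - y_low f \<alpha> u0 x t) t = cM \<and> hA f \<alpha> (x - y_up f \<alpha> u0 x t) t = cm"
        and B: "mB x t < mA x t \<Longrightarrow> hB f \<alpha> x t (tau_low f \<alpha> u0 ub x t) = cm \<and> hB f \<alpha> x t (tau_up f \<alpha> u0 ub x t) = cM"
        and AB: "mA x t = mB x t \<Longrightarrow> hA f \<alpha> (x - y_up f \<alpha> u0 x t) t = cm \<and> hB f \<alpha> x t (tau_up f \<alpha> u0 ub x t) = cM"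
      \<comment> \<open>One value serves all cases: equal outermost parameters give
        \<open>deriv f\<close>, and when both feet are the origin, h(x,t) and h(x,t,0) are the same
        parameter.\<close>
      define D where "D = shock_speed f (cm * exp (beta \<alpha> t)) (cM * exp (beta \<alpha> t))"
      obtain L where "L-lipschitz_on {t1..t + 1} X" using X(5) by blast
      then have L: "L-lipschitz_on {t..t + 1} X" by (rule lipschitz_on_subset) (use t in auto)
      have m: "tri (X v) v \<xi> \<theta>" if "t \<le> s" "s \<le> v" "tri (X s) s \<xi> \<theta>" for s v \<xi> \<theta>
        using X(4)[OF _ that(2,3)] that(1) t(1) by simp
      have "has_forward_speed X D t"
        unfolding D_def by (rule forward_speed[OF t(4) _ _ L m]) (use t c X(2) in auto)
      moreover have "shock_speed f a a = deriv f a" for a by (simp add: shock_speed_def)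
      moreover have "hA f \<alpha> x t = hB f \<alpha> x t 0" by (simp add: hA_def hB_def)
      ultimately show ?case
        using A B AB shock_speed_commute[of f "cm * exp (beta \<alpha> t)" "cM * exp (beta \<alpha> t)"]
        by (intro exI[of _ D]) (auto simp: D_def)
    qed
  qed (rule X(1))
qed

end
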